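(* Let $(\mathbf E,\mathsf K)$ be an exact DG-pair, and let $(\mathbf F,\mathsf L),(\mathbf G,\mathsf M)\subset(\mathbf E,\mathsf K)$ be exact DG-subpairs. (a) Assume that the full subcategory $\mathsf L$ is self-resolving in the exact category $\mathsf K$. Then the triangulated functor $\mathsf D^{\mathsf{abs}}(\mathbf F)\to\mathsf D^{\mathsf{abs}}(\mathbf E)$ induced by the inclusion of exact DG-categories $\mathbf F\to\mathbf E$ is fully faithful. Furthermore, if the exact DG-category $\mathbf E$ has exact products and the full DG-subcategory $\mathbf F\subset\mathbf E$ is closed under products, then the induced triangulated functor $\mathsf D^{\mathsf{ctr}}(\mathbf F)\to\mathsf D^{\mathsf{ctr}}(\mathbf E)$ is fully faithful. (b) Assume that the full subcategory $\mathsf M$ is self-coresolving in the exact category $\mathsf K$. Then the triangulated functor $\mathsf D^{\mathsf{abs}}(\mathbf G)\to\mathsf D^{\mathsf{abs}}(\mathbf E)$ induced by the inclusion of exact DG-categories $\mathbf G\to\mathbf E$ is fully faithful. Furthermore, if the exact DG-category $\mathbf E$ has exact coproducts and the full DG-subcategory $\mathbf G\subset\mathbf E$ is closed under coproducts, then the induced triangulated functor $\mathsf D^{\mathsf{co}}(\mathbf G)\to\mathsf D^{\mathsf{co}}(\mathbf E)$ is fully faithful.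
   Context: Gradings: fix an abelian group $\Gamma$, a symmetric bilinear form $\sigma\colon\Gamma\times\Gamma\to\mathbb Z/2$ and an element $\mathbf 1\in\Gamma$ with $\sigma(\mathbf 1,\mathbf 1)=1$; complexes are $\Gamma$-graded with differentials of degree $\mathbf 1$ (an integer $n$ denotes $n\cdot\mathbf 1$; $(-1)^i$ means $(-1)^{\sigma(\mathbf 1,i)}$), with the Koszul sign rule (standard case: $\Gamma=\mathbb Z$). A DG-category $\mathbf A$ is a category enriched in complexes of abelian groups; $\mathsf Z^0(\mathbf A)$ and $\mathsf H^0(\mathbf A)$ have the same objects and the degree-$0$ cocycles (closed morphisms), resp. the degree-$0$ cohomology, of $\operatorname{Hom}^\bullet_{\mathbf A}(X,Y)$ as morphisms; $\mathbf A$ is additive if $\mathsf Z^0(\mathbf A)$ is. Shifts $X[i]$: objects with mutually inverse closed morphisms in $\operatorname{Hom}^{-i}(X,X[i])$ and $\operatorname{Hom}^{i}(X[i],X)$. The cone of a closed degree-$0$ morphism $X\to Y$ represents, functorially in $Z$, the cone of $\operatorname{Hom}^\bullet(Z,X)\to\operatorname{Hom}^\bullet(Z,Y)$. (Co)products in $\mathbf A$: objects with $\operatorname{Hom}^\bullet(\coprod X_\alpha,Z)\simeq\prod\operatorname{Hom}^\bullet(X_\alpha,Z)$, resp. $\operatorname{Hom}^\bullet(Z,\prod Y_\alpha)\simeq\prod\operatorname{Hom}^\bullet(Z,Y_\alpha)$, functorially in $Z$. For additive $\mathbf A$ with shifts and cones, $\mathsf H^0(\mathbf A)$ is triangulated,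 and every finite complex in $\mathsf Z^0(\mathbf A)$ has a totalization (an iterated cone) in $\mathbf A$. The DG-category $\mathbf E^\natural$: objects $(X,\sigma_X)$ with $X\in\mathbf E$, $\sigma_X\in\operatorname{Hom}^{-1}_{\mathbf E}(X,X)$, $d(\sigma_X)=\mathrm{id}_X$, $\sigma_X^2=0$; $\operatorname{Hom}^i_{\mathbf E^\natural}((X,\sigma_X),(Y,\sigma_Y))$ is the group of closed morphisms $X\to Y$ of degree $-i$ in $\mathbf E$, with differential $f\mapsto\sigma_Yf-(-1)^if\sigma_X$. $\Phi_{\mathbf E}\colon\mathsf Z^0(\mathbf E)\to\mathsf Z^0(\mathbf E^\natural)$ takes $A$ to $\operatorname{cone}(\mathrm{id}_A[-1])$ with its natural contracting homotopy ($\iota'\pi'$, where $\pi'\colon\operatorname{cone}(\mathrm{id}_A[-1])\to A$ of degree $-1$ and $\iota'\colon A\to\operatorname{cone}(\mathrm{id}_A[-1])$ of degree $0$ are the canonical nonclosed projection and injection); $\Psi^+_{\mathbf E}(X,\sigma_X)=X$. An exact DG-category is an additive DG-category $\mathbf E$ with shifts and cones endowed with (Quillen) exact category structures on both $\mathsf Z^0(\mathbf E)$ and $\mathsf Z^0(\mathbf E^\natural)$ which are preserved by the shifts $[1],[-1]$ and such that both $\Phi_{\mathbf E}$ and $\Psi^+_{\mathbf E}$ preserve and reflect admissible short exact sequences. $\mathbf E$ has exact coproducts (products) if all infinite coproducts (products) exist in the DG-category $\mathbf E$ and (co)products of short exact sequences in $\mathsf Z^0(\mathbf E)$ (equivalently,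 in $\mathsf Z^0(\mathbf E^\natural)$) are short exact. $\mathsf{Ac}^{\mathsf{abs}}(\mathbf E)\subset\mathsf H^0(\mathbf E)$ is the minimal thick subcategory containing the totalizations of all short exact sequences in $\mathsf Z^0(\mathbf E)$; $\mathsf{Ac}^{\mathsf{co}}(\mathbf E)$ (resp. $\mathsf{Ac}^{\mathsf{ctr}}(\mathbf E)$), for $\mathbf E$ with exact coproducts (products), is the minimal triangulated subcategory containing these totalizations and closed under coproducts (products). $\mathsf D^{\star}(\mathbf E)=\mathsf H^0(\mathbf E)/\mathsf{Ac}^{\star}(\mathbf E)$ for $\star=\mathsf{abs},\mathsf{co},\mathsf{ctr}$. A full additive subcategory $\mathsf L$ of an exact category $\mathsf K$ inherits an exact structure if the class of all short exact sequences of $\mathsf K$ with terms in $\mathsf L$ is an exact structure on $\mathsf L$. A full additive DG-subcategory $\mathbf F\subset\mathbf E$ closed under shifts and cones inherits an exact DG-category structure if $\mathsf Z^0(\mathbf F)\subset\mathsf Z^0(\mathbf E)$ and $\mathsf Z^0(\mathbf F^\natural)\subset\mathsf Z^0(\mathbf E^\natural)$ both inherit exact structures. An exact DG-pair $(\mathbf E,\mathsf K)$ is an exact DG-category $\mathbf E$ with a full subcategory $\mathsf K\subset\mathsf Z^0(\mathbf E^\natural)$ preserved by $[1],[-1]$, containing the image of $\Phi_{\mathbf E}$, and inheriting an exact structure. An exact DG-subpair $(\mathbf F,\mathsf L)\subset(\mathbf E,\mathsf K)$ consists of a full DG-subcategory $\mathbf F\subset\mathbf E$ inheriting an exact DG-category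 structure and a full subcategory $\mathsf L\subset\mathsf K$ preserved by $[1],[-1]$ and inheriting an exact structure, such that $\mathsf L\subset\mathsf Z^0(\mathbf F^\natural)$ and $\Phi_{\mathbf E}(F)\in\mathsf L$ for all $F\in\mathbf F$. A full subcategory $\mathsf L$ of an exact category $\mathsf K$ is self-resolving if it inherits an exact structure, is closed under kernels of admissible epimorphisms in $\mathsf K$, and for any $L\in\mathsf L$, $K\in\mathsf K$ and admissible epimorphism $K\to L$ in $\mathsf K$ there exist $L'\in\mathsf L$, an admissible epimorphism $L'\to L$ and a morphism $L'\to K$ such that $L'\to K\to L$ equals $L'\to L$. Self-coresolving is the dual notion (inherits an exact structure, closed under cokernels of admissible monomorphisms, and for any admissible monomorphism $L\to K$ with $L\in\mathsf L$ there are an admissible monomorphism $L\to L'$ with $L'\in\mathsf L$ and a morphism $K\to L'$ making the triangle commute). *)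

theory Defs
  imports "HOL-Library.Z2" "HOL-Library.FuncSet"
begin

section \<open>Preadditive categories and exact categories\<close>

text \<open>
  A preadditive category is given as a ``ring with several objects'': its groups of morphisms are
  additive subgroups of one (possibly non-unital) associative ring, and composition is the
  multiplication of that ring, \<open>g * f\<close> meaning first \<open>f\<close>, then \<open>g\<close>.  This is no loss of
  generality: for an arbitrary preadditive category take the direct sum of all its groups of
  morphisms, with matrix multiplication.  The subgroups need not be disjoint, so a morphism does
  not determine its source and target.
\<close>

record ('o, 'm) lincat =
  obj :: "'o set"
  mor :: "'o \<Rightarrow> 'o \<Rightarrow> 'm set"
  idm :: "'o \<Rightarrow> 'm"

locale preadditive_category =
  fixes C :: "('o, 'm::ring) lincat"
  assumes zero_mor: "\<lbrakk>X \<in> obj C; Y \<in> obj C\<rbrakk> \<Longrightarrow> 0 \<in> mor C X Y"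
    and add_mor: "\<lbrakk>X \<in> obj C; Y \<in> obj C; f \<in> mor C X Y; g \<in> mor C X Y\<rbrakk> \<Longrightarrow> f + g \<in> mor C X Y"
    and uminus_mor: "\<lbrakk>X \<in> obj C; Y \<in> obj C; f \<in> mor C X Y\<rbrakk> \<Longrightarrow> - f \<in> mor C X Y"
    and comp_mor: "\<lbrakk>X \<in> obj C; Y \<in> obj C; Z \<in> obj C; f \<in> mor C X Y; g \<in> mor C Y Z\<rbrakk>
                     \<Longrightarrow> g * f \<in> mor C X Z"
    and idm_mor: "X \<in> obj C \<Longrightarrow> idm C X \<in> mor C X X"
    and idm_left: "\<lbrakk>X \<in> obj C; Y \<in> obj C; f \<in> mor C X Y\<rbrakk> \<Longrightarrow> idm C Y * f = f"
    and idm_right: "\<lbrakk>X \<in> obj C; Y \<in> obj C; f \<in> mor C X Y\<rbrakk> \<Longrightarrow> f * idm C X = f"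

definition zero_object :: "('o, 'm::ring) lincat \<Rightarrow> 'o \<Rightarrow> bool" where
  "zero_object C Z \<longleftrightarrow> Z \<in> obj C \<and> (\<forall>X\<in>obj C. mor C X Z = {0} \<and> mor C Z X = {0})"

definition biproduct :: "('o, 'm::ring) lincat \<Rightarrow> 'o \<Rightarrow> 'o \<Rightarrow> 'o \<Rightarrow> bool" where
  "biproduct C X Y B \<longleftrightarrow> B \<in> obj C \<and>
     (\<exists>i\<in>mor C X B. \<exists>j\<in>mor C Y B. \<exists>p\<in>mor C B X. \<exists>q\<in>mor C B Y.
        p * i = idm C X \<and> q * j = idm C Y \<and> q * i = 0 \<and> p * j = 0 \<and> i * p + j * q = idm C B)"

definition additive_category :: "('o, 'm::ring) lincat \<Rightarrow> bool" where
  "additive_category C \<longleftrightarrow> preadditive_category C \<and> (\<exists>Z. zero_object C Z) \<and>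
     (\<forall>X\<in>obj C. \<forall>Y\<in>obj C. \<exists>B. biproduct C X Y B)"

definition iso_mor :: "('o, 'm::ring) lincat \<Rightarrow> 'o \<Rightarrow> 'm \<Rightarrow> 'o \<Rightarrow> bool" where
  "iso_mor C X f Y \<longleftrightarrow> X \<in> obj C \<and> Y \<in> obj C \<and> f \<in> mor C X Y \<and>
     (\<exists>g\<in>mor C Y X. g * f = idm C X \<and> f * g = idm C Y)"

definition is_kernel :: "('o, 'm::ring) lincat \<Rightarrow> 'o \<Rightarrow> 'm \<Rightarrow> 'o \<Rightarrow> 'm \<Rightarrow> 'o \<Rightarrow> bool" where
  "is_kernel C X i Y p Z \<longleftrightarrow> i \<in> mor C X Y \<and> p \<in> mor C Y Z \<and> p * i = 0 \<and>
     (\<forall>W\<in>obj C. \<forall>h\<in>mor C W Y. p * h = 0 \<longrightarrow> (\<exists>!k. k \<in> mor C W X \<and> i * k = h))"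

definition is_cokernel :: "('o, 'm::ring) lincat \<Rightarrow> 'o \<Rightarrow> 'm \<Rightarrow> 'o \<Rightarrow> 'm \<Rightarrow> 'o \<Rightarrow> bool" where
  "is_cokernel C X i Y p Z \<longleftrightarrow> i \<in> mor C X Y \<and> p \<in> mor C Y Z \<and> p * i = 0 \<and>
     (\<forall>W\<in>obj C. \<forall>h\<in>mor C Y W. h * i = 0 \<longrightarrow> (\<exists>!k. k \<in> mor C Z W \<and> k * p = h))"

text \<open>The square with sides \<open>i : X \<rightarrow> Y\<close>, \<open>f : X \<rightarrow> X'\<close>, \<open>f' : Y \<rightarrow> Y'\<close>, \<open>i' : X' \<rightarrow> Y'\<close> is cocartesian.\<close>

definition is_pushout ::
  "('o, 'm::ring) lincat \<Rightarrow> 'o \<Rightarrow> 'm \<Rightarrow> 'o \<Rightarrow> 'm \<Rightarrow> 'o \<Rightarrow> 'm \<Rightarrow> 'm \<Rightarrow> 'o \<Rightarrow> bool" where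
  "is_pushout C X i Y f X' f' i' Y' \<longleftrightarrow> Y' \<in> obj C \<and> f' \<in> mor C Y Y' \<and> i' \<in> mor C X' Y' \<and>
     f' * i = i' * f \<and>
     (\<forall>W\<in>obj C. \<forall>u\<in>mor C Y W. \<forall>v\<in>mor C X' W. u * i = v * f \<longrightarrow>
        (\<exists>!w. w \<in> mor C Y' W \<and> w * f' = u \<and> w * i' = v))"

text \<open>The square with sides \<open>p' : Y' \<rightarrow> Z'\<close>, \<open>f' : Y' \<rightarrow> Y\<close>, \<open>p : Y \<rightarrow> Z\<close>, \<open>f : Z' \<rightarrow> Z\<close> is cartesian.\<close>

definition is_pullback ::
  "('o, 'm::ring) lincat \<Rightarrow> 'o \<Rightarrow> 'm \<Rightarrow> 'o \<Rightarrow> 'm \<Rightarrow> 'o \<Rightarrow> 'm \<Rightarrow> 'm \<Rightarrow> 'o \<Rightarrow> bool" where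
  "is_pullback C Y p Z f Z' f' p' Y' \<longleftrightarrow> Y' \<in> obj C \<and> f' \<in> mor C Y' Y \<and> p' \<in> mor C Y' Z' \<and>
     p * f' = f * p' \<and>
     (\<forall>W\<in>obj C. \<forall>u\<in>mor C W Y. \<forall>v\<in>mor C W Z'. p * u = f * v \<longrightarrow>
        (\<exists>!w. w \<in> mor C W Y' \<and> f' * w = u \<and> p' * w = v))"

text \<open>\<open>(X, i, Y, p, Z)\<close> stands for \<open>X \<rightarrow> Y \<rightarrow> Z\<close> with the morphisms \<open>i\<close> and \<open>p\<close>.\<close>

type_synonym ('o, 'm) seq = "'o \<times> 'm \<times> 'o \<times> 'm \<times> 'o"

definition adm_mono :: "('o, 'm) seq set \<Rightarrow> 'o \<Rightarrow> 'm \<Rightarrow> 'o \<Rightarrow> bool" where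
  "adm_mono S X i Y \<longleftrightarrow> (\<exists>p Z. (X, i, Y, p, Z) \<in> S)"

definition adm_epi :: "('o, 'm) seq set \<Rightarrow> 'o \<Rightarrow> 'm \<Rightarrow> 'o \<Rightarrow> bool" where
  "adm_epi S Y p Z \<longleftrightarrow> (\<exists>X i. (X, i, Y, p, Z) \<in> S)"

locale exact_category =
  fixes C :: "('o, 'm::ring) lincat" and S :: "('o, 'm) seq set"
  assumes additive: "additive_category C"
    and ses_obj: "(X, i, Y, p, Z) \<in> S \<Longrightarrow> X \<in> obj C \<and> Y \<in> obj C \<and> Z \<in> obj C"
    and ses_kernel: "(X, i, Y, p, Z) \<in> S \<Longrightarrow> is_kernel C X i Y p Z"
    and ses_cokernel: "(X, i, Y, p, Z) \<in> S \<Longrightarrow> is_cokernel C X i Y p Z"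
    and ses_iso: "\<lbrakk>(X, i, Y, p, Z) \<in> S; iso_mor C X a X'; iso_mor C Y b Y'; iso_mor C Z c Z';
                   i' \<in> mor C X' Y'; p' \<in> mor C Y' Z'; b * i = i' * a; c * p = p' * b\<rbrakk>
                  \<Longrightarrow> (X', i', Y', p', Z') \<in> S"
    and idm_mono: "X \<in> obj C \<Longrightarrow> adm_mono S X (idm C X) X"
    and idm_epi: "X \<in> obj C \<Longrightarrow> adm_epi S X (idm C X) X"
    and comp_mono: "\<lbrakk>adm_mono S X i Y; adm_mono S Y j Z\<rbrakk> \<Longrightarrow> adm_mono S X (j * i) Z"
    and comp_epi: "\<lbrakk>adm_epi S X p Y; adm_epi S Y q Z\<rbrakk> \<Longrightarrow> adm_epi S X (q * p) Z"
    and pushout_mono: "\<lbrakk>adm_mono S X i Y; X' \<in> obj C; f \<in> mor C X X'\<rbrakk>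
                  \<Longrightarrow> \<exists>f' i' Y'. is_pushout C X i Y f X' f' i' Y' \<and> adm_mono S X' i' Y'"
    and pullback_epi: "\<lbrakk>adm_epi S Y p Z; Z' \<in> obj C; f \<in> mor C Z' Z\<rbrakk>
                  \<Longrightarrow> \<exists>f' p' Y'. is_pullback C Y p Z f Z' f' p' Y' \<and> adm_epi S Y' p' Z'"

text \<open>
  A full subcategory is given by its set of objects, which need not be closed under isomorphisms.
  ``Closed under'' or ``preserved by'' a construction defined up to isomorphism accordingly means
  that some object representing the result belongs to the subcategory.
\<close>

definition seqs_in :: "'o set \<Rightarrow> ('o, 'm) seq set \<Rightarrow> ('o, 'm) seq set" where
  "seqs_in L S = {(X, i, Y, p, Z) \<in> S. X \<in> L \<and> Y \<in> L \<and> Z \<in> L}"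

definition inherits_exact :: "('o, 'm::ring) lincat \<Rightarrow> ('o, 'm) seq set \<Rightarrow> 'o set \<Rightarrow> bool" where
  "inherits_exact C S L \<longleftrightarrow> L \<subseteq> obj C \<and> exact_category (C\<lparr>obj := L\<rparr>) (seqs_in L S)"

definition self_resolving :: "('o, 'm::ring) lincat \<Rightarrow> ('o, 'm) seq set \<Rightarrow> 'o set \<Rightarrow> bool" where
  "self_resolving C S L \<longleftrightarrow> inherits_exact C S L \<and>
     (\<forall>X i Y p Z. (X, i, Y, p, Z) \<in> S \<and> Y \<in> L \<and> Z \<in> L \<longrightarrow> (\<exists>X'\<in>L. \<exists>a. iso_mor C X a X')) \<and>
     (\<forall>Y\<in>obj C. \<forall>Z\<in>L. \<forall>p. adm_epi S Y p Z \<longrightarrow>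
        (\<exists>Z'\<in>L. \<exists>e. adm_epi S Z' e Z \<and> (\<exists>h\<in>mor C Z' Y. p * h = e)))"

definition self_coresolving :: "('o, 'm::ring) lincat \<Rightarrow> ('o, 'm) seq set \<Rightarrow> 'o set \<Rightarrow> bool" where
  "self_coresolving C S L \<longleftrightarrow> inherits_exact C S L \<and>
     (\<forall>X i Y p Z. (X, i, Y, p, Z) \<in> S \<and> X \<in> L \<and> Y \<in> L \<longrightarrow> (\<exists>Z'\<in>L. \<exists>a. iso_mor C Z a Z')) \<and>
     (\<forall>X\<in>L. \<forall>Y\<in>obj C. \<forall>i. adm_mono S X i Y \<longrightarrow>
        (\<exists>X'\<in>L. \<exists>e. adm_mono S X e X' \<and> (\<exists>h\<in>mor C Y X'. h * i = e)))"

section \<open>DG-categories\<close>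

text \<open>
  The record carries the grading datum (the form \<open>sform\<close> and the distinguished element \<open>gone\<close> of
  the grading group \<open>'g\<close>).  Composition is again the multiplication of the ring \<open>'m\<close>.
\<close>

record ('g, 'o, 'm) dgcat =
  sform :: "'g \<Rightarrow> 'g \<Rightarrow> bit"
  gone :: 'g
  Ob :: "'o set"
  Hom :: "'o \<Rightarrow> 'o \<Rightarrow> 'g \<Rightarrow> 'm set"
  Idt :: "'o \<Rightarrow> 'm"
  Diff :: "'o \<Rightarrow> 'o \<Rightarrow> 'g \<Rightarrow> 'm \<Rightarrow> 'm"

text \<open>\<open>ksign A i x\<close> is \<open>(-1)\<^sup>i x\<close>.\<close>

definition ksign :: "('g, 'o, 'm::ring, 'z) dgcat_scheme \<Rightarrow> 'g \<Rightarrow> 'm \<Rightarrow> 'm" where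
  "ksign A i x = (if sform A (gone A) i = 0 then x else - x)"

locale dg_category =
  fixes A :: "('g::ab_group_add, 'o, 'm::ring, 'z) dgcat_scheme"
  assumes sform_sym: "sform A i j = sform A j i"
    and sform_add: "sform A (i + j) k = sform A i k + sform A j k"
    and sform_gone: "sform A (gone A) (gone A) = 1"
    and zero_Hom: "\<lbrakk>X \<in> Ob A; Y \<in> Ob A\<rbrakk> \<Longrightarrow> 0 \<in> Hom A X Y i"
    and add_Hom: "\<lbrakk>X \<in> Ob A; Y \<in> Ob A; f \<in> Hom A X Y i; g \<in> Hom A X Y i\<rbrakk> \<Longrightarrow> f + g \<in> Hom A X Y i"
    and uminus_Hom: "\<lbrakk>X \<in> Ob A; Y \<in> Ob A; f \<in> Hom A X Y i\<rbrakk> \<Longrightarrow> - f \<in> Hom A X Y i"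
    and comp_Hom: "\<lbrakk>X \<in> Ob A; Y \<in> Ob A; Z \<in> Ob A; f \<in> Hom A X Y i; g \<in> Hom A Y Z j\<rbrakk>
                     \<Longrightarrow> g * f \<in> Hom A X Z (i + j)"
    and Idt_Hom: "X \<in> Ob A \<Longrightarrow> Idt A X \<in> Hom A X X 0"
    and Idt_left: "\<lbrakk>X \<in> Ob A; Y \<in> Ob A; f \<in> Hom A X Y i\<rbrakk> \<Longrightarrow> Idt A Y * f = f"
    and Idt_right: "\<lbrakk>X \<in> Ob A; Y \<in> Ob A; f \<in> Hom A X Y i\<rbrakk> \<Longrightarrow> f * Idt A X = f"
    and Diff_Hom: "\<lbrakk>X \<in> Ob A; Y \<in> Ob A; f \<in> Hom A X Y i\<rbrakk> \<Longrightarrow> Diff A X Y i f \<in> Hom A X Y (i + gone A)"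
    and Diff_add: "\<lbrakk>X \<in> Ob A; Y \<in> Ob A; f \<in> Hom A X Y i; g \<in> Hom A X Y i\<rbrakk>
                     \<Longrightarrow> Diff A X Y i (f + g) = Diff A X Y i f + Diff A X Y i g"
    and Diff_Diff: "\<lbrakk>X \<in> Ob A; Y \<in> Ob A; f \<in> Hom A X Y i\<rbrakk>
                     \<Longrightarrow> Diff A X Y (i + gone A) (Diff A X Y i f) = 0"
    and Leibniz: "\<lbrakk>X \<in> Ob A; Y \<in> Ob A; Z \<in> Ob A; f \<in> Hom A X Y i; g \<in> Hom A Y Z j\<rbrakk>
                     \<Longrightarrow> Diff A X Z (i + j) (g * f)
                         = Diff A Y Z j g * f + ksign A j (g * Diff A X Y i f)"

definition Cyc :: "('g::ab_group_add, 'o, 'm::ring, 'z) dgcat_scheme \<Rightarrow> 'o \<Rightarrow> 'o \<Rightarrow> 'g \<Rightarrow> 'm set" where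
  "Cyc A X Y i = {f \<in> Hom A X Y i. Diff A X Y i f = 0}"

definition Z0 :: "('g::ab_group_add, 'o, 'm::ring, 'z) dgcat_scheme \<Rightarrow> ('o, 'm) lincat" where
  "Z0 A = \<lparr>obj = Ob A, mor = (\<lambda>X Y. Cyc A X Y 0), idm = Idt A\<rparr>"

definition is_shift ::
  "('g::ab_group_add, 'o, 'm::ring, 'z) dgcat_scheme \<Rightarrow> 'o \<Rightarrow> 'g \<Rightarrow> 'o \<Rightarrow> 'm \<Rightarrow> 'm \<Rightarrow> bool" where
  "is_shift A X i X' s t \<longleftrightarrow> X \<in> Ob A \<and> X' \<in> Ob A \<and> s \<in> Cyc A X X' (- i) \<and> t \<in> Cyc A X' X i \<and>
     t * s = Idt A X \<and> s * t = Idt A X'"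

text \<open>
  \<open>Hom(Z, C)\<close> is identified with the cone of \<open>Hom(Z, X) \<rightarrow> Hom(Z, Y)\<close>, which in degree \<open>n\<close> consists
  of the pairs \<open>(b, a)\<close> with \<open>b\<close> in \<open>Hom\<^sup>n(Z, Y)\<close> and \<open>a\<close> in \<open>Hom\<^sup>n\<^sup>+\<^sup>1(Z, X)\<close> and has the differential
  \<open>d(b, a) = (db + fa, -da)\<close>.  By the Yoneda lemma an isomorphism functorial in \<open>Z\<close> is given by a
  universal element, that is, a degree \<open>0\<close> cocycle \<open>(q, p)\<close> of the cone for \<open>Z = C\<close>.
\<close>

definition is_cone ::
  "('g::ab_group_add, 'o, 'm::ring, 'z) dgcat_scheme \<Rightarrow> 'o \<Rightarrow> 'm \<Rightarrow> 'o \<Rightarrow> 'o \<Rightarrow> 'm \<Rightarrow> 'm \<Rightarrow> bool" where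
  "is_cone A X f Y C q p \<longleftrightarrow> X \<in> Ob A \<and> Y \<in> Ob A \<and> C \<in> Ob A \<and> f \<in> Cyc A X Y 0 \<and>
     q \<in> Hom A C Y 0 \<and> p \<in> Hom A C X (gone A) \<and>
     Diff A C Y 0 q + f * p = 0 \<and> Diff A C X (gone A) p = 0 \<and>
     (\<forall>Z\<in>Ob A. \<forall>n. \<forall>b\<in>Hom A Z Y n. \<forall>a\<in>Hom A Z X (n + gone A).
        \<exists>!h. h \<in> Hom A Z C n \<and> q * h = b \<and> p * h = a)"

text \<open>Shift of a sequence; the shift of a morphism \<open>f : X \<rightarrow> Y\<close> of degree \<open>0\<close> is \<open>s\<^sub>Y f s\<^sub>X\<close>\<open>\<^sup>-\<^sup>1\<close>.\<close>

fun shift_seq ::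
  "('g::ab_group_add, 'o, 'm::ring, 'z) dgcat_scheme \<Rightarrow> 'g \<Rightarrow> ('o, 'm) seq \<Rightarrow> ('o, 'm) seq \<Rightarrow> bool" where
  "shift_seq A i (X, f, Y, g, Z) (X', f', Y', g', Z') \<longleftrightarrow>
     (\<exists>sx tx sy ty sz tz. is_shift A X i X' sx tx \<and> is_shift A Y i Y' sy ty \<and> is_shift A Z i Z' sz tz \<and>
        f' = sy * f * tx \<and> g' = sz * g * ty)"

definition ses_shift_invariant ::
  "('g::ab_group_add, 'o, 'm::ring, 'z) dgcat_scheme \<Rightarrow> ('o, 'm) seq set \<Rightarrow> bool" where
  "ses_shift_invariant A S \<longleftrightarrow>
     (\<forall>i\<in>{gone A, - gone A}. \<forall>s\<in>S. \<forall>s'. shift_seq A i s s' \<longrightarrow> s' \<in> S)"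

definition obj_shift_invariant ::
  "('g::ab_group_add, 'o, 'm::ring, 'z) dgcat_scheme \<Rightarrow> 'o set \<Rightarrow> bool" where
  "obj_shift_invariant A K \<longleftrightarrow>
     (\<forall>i\<in>{gone A, - gone A}. \<forall>X\<in>K. \<exists>X'\<in>K. \<exists>s t. is_shift A X i X' s t)"

definition closed_under_shifts ::
  "('g::ab_group_add, 'o, 'm::ring, 'z) dgcat_scheme \<Rightarrow> 'o set \<Rightarrow> bool" where
  "closed_under_shifts A F \<longleftrightarrow> (\<forall>X\<in>F. \<forall>i. \<exists>X'\<in>F. \<exists>s t. is_shift A X i X' s t)"

definition closed_under_cones ::
  "('g::ab_group_add, 'o, 'm::ring, 'z) dgcat_scheme \<Rightarrow> 'o set \<Rightarrow> bool" where
  "closed_under_cones A F \<longleftrightarrow>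
     (\<forall>X\<in>F. \<forall>Y\<in>F. \<forall>f\<in>Cyc A X Y 0. \<exists>C\<in>F. \<exists>q p. is_cone A X f Y C q p)"

subsection \<open>The DG-category $A^\natural$ and the functors $\Phi$, $\Psi^+$\<close>

definition natural_dg :: "('g::ab_group_add, 'o, 'm::ring, 'z) dgcat_scheme \<Rightarrow> ('g, 'o \<times> 'm, 'm) dgcat" where
  "natural_dg A = \<lparr>sform = sform A, gone = gone A,
     Ob = {(X, s). X \<in> Ob A \<and> s \<in> Hom A X X (- gone A) \<and> Diff A X X (- gone A) s = Idt A X \<and> s * s = 0},
     Hom = (\<lambda>(X, s) (Y, t) i. Cyc A X Y (- i)),
     Idt = (\<lambda>(X, s). Idt A X),
     Diff = (\<lambda>(X, s) (Y, t) i f. t * f - ksign A i (f * s))\<rparr>"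

text \<open>
  \<open>P\<close> is \<open>\<Phi>(X)\<close>, computed with the shift \<open>X1 = X[-1]\<close> and the cone \<open>(fst P, q, p)\<close> of the identity
  of \<open>X1\<close>.  In coordinates the injection \<open>\<iota>' : X \<rightarrow> fst P\<close> is \<open>(0, s)\<close>, and \<open>t * q\<close> is \<open>\<pi>'\<close>.
\<close>

definition is_Phi ::
  "('g::ab_group_add, 'o, 'm::ring, 'z) dgcat_scheme \<Rightarrow> 'o \<Rightarrow> 'o \<Rightarrow> 'm \<Rightarrow> 'm \<Rightarrow> 'm \<Rightarrow> 'm \<Rightarrow> 'o \<times> 'm \<Rightarrow> bool" where
  "is_Phi A X X1 s t q p P \<longleftrightarrow> is_shift A X (- gone A) X1 s t \<and>
     is_cone A X1 (Idt A X1) X1 (fst P) q p \<and>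
     (\<exists>\<iota>'\<in>Hom A X (fst P) 0. q * \<iota>' = 0 \<and> p * \<iota>' = s \<and> snd P = \<iota>' * (t * q))"

definition Phi_rep :: "('g::ab_group_add, 'o, 'm::ring, 'z) dgcat_scheme \<Rightarrow> 'o \<Rightarrow> 'o \<times> 'm \<Rightarrow> bool" where
  "Phi_rep A X P \<longleftrightarrow> (\<exists>X1 s t q p. is_Phi A X X1 s t q p P)"

text \<open>
  The second sequence is the image of the first one, a composable pair in \<open>Z0 A\<close>, under \<open>\<Phi>\<close>;
  \<open>\<Phi>(f)\<close> is the morphism of cones induced by \<open>f[-1] = s\<^sub>Y f t\<^sub>X\<close>.
\<close>

fun Phi_seq ::
  "('g::ab_group_add, 'o, 'm::ring, 'z) dgcat_scheme \<Rightarrow> ('o, 'm) seq \<Rightarrow> ('o \<times> 'm, 'm) seq \<Rightarrow> bool" where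
  "Phi_seq A (X, f, Y, g, Z) (P, f', Q, g', R) \<longleftrightarrow>
     f \<in> Cyc A X Y 0 \<and> g \<in> Cyc A Y Z 0 \<and>
     f' \<in> Cyc A (fst P) (fst Q) 0 \<and> g' \<in> Cyc A (fst Q) (fst R) 0 \<and>
     (\<exists>X1 sx tx qx px Y1 sy ty qy py Z1 sz tz qz pz.
        is_Phi A X X1 sx tx qx px P \<and> is_Phi A Y Y1 sy ty qy py Q \<and> is_Phi A Z Z1 sz tz qz pz R \<and>
        qy * f' = sy * f * tx * qx \<and> py * f' = sy * f * tx * px \<and>
        qz * g' = sz * g * ty * qy \<and> pz * g' = sz * g * ty * py)"

subsection \<open>Exact DG-categories, DG-pairs and DG-subpairs\<close>

text \<open>\<open>ses\<close> and \<open>nses\<close> are the exact structures on \<open>Z0 E\<close> and \<open>Z0 (natural_dg E)\<close>.\<close>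

record ('g, 'o, 'm) exact_dgcat = "('g, 'o, 'm) dgcat" +
  ses :: "('o, 'm) seq set"
  nses :: "('o \<times> 'm, 'm) seq set"

locale exact_dg_category =
  fixes E :: "('g::ab_group_add, 'o, 'm::ring) exact_dgcat"
  assumes dg: "dg_category E"
    and additive: "additive_category (Z0 E)"
    and has_shifts: "closed_under_shifts E (Ob E)"
    and has_cones: "closed_under_cones E (Ob E)"
    and exact: "exact_category (Z0 E) (ses E)"
    and nat_exact: "exact_category (Z0 (natural_dg E)) (nses E)"
    and ses_shift: "ses_shift_invariant E (ses E)"
    and nses_shift: "ses_shift_invariant (natural_dg E) (nses E)"
    and Phi_exact: "Phi_seq E s s' \<Longrightarrow> s \<in> ses E \<longleftrightarrow> s' \<in> nses E"
    and Psi_exact: "\<lbrakk>(X, a) \<in> Ob (natural_dg E); (Y, b) \<in> Ob (natural_dg E); (Z, c) \<in> Ob (natural_dg E);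
        f \<in> mor (Z0 (natural_dg E)) (X, a) (Y, b); g \<in> mor (Z0 (natural_dg E)) (Y, b) (Z, c)\<rbrakk>
        \<Longrightarrow> ((X, a), f, (Y, b), g, (Z, c)) \<in> nses E \<longleftrightarrow> (X, f, Y, g, Z) \<in> ses E"

definition dg_sub ::
  "('g::ab_group_add, 'o, 'm::ring) exact_dgcat \<Rightarrow> 'o set \<Rightarrow> ('g, 'o, 'm) exact_dgcat" where
  "dg_sub E F = E\<lparr>Ob := F, ses := seqs_in F (ses E),
     nses := seqs_in (Ob (natural_dg (E\<lparr>Ob := F\<rparr>))) (nses E)\<rparr>"

definition inherits_exact_dg :: "('g::ab_group_add, 'o, 'm::ring) exact_dgcat \<Rightarrow> 'o set \<Rightarrow> bool" where
  "inherits_exact_dg E F \<longleftrightarrow> F \<subseteq> Ob E \<and> additive_category (Z0 (dg_sub E F)) \<and>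
     closed_under_shifts E F \<and> closed_under_cones E F \<and>
     inherits_exact (Z0 E) (ses E) F \<and>
     inherits_exact (Z0 (natural_dg E)) (nses E) (Ob (natural_dg (dg_sub E F)))"

definition pair_cat ::
  "('g::ab_group_add, 'o, 'm::ring) exact_dgcat \<Rightarrow> ('o \<times> 'm) set \<Rightarrow> ('o \<times> 'm, 'm) lincat" where
  "pair_cat E K = (Z0 (natural_dg E))\<lparr>obj := K\<rparr>"

definition pair_ses ::
  "('g::ab_group_add, 'o, 'm::ring) exact_dgcat \<Rightarrow> ('o \<times> 'm) set \<Rightarrow> ('o \<times> 'm, 'm) seq set" where
  "pair_ses E K = seqs_in K (nses E)"

definition exact_dg_pair ::
  "('g::ab_group_add, 'o, 'm::ring) exact_dgcat \<Rightarrow> ('o \<times> 'm) set \<Rightarrow> bool" where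
  "exact_dg_pair E K \<longleftrightarrow> exact_dg_category E \<and> K \<subseteq> Ob (natural_dg E) \<and>
     obj_shift_invariant (natural_dg E) K \<and> (\<forall>X\<in>Ob E. \<exists>P\<in>K. Phi_rep E X P) \<and>
     inherits_exact (Z0 (natural_dg E)) (nses E) K"

definition exact_dg_subpair ::
  "('g::ab_group_add, 'o, 'm::ring) exact_dgcat \<Rightarrow> ('o \<times> 'm) set \<Rightarrow> 'o set \<Rightarrow> ('o \<times> 'm) set \<Rightarrow> bool" where
  "exact_dg_subpair E K F L \<longleftrightarrow> inherits_exact_dg E F \<and> L \<subseteq> K \<and>
     obj_shift_invariant (natural_dg E) L \<and> inherits_exact (pair_cat E K) (pair_ses E K) L \<and>
     L \<subseteq> Ob (natural_dg (dg_sub E F)) \<and> (\<forall>X\<in>F. \<exists>P\<in>L. Phi_rep E X P)"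

subsection \<open>Infinite products and coproducts\<close>

text \<open>
  \<open>J\<close> is the collection of index sets of the families whose (co)products are considered.  An additive
  category with (co)products indexed by all sets as large as its own set of morphisms is zero, so the
  index sets must be ``small''; \<open>J\<close> is a parameter, and the conditions below are the closure
  properties of the collection of small subsets of \<open>'i\<close>.
\<close>

definition small_index_sets :: "'i set set \<Rightarrow> bool" where
  "small_index_sets J \<longleftrightarrow> (\<exists>I\<in>J. infinite I) \<and> (\<forall>I\<in>J. \<forall>I'\<subseteq>I. I' \<in> J) \<and>
     (\<forall>I\<in>J. \<forall>f. f ` I \<in> J) \<and> (\<forall>I\<in>J. \<forall>H\<in>I \<rightarrow> J. (\<Union>i\<in>I. H i) \<in> J)"

definition is_coproduct ::
  "('g::ab_group_add, 'o, 'm::ring, 'z) dgcat_scheme \<Rightarrow> 'i set \<Rightarrow> ('i \<Rightarrow> 'o) \<Rightarrow> 'o \<Rightarrow> ('i \<Rightarrow> 'm) \<Rightarrow> bool" where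
  "is_coproduct A I X C \<iota> \<longleftrightarrow> X \<in> I \<rightarrow> Ob A \<and> C \<in> Ob A \<and> (\<forall>i\<in>I. \<iota> i \<in> Cyc A (X i) C 0) \<and>
     (\<forall>Z\<in>Ob A. \<forall>n. \<forall>h. (\<forall>i\<in>I. h i \<in> Hom A (X i) Z n) \<longrightarrow>
        (\<exists>!g. g \<in> Hom A C Z n \<and> (\<forall>i\<in>I. g * \<iota> i = h i)))"

definition is_product ::
  "('g::ab_group_add, 'o, 'm::ring, 'z) dgcat_scheme \<Rightarrow> 'i set \<Rightarrow> ('i \<Rightarrow> 'o) \<Rightarrow> 'o \<Rightarrow> ('i \<Rightarrow> 'm) \<Rightarrow> bool" where
  "is_product A I X P \<pi> \<longleftrightarrow> X \<in> I \<rightarrow> Ob A \<and> P \<in> Ob A \<and> (\<forall>i\<in>I. \<pi> i \<in> Cyc A P (X i) 0) \<and>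
     (\<forall>Z\<in>Ob A. \<forall>n. \<forall>h. (\<forall>i\<in>I. h i \<in> Hom A Z (X i) n) \<longrightarrow>
        (\<exists>!g. g \<in> Hom A Z P n \<and> (\<forall>i\<in>I. \<pi> i * g = h i)))"

definition closed_under_coproducts ::
  "'i set set \<Rightarrow> ('g::ab_group_add, 'o, 'm::ring, 'z) dgcat_scheme \<Rightarrow> 'o set \<Rightarrow> bool" where
  "closed_under_coproducts J A F \<longleftrightarrow> (\<forall>I\<in>J. \<forall>X\<in>I \<rightarrow> F. \<exists>C\<in>F. \<exists>\<iota>. is_coproduct A I X C \<iota>)"

definition closed_under_products ::
  "'i set set \<Rightarrow> ('g::ab_group_add, 'o, 'm::ring, 'z) dgcat_scheme \<Rightarrow> 'o set \<Rightarrow> bool" where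
  "closed_under_products J A F \<longleftrightarrow> (\<forall>I\<in>J. \<forall>X\<in>I \<rightarrow> F. \<exists>P\<in>F. \<exists>\<pi>. is_product A I X P \<pi>)"

definition exact_coproducts :: "'i set set \<Rightarrow> ('g::ab_group_add, 'o, 'm::ring) exact_dgcat \<Rightarrow> bool" where
  "exact_coproducts J E \<longleftrightarrow> closed_under_coproducts J E (Ob E) \<and>
     (\<forall>I\<in>J. \<forall>X f Y g Z X' \<iota>x f' Y' \<iota>y g' Z' \<iota>z.
        (\<forall>i\<in>I. (X i, f i, Y i, g i, Z i) \<in> ses E) \<and>
        is_coproduct E I X X' \<iota>x \<and> is_coproduct E I Y Y' \<iota>y \<and> is_coproduct E I Z Z' \<iota>z \<and>
        f' \<in> Cyc E X' Y' 0 \<and> (\<forall>i\<in>I. f' * \<iota>x i = \<iota>y i * f i) \<and>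
        g' \<in> Cyc E Y' Z' 0 \<and> (\<forall>i\<in>I. g' * \<iota>y i = \<iota>z i * g i) \<longrightarrow>
        (X', f', Y', g', Z') \<in> ses E)"

definition exact_products :: "'i set set \<Rightarrow> ('g::ab_group_add, 'o, 'm::ring) exact_dgcat \<Rightarrow> bool" where
  "exact_products J E \<longleftrightarrow> closed_under_products J E (Ob E) \<and>
     (\<forall>I\<in>J. \<forall>X f Y g Z X' \<pi>x f' Y' \<pi>y g' Z' \<pi>z.
        (\<forall>i\<in>I. (X i, f i, Y i, g i, Z i) \<in> ses E) \<and>
        is_product E I X X' \<pi>x \<and> is_product E I Y Y' \<pi>y \<and> is_product E I Z Z' \<pi>z \<and>
        f' \<in> Cyc E X' Y' 0 \<and> (\<forall>i\<in>I. \<pi>y i * f' = f i * \<pi>x i) \<and>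
        g' \<in> Cyc E Y' Z' 0 \<and> (\<forall>i\<in>I. \<pi>z i * g' = g i * \<pi>y i) \<longrightarrow>
        (X', f', Y', g', Z') \<in> ses E)"

section \<open>Derived categories of the second kind\<close>

subsection \<open>Categories, functors and calculus of fractions\<close>

record ('o, 'a) cat =
  cobj :: "'o set"
  chom :: "'o \<Rightarrow> 'o \<Rightarrow> 'a set"
  ccomp :: "'o \<Rightarrow> 'o \<Rightarrow> 'o \<Rightarrow> 'a \<Rightarrow> 'a \<Rightarrow> 'a"
  cid :: "'o \<Rightarrow> 'a"

text \<open>\<open>ccomp C X Y Z g f\<close> is the composition of \<open>f : X \<rightarrow> Y\<close> and \<open>g : Y \<rightarrow> Z\<close>.\<close>

definition is_functor ::
  "('o, 'a) cat \<Rightarrow> ('p, 'b) cat \<Rightarrow> ('o \<Rightarrow> 'p) \<Rightarrow> ('o \<Rightarrow> 'o \<Rightarrow> 'a \<Rightarrow> 'b) \<Rightarrow> bool" where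
  "is_functor C D Fo Fm \<longleftrightarrow> Fo \<in> cobj C \<rightarrow> cobj D \<and>
     (\<forall>X\<in>cobj C. \<forall>Y\<in>cobj C. Fm X Y \<in> chom C X Y \<rightarrow> chom D (Fo X) (Fo Y)) \<and>
     (\<forall>X\<in>cobj C. Fm X X (cid C X) = cid D (Fo X)) \<and>
     (\<forall>X\<in>cobj C. \<forall>Y\<in>cobj C. \<forall>Z\<in>cobj C. \<forall>f\<in>chom C X Y. \<forall>g\<in>chom C Y Z.
        Fm X Z (ccomp C X Y Z g f) = ccomp D (Fo X) (Fo Y) (Fo Z) (Fm Y Z g) (Fm X Y f))"

definition fully_faithful ::
  "('o, 'a) cat \<Rightarrow> ('p, 'b) cat \<Rightarrow> ('o \<Rightarrow> 'p) \<Rightarrow> ('o \<Rightarrow> 'o \<Rightarrow> 'a \<Rightarrow> 'b) \<Rightarrow> bool" where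
  "fully_faithful C D Fo Fm \<longleftrightarrow> is_functor C D Fo Fm \<and>
     (\<forall>X\<in>cobj C. \<forall>Y\<in>cobj C. bij_betw (Fm X Y) (chom C X Y) (chom D (Fo X) (Fo Y)))"

definition cat_isomorphic :: "('o, 'a) cat \<Rightarrow> 'o \<Rightarrow> 'o \<Rightarrow> bool" where
  "cat_isomorphic C X Y \<longleftrightarrow> X \<in> cobj C \<and> Y \<in> cobj C \<and>
     (\<exists>f\<in>chom C X Y. \<exists>g\<in>chom C Y X. ccomp C X Y X g f = cid C X \<and> ccomp C Y X Y f g = cid C Y)"

definition cat_retract :: "('o, 'a) cat \<Rightarrow> 'o \<Rightarrow> 'o \<Rightarrow> bool" where
  "cat_retract C X Y \<longleftrightarrow> X \<in> cobj C \<and> Y \<in> cobj C \<and>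
     (\<exists>f\<in>chom C X Y. \<exists>g\<in>chom C Y X. ccomp C X Y X g f = cid C X)"

text \<open>A roof \<open>(V, s, f)\<close> is a fraction \<open>X \<leftarrow> V \<rightarrow> Y\<close> with \<open>s : V \<rightarrow> X\<close> in the class \<open>W\<close> of denominators.\<close>

definition roofs ::
  "('o, 'a) cat \<Rightarrow> ('o \<Rightarrow> 'o \<Rightarrow> 'a set) \<Rightarrow> 'o \<Rightarrow> 'o \<Rightarrow> ('o \<times> 'a \<times> 'a) set" where
  "roofs C W X Y = {(V, s, f). V \<in> cobj C \<and> s \<in> W V X \<and> f \<in> chom C V Y}"

definition roof_eq ::
  "('o, 'a) cat \<Rightarrow> ('o \<Rightarrow> 'o \<Rightarrow> 'a set) \<Rightarrow> 'o \<Rightarrow> 'o \<Rightarrow> ('o \<times> 'a \<times> 'a) rel" where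
  "roof_eq C W X Y = {((V, s, f), (V', s', f')).
     (V, s, f) \<in> roofs C W X Y \<and> (V', s', f') \<in> roofs C W X Y \<and>
     (\<exists>U\<in>cobj C. \<exists>u\<in>chom C U V. \<exists>u'\<in>chom C U V'.
        ccomp C U V X s u = ccomp C U V' X s' u' \<and> ccomp C U V X s u \<in> W U X \<and>
        ccomp C U V Y f u = ccomp C U V' Y f' u')}"

definition localization ::
  "('o, 'a) cat \<Rightarrow> ('o \<Rightarrow> 'o \<Rightarrow> 'a set) \<Rightarrow> ('o, ('o \<times> 'a \<times> 'a) set) cat" where
  "localization C W = \<lparr>cobj = cobj C,
     chom = (\<lambda>X Y. roofs C W X Y // roof_eq C W X Y),
     ccomp = (\<lambda>X Y Z b a. \<Union>{roof_eq C W X Z `` {(U, ccomp C U V X s u, ccomp C U V' Z g v)} |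
                U u v V s f V' t g. (V, s, f) \<in> a \<and> (V', t, g) \<in> b \<and>
                  U \<in> cobj C \<and> u \<in> W U V \<and> v \<in> chom C U V' \<and>
                  ccomp C U V Y f u = ccomp C U V' Y t v}),
     cid = (\<lambda>X. roof_eq C W X X `` {(X, cid C X, cid C X)})\<rparr>"

subsection \<open>The homotopy category and its Verdier quotients\<close>

definition hclass :: "('g::ab_group_add, 'o, 'm::ring, 'z) dgcat_scheme \<Rightarrow> 'o \<Rightarrow> 'o \<Rightarrow> 'm \<Rightarrow> 'm set" where
  "hclass A X Y f = {f + Diff A X Y (- gone A) h | h. h \<in> Hom A X Y (- gone A)}"

definition H0 :: "('g::ab_group_add, 'o, 'm::ring, 'z) dgcat_scheme \<Rightarrow> ('o, 'm set) cat" where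
  "H0 A = \<lparr>cobj = Ob A,
     chom = (\<lambda>X Y. hclass A X Y ` Cyc A X Y 0),
     ccomp = (\<lambda>X Y Z b a. \<Union>g\<in>b. \<Union>f\<in>a. hclass A X Z (g * f)),
     cid = (\<lambda>X. hclass A X X (Idt A X))\<rparr>"

text \<open>
  Full triangulated subcategories of \<open>H0 E\<close> (strictly full, as usual).  The distinguished triangles of
  \<open>H0 E\<close> are those isomorphic to \<open>X \<rightarrow> Y \<rightarrow> cone(f) \<rightarrow> X[1]\<close>.
\<close>

definition triangulated_sub :: "('g::ab_group_add, 'o, 'm::ring, 'z) dgcat_scheme \<Rightarrow> 'o set \<Rightarrow> bool" where
  "triangulated_sub E N \<longleftrightarrow> N \<subseteq> Ob E \<and> N \<noteq> {} \<and>
     (\<forall>X\<in>N. \<forall>Y. cat_isomorphic (H0 E) X Y \<longrightarrow> Y \<in> N) \<and>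
     (\<forall>X\<in>N. \<forall>i\<in>{gone E, - gone E}. \<forall>X' s t. is_shift E X i X' s t \<longrightarrow> X' \<in> N) \<and>
     (\<forall>X\<in>N. \<forall>Y\<in>N. \<forall>f C q p. is_cone E X f Y C q p \<longrightarrow> C \<in> N)"

text \<open>In a triangulated category the retracts of an object are its direct summands.\<close>

definition thick_sub :: "('g::ab_group_add, 'o, 'm::ring, 'z) dgcat_scheme \<Rightarrow> 'o set \<Rightarrow> bool" where
  "thick_sub E N \<longleftrightarrow> triangulated_sub E N \<and> (\<forall>Y\<in>N. \<forall>X. cat_retract (H0 E) X Y \<longrightarrow> X \<in> N)"

text \<open>
  The totalization of \<open>X \<rightarrow> Y \<rightarrow> Z\<close> as the cone of \<open>cone(f) \<rightarrow> Z\<close>; here \<open>q : cone(f) \<rightarrow> Y\<close> is not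
  closed, but \<open>g * q\<close> is, as \<open>d q = - f p\<close> and \<open>g f = 0\<close>.
\<close>

definition totalizations :: "('g::ab_group_add, 'o, 'm::ring) exact_dgcat \<Rightarrow> 'o set" where
  "totalizations E = {T. \<exists>X f Y g Z C q p q' p'. (X, f, Y, g, Z) \<in> ses E \<and>
     is_cone E X f Y C q p \<and> is_cone E C (g * q) Z T q' p'}"

definition Ac_abs :: "('g::ab_group_add, 'o, 'm::ring) exact_dgcat \<Rightarrow> 'o set" where
  "Ac_abs E = \<Inter>{N. thick_sub E N \<and> totalizations E \<subseteq> N}"

definition Ac_co :: "'i set set \<Rightarrow> ('g::ab_group_add, 'o, 'm::ring) exact_dgcat \<Rightarrow> 'o set" where
  "Ac_co J E = \<Inter>{N. triangulated_sub E N \<and> totalizations E \<subseteq> N \<and> closed_under_coproducts J E N}"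

definition Ac_ctr :: "'i set set \<Rightarrow> ('g::ab_group_add, 'o, 'm::ring) exact_dgcat \<Rightarrow> 'o set" where
  "Ac_ctr J E = \<Inter>{N. triangulated_sub E N \<and> totalizations E \<subseteq> N \<and> closed_under_products J E N}"

definition cone_in :: "('g::ab_group_add, 'o, 'm::ring, 'z) dgcat_scheme \<Rightarrow> 'o set \<Rightarrow> 'o \<Rightarrow> 'o \<Rightarrow> 'm set set" where
  "cone_in E N X Y = {hclass E X Y f | f. \<exists>C\<in>N. \<exists>q p. is_cone E X f Y C q p}"

type_synonym ('o, 'm) fraction_class = "('o \<times> 'm set \<times> 'm set) set"

definition verdier_quotient ::
  "('g::ab_group_add, 'o, 'm::ring, 'z) dgcat_scheme \<Rightarrow> 'o set \<Rightarrow> ('o, ('o, 'm) fraction_class) cat" where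
  "verdier_quotient E N = localization (H0 E) (cone_in E N)"

definition D_abs ::
  "('g::ab_group_add, 'o, 'm::ring) exact_dgcat \<Rightarrow> ('o, ('o, 'm) fraction_class) cat" where
  "D_abs E = verdier_quotient E (Ac_abs E)"

definition D_co ::
  "'i set set \<Rightarrow> ('g::ab_group_add, 'o, 'm::ring) exact_dgcat \<Rightarrow> ('o, ('o, 'm) fraction_class) cat" where
  "D_co J E = verdier_quotient E (Ac_co J E)"

definition D_ctr ::
  "'i set set \<Rightarrow> ('g::ab_group_add, 'o, 'm::ring) exact_dgcat \<Rightarrow> ('o, ('o, 'm) fraction_class) cat" where
  "D_ctr J E = verdier_quotient E (Ac_ctr J E)"

text \<open>
  The action on morphisms of the functor from \<open>verdier_quotient (dg_sub E F) N'\<close> to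
  \<open>verdier_quotient E N\<close> induced by the inclusion.  \<open>H0 (dg_sub E F)\<close> is literally a full subcategory
  of \<open>H0 E\<close>, so a fraction in the former is a fraction in the latter; its class is sent to the class
  of the same fraction.
\<close>

definition inclusion_map ::
  "('g::ab_group_add, 'o, 'm::ring, 'z) dgcat_scheme \<Rightarrow> 'o set \<Rightarrow> 'o \<Rightarrow> 'o \<Rightarrow>
     ('o, 'm) fraction_class \<Rightarrow> ('o, 'm) fraction_class" where
  "inclusion_map E N X Y c = roof_eq (H0 E) (cone_in E N) X Y `` c"

end

theory Submission
  imports Defs
begin

text \<open>
  Let \<open>N\<close> and \<open>N'\<close> be the classes of acyclic objects of \<open>E\<close> and \<open>F\<close>.  The functor \<open>H\<^sup>0(F)/N' \<rightarrow> H\<^sup>0(E)/N\<close> is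
  fully faithful as soon as every morphism \<open>Y \<rightarrow> X\<close> in \<open>H\<^sup>0(E)\<close> with \<open>Y\<close> in \<open>F\<close> and \<open>X\<close> in \<open>N\<close> factors through an
  object of \<open>N'\<close>; part (b) uses morphisms \<open>X \<rightarrow> Y\<close> instead.  The objects \<open>X\<close> with this property form a thick
  subcategory, closed under products, so one may assume that \<open>X\<close> is the totalization \<open>T\<close> of a short exact
  sequence \<open>U \<rightarrow> V \<rightarrow> W\<close>.

  A morphism \<open>Y \<rightarrow> T\<close> is null-homotopic once its component \<open>w : Y \<rightarrow> W\<close> lifts to a, possibly nonclosed, morphism
  \<open>Y \<rightarrow> V\<close>.  In general \<open>w\<close> yields a morphism \<open>\<Phi>(Y) \<rightarrow> \<Phi>(W)\<close>.  The pullback of \<open>\<Phi>(V) \<rightarrow> \<Phi>(W)\<close> along it in \<open>K\<close> and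
  the resolving property give an admissible epimorphism from some \<open>(X, \<tau>)\<close> in \<open>L\<close> to \<open>\<Phi>(Y)\<close> that lifts to \<open>\<Phi>(V)\<close>.
  Composing with \<open>\<Psi>\<^sup>+\<Phi>(Y) \<rightarrow> Y\<close> one obtains a short exact sequence \<open>R \<rightarrow> X \<rightarrow> Y\<close> in \<open>Z\<^sup>0(F)\<close> such that \<open>w\<close> lifts to \<open>V\<close>
  along \<open>X \<rightarrow> Y\<close>.  Hence the composition \<open>cone(R \<rightarrow> X) \<rightarrow> Y \<rightarrow> T\<close> is null-homotopic, and \<open>Y \<rightarrow> T\<close> factors through the
  cone of the first map, which is the totalization of \<open>R \<rightarrow> X \<rightarrow> Y\<close>.
\<close>

section \<open>Calculus of fractions\<close>

text \<open>The component \<open>w : Y -> W\<close> of a morphism to \<open>T\<close> is not closed: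
  \<open>dw = - g v\<close>, where \<open>v : Y -> V\<close> is the next component. What passes to
  Phi is therefore not \<open>w\<close> but
  \<open>c = d(w p \<sigma>) = w p - g v p \<sigma>\<close>, where \<open>p\<close> is the closed
  projection of \<open>Phi(Y)\<close> to \<open>Y\<close> and \<sigma> its contracting homotopy.
  Being closed, \<open>c\<close> corresponds by adjunction to a morphism from \<open>Phi(Y)\<close>
  to \<open>Phi(W)\<close>, and it differs from \<open>w p\<close> by a map that visibly lifts to
  \<open>V\<close>. That \<open>p\<close> is an admissible epimorphism rests on Phi reflecting
  exactness. Part (b) is not obtained by formal duality. Roofs have their denominator on the source
  side only, so fractions must be turned around. Moreover, the adjunctions of Phi on its two sides
  differ by a shift, so a sequence is shifted by [1] before Phi is applied to it. Cones are used in
  an equational form with both nonclosed structure maps. The facts about triangles thus become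
  identities in the ring of morphisms combined with the Leibniz rule.\<close>

locale fractions =
  fixes C :: "('o, 'a) cat" and W :: "'o \<Rightarrow> 'o \<Rightarrow> 'a set"
  assumes comp_in: "\<lbrakk>X \<in> cobj C; Y \<in> cobj C; Z \<in> cobj C; f \<in> chom C X Y; g \<in> chom C Y Z\<rbrakk>
      \<Longrightarrow> ccomp C X Y Z g f \<in> chom C X Z"
    and id_in: "X \<in> cobj C \<Longrightarrow> cid C X \<in> chom C X X"
    and id_left: "\<lbrakk>X \<in> cobj C; Y \<in> cobj C; f \<in> chom C X Y\<rbrakk> \<Longrightarrow> ccomp C X Y Y (cid C Y) f = f"
    and id_right: "\<lbrakk>X \<in> cobj C; Y \<in> cobj C; f \<in> chom C X Y\<rbrakk> \<Longrightarrow> ccomp C X X Y f (cid C X) = f"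
    and comp_assoc: "\<lbrakk>X \<in> cobj C; Y \<in> cobj C; Z \<in> cobj C; V \<in> cobj C;
        f \<in> chom C X Y; g \<in> chom C Y Z; h \<in> chom C Z V\<rbrakk>
      \<Longrightarrow> ccomp C X Y V (ccomp C Y Z V h g) f = ccomp C X Z V h (ccomp C X Y Z g f)"
    and W_sub: "\<lbrakk>X \<in> cobj C; Y \<in> cobj C; s \<in> W X Y\<rbrakk> \<Longrightarrow> s \<in> chom C X Y"
    and W_id: "X \<in> cobj C \<Longrightarrow> cid C X \<in> W X X"
    and W_comp: "\<lbrakk>X \<in> cobj C; Y \<in> cobj C; Z \<in> cobj C; s \<in> W X Y; t \<in> W Y Z\<rbrakk>
      \<Longrightarrow> ccomp C X Y Z t s \<in> W X Z"
    and ore: "\<lbrakk>X \<in> cobj C; Y \<in> cobj C; Z \<in> cobj C; f \<in> chom C X Y; s \<in> W Z Y\<rbrakk>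
      \<Longrightarrow> \<exists>U\<in>cobj C. \<exists>u\<in>W U X. \<exists>v\<in>chom C U Z. ccomp C U X Y f u = ccomp C U Z Y s v"
    and cancel: "\<lbrakk>X \<in> cobj C; Y \<in> cobj C; Z \<in> cobj C; f \<in> chom C X Z; g \<in> chom C X Z; s \<in> W Z Y;
        ccomp C X Z Y s f = ccomp C X Z Y s g\<rbrakk>
      \<Longrightarrow> \<exists>U\<in>cobj C. \<exists>u\<in>W U X. ccomp C U X Z f u = ccomp C U X Z g u"
begin

section \<open>Equivalence and composition of roofs\<close>

lemma square_comp:
  assumes "T \<in> cobj C" "U \<in> cobj C" "V \<in> cobj C" "V' \<in> cobj C" "X \<in> cobj C"
    and "u \<in> chom C U V" "s \<in> chom C V X" "u' \<in> chom C U V'" "s' \<in> chom C V' X" "a \<in> chom C T U"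
    and "ccomp C U V X s u = ccomp C U V' X s' u'"
  shows "ccomp C T V X s (ccomp C T U V u a) = ccomp C T V' X s' (ccomp C T U V' u' a)"
  using assms comp_assoc by metis

text \<open>The common tool behind transitivity and composition of roofs. An Ore square over
  \<open>X\<close> only makes the two maps to \<open>V1\<close> agree after \<open>s1\<close>, and
  those to \<open>V2\<close> after \<open>s2\<close>. Each of these denominators is then removed by
  one use of \<open>cancel\<close>, at the price of a further refinement of
  \<open>D\<close>.\<close>

lemma lift_to_apex:
  assumes ob: "X \<in> cobj C" "V1 \<in> cobj C" "V2 \<in> cobj C" "A \<in> cobj C" "D \<in> cobj C"
    and s1: "s1 \<in> W V1 X" and s2: "s2 \<in> W V2 X"
    and a: "a1 \<in> chom C A V1" "a2 \<in> chom C A V2" "ccomp C A V1 X s1 a1 = ccomp C A V2 X s2 a2"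
    and aW: "ccomp C A V1 X s1 a1 \<in> W A X"
    and m: "m1 \<in> chom C D V1" "m2 \<in> chom C D V2" "ccomp C D V1 X s1 m1 = ccomp C D V2 X s2 m2"
  obtains T y z where "T \<in> cobj C" "y \<in> W T D" "z \<in> chom C T A"
    "ccomp C T D V1 m1 y = ccomp C T A V1 a1 z" "ccomp C T D V2 m2 y = ccomp C T A V2 a2 z"
proof -
  have h: "s1 \<in> chom C V1 X" "s2 \<in> chom C V2 X" using ob s1 s2 W_sub by auto
  obtain T1 y1 z1 where 1: "T1 \<in> cobj C" "y1 \<in> W T1 D" "z1 \<in> chom C T1 A"
      "ccomp C T1 D X (ccomp C D V1 X s1 m1) y1 = ccomp C T1 A X (ccomp C A V1 X s1 a1) z1"
    using ore[of D X A "ccomp C D V1 X s1 m1" "ccomp C A V1 X s1 a1"] ob m a aW h comp_in by metis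
  have y1: "y1 \<in> chom C T1 D" using 1 ob W_sub by auto
  have e1: "ccomp C T1 V1 X s1 (ccomp C T1 D V1 m1 y1) = ccomp C T1 V1 X s1 (ccomp C T1 A V1 a1 z1)"
    using 1 ob m a h y1 comp_assoc by metis
  obtain T2 y2 where 2: "T2 \<in> cobj C" "y2 \<in> W T2 T1"
      "ccomp C T2 T1 V1 (ccomp C T1 D V1 m1 y1) y2 = ccomp C T2 T1 V1 (ccomp C T1 A V1 a1 z1) y2"
    using cancel[of T1 X V1 "ccomp C T1 D V1 m1 y1" "ccomp C T1 A V1 a1 z1" s1] e1 1 ob m a h y1 s1 comp_in
    by metis
  have y2: "y2 \<in> chom C T2 T1" using 1 2 W_sub by auto
  have e2: "ccomp C T1 V2 X s2 (ccomp C T1 D V2 m2 y1) = ccomp C T1 V2 X s2 (ccomp C T1 A V2 a2 z1)"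
    using 1 ob m a h y1 comp_assoc by metis
  have e2': "ccomp C T2 V2 X s2 (ccomp C T2 T1 V2 (ccomp C T1 D V2 m2 y1) y2)
      = ccomp C T2 V2 X s2 (ccomp C T2 T1 V2 (ccomp C T1 A V2 a2 z1) y2)"
    using square_comp[OF _ _ _ _ _ _ _ _ _ _ e2] 1 2 ob m a h y1 y2 comp_in by metis
  have in2: "ccomp C T2 T1 V2 (ccomp C T1 D V2 m2 y1) y2 \<in> chom C T2 V2"
     "ccomp C T2 T1 V2 (ccomp C T1 A V2 a2 z1) y2 \<in> chom C T2 V2"
    using 1 2 ob m a y1 y2 comp_in by metis+
  obtain T3 y3 where 3: "T3 \<in> cobj C" "y3 \<in> W T3 T2"
      "ccomp C T3 T2 V2 (ccomp C T2 T1 V2 (ccomp C T1 D V2 m2 y1) y2) y3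
       = ccomp C T3 T2 V2 (ccomp C T2 T1 V2 (ccomp C T1 A V2 a2 z1) y2) y3"
    using cancel[OF _ _ _ in2 s2 e2'] 1 2 ob by metis
  have y3: "y3 \<in> chom C T3 T2" using 2 3 W_sub by auto
  define y where "y = ccomp C T3 T1 D y1 (ccomp C T3 T2 T1 y2 y3)"
  define z where "z = ccomp C T3 T1 A z1 (ccomp C T3 T2 T1 y2 y3)"
  note mem = 1(1-3) 2(1,2) 3(1,2) ob m(1,2) a(1,2) y1 y2 y3
  have y23: "ccomp C T3 T2 T1 y2 y3 \<in> chom C T3 T1" using mem comp_in by metis
  have "y \<in> W T3 D" unfolding y_def using mem W_comp by metis
  moreover have "z \<in> chom C T3 A" unfolding z_def using mem y23 comp_in by metis
  moreover have "ccomp C T3 D V1 m1 y = ccomp C T3 A V1 a1 z"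
  proof -
    have "ccomp C T3 T1 V1 (ccomp C T1 D V1 m1 y1) (ccomp C T3 T2 T1 y2 y3)
        = ccomp C T3 T1 V1 (ccomp C T1 A V1 a1 z1) (ccomp C T3 T2 T1 y2 y3)"
      using 2(3) mem comp_assoc comp_in by metis
    thus ?thesis unfolding y_def z_def using mem y23 comp_assoc by metis
  qed
  moreover have "ccomp C T3 D V2 m2 y = ccomp C T3 A V2 a2 z"
  proof -
    have "ccomp C T3 T1 V2 (ccomp C T1 D V2 m2 y1) (ccomp C T3 T2 T1 y2 y3)
        = ccomp C T3 T1 V2 (ccomp C T1 A V2 a2 z1) (ccomp C T3 T2 T1 y2 y3)"
      using 3(3) mem comp_assoc comp_in by metis
    thus ?thesis unfolding y_def z_def using mem y23 comp_assoc by metis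
  qed
  ultimately show thesis using that 3(1) by blast
qed

lemma roofsI: "\<lbrakk>V \<in> cobj C; s \<in> W V X; f \<in> chom C V Y\<rbrakk> \<Longrightarrow> (V, s, f) \<in> roofs C W X Y"
  by (simp add: roofs_def)

lemma roof_eqI:
  assumes "(V, s, f) \<in> roofs C W X Y" "(V', s', f') \<in> roofs C W X Y"
    and "U \<in> cobj C" "u \<in> chom C U V" "u' \<in> chom C U V'"
    and "ccomp C U V X s u = ccomp C U V' X s' u'" "ccomp C U V X s u \<in> W U X"
    and "ccomp C U V Y f u = ccomp C U V' Y f' u'"
  shows "((V, s, f), (V', s', f')) \<in> roof_eq C W X Y"
  using assms unfolding roof_eq_def by blast

lemma roof_eqE:
  assumes "((V, s, f), (V', s', f')) \<in> roof_eq C W X Y"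
  obtains U u u' where "V \<in> cobj C" "V' \<in> cobj C" "s \<in> W V X" "s' \<in> W V' X" "f \<in> chom C V Y" "f' \<in> chom C V' Y"
    and "U \<in> cobj C" "u \<in> chom C U V" "u' \<in> chom C U V'"
    and "ccomp C U V X s u = ccomp C U V' X s' u'" "ccomp C U V X s u \<in> W U X"
    and "ccomp C U V Y f u = ccomp C U V' Y f' u'"
  using assms unfolding roof_eq_def roofs_def by blast

lemma equiv_roof_eq:
  assumes X: "X \<in> cobj C" and Y: "Y \<in> cobj C"
  shows "equiv (roofs C W X Y) (roof_eq C W X Y)"
proof (rule equivI)
  show "roof_eq C W X Y \<subseteq> roofs C W X Y \<times> roofs C W X Y" by (auto simp: roof_eq_def)
  show "refl_on (roofs C W X Y) (roof_eq C W X Y)"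
  proof (rule refl_onI)
    fix r assume "r \<in> roofs C W X Y"
    then obtain V s f where r: "r = (V, s, f)" and rf: "V \<in> cobj C" "s \<in> W V X" "f \<in> chom C V Y"
      by (auto simp: roofs_def)
    show "(r, r) \<in> roof_eq C W X Y" unfolding r
      using rf X Y id_in W_sub id_right
      by (intro roof_eqI[where U = V and u = "cid C V" and u' = "cid C V"] roofsI) auto
  qed
  show "sym (roof_eq C W X Y)"
    by (rule symI) (auto simp: roof_eq_def; metis)
  show "trans (roof_eq C W X Y)"
  proof (rule transI)
    fix r1 r2 r3 assume 12: "(r1, r2) \<in> roof_eq C W X Y" and 23: "(r2, r3) \<in> roof_eq C W X Y"
    obtain V1 s1 f1 V2 s2 f2 V3 s3 f3 where r: "r1 = (V1, s1, f1)" "r2 = (V2, s2, f2)" "r3 = (V3, s3, f3)"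
      by (metis prod_cases3)
    obtain U u1 u2 where U: "V1 \<in> cobj C" "V2 \<in> cobj C" "s1 \<in> W V1 X" "s2 \<in> W V2 X" "f1 \<in> chom C V1 Y"
        "f2 \<in> chom C V2 Y" "U \<in> cobj C" "u1 \<in> chom C U V1" "u2 \<in> chom C U V2"
        "ccomp C U V1 X s1 u1 = ccomp C U V2 X s2 u2" "ccomp C U V1 X s1 u1 \<in> W U X"
        "ccomp C U V1 Y f1 u1 = ccomp C U V2 Y f2 u2"
      using roof_eqE[OF 12[unfolded r]] by metis
    obtain U' v2 v3 where U': "V3 \<in> cobj C" "s3 \<in> W V3 X"
        "f3 \<in> chom C V3 Y" "U' \<in> cobj C" "v2 \<in> chom C U' V2" "v3 \<in> chom C U' V3"
        "ccomp C U' V2 X s2 v2 = ccomp C U' V3 X s3 v3" "ccomp C U' V2 X s2 v2 \<in> W U' X"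
        "ccomp C U' V2 Y f2 v2 = ccomp C U' V3 Y f3 v3"
      using roof_eqE[OF 23[unfolded r]] by metis
    \<comment> \<open>Both legs of the lemma are taken to be the same \<open>V2\<close>, so it
      yields a square over \<open>V2\<close> and not merely over \<open>X\<close>.\<close>
    obtain T y z where T: "T \<in> cobj C" "y \<in> W T U" "z \<in> chom C T U'"
        "ccomp C T U V2 u2 y = ccomp C T U' V2 v2 z"
      using lift_to_apex[OF X U(2) U(2) U'(4) U(7) U(4) U(4) U'(5,5) refl U'(8) U(9,9) refl] by metis
    have y: "y \<in> chom C T U" using T U W_sub by auto
    have s: "s1 \<in> chom C V1 X" "s2 \<in> chom C V2 X" "s3 \<in> chom C V3 X"
      using X U U' W_sub by auto
    note mem = X Y U(1-9) U'(1-6) T(1-3) y s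
    show "(r1, r3) \<in> roof_eq C W X Y" unfolding r
    proof (rule roof_eqI)
      show "(V1, s1, f1) \<in> roofs C W X Y" "(V3, s3, f3) \<in> roofs C W X Y"
        using mem by (auto intro: roofsI)
      show "ccomp C T U V1 u1 y \<in> chom C T V1" "ccomp C T U' V3 v3 z \<in> chom C T V3"
        using mem comp_in by metis+
      show "ccomp C T V1 X s1 (ccomp C T U V1 u1 y) = ccomp C T V3 X s3 (ccomp C T U' V3 v3 z)"
        using square_comp[OF _ _ _ _ _ _ _ _ _ _ U(10), of T y]
          square_comp[OF _ _ _ _ _ _ _ _ _ _ U'(7), of T z] mem T(4) by metis
      show "ccomp C T V1 Y f1 (ccomp C T U V1 u1 y) = ccomp C T V3 Y f3 (ccomp C T U' V3 v3 z)"
        using square_comp[OF _ _ _ _ _ _ _ _ _ _ U(12), of T y]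
          square_comp[OF _ _ _ _ _ _ _ _ _ _ U'(9), of T z] mem T(4) by metis
      show "ccomp C T V1 X s1 (ccomp C T U V1 u1 y) \<in> W T X"
        using W_comp[of T U X y "ccomp C U V1 X s1 u1"] U(11) mem comp_assoc by metis
    qed (use T in auto)
  qed
qed

text \<open>Independence of the composite from the representatives and from the Ore squares at once.
  \<open>A\<close> and \<open>B\<close> witness the two equivalences. An Ore square over
  \<open>X\<close> is refined first so as to factor through \<open>A\<close>, then so as to factor
  through \<open>B\<close>; the second refinement needs two maps that agree over \<open>Y\<close>,
  which the first one provides.\<close>

lemma roof_comp_cong:
  assumes ob: "X \<in> cobj C" "Y \<in> cobj C" "Z \<in> cobj C" "U1 \<in> cobj C" "U2 \<in> cobj C"
    and 12: "((V1, s1, f1), (V2, s2, f2)) \<in> roof_eq C W X Y"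
    and eq': "((V1', t1, g1), (V2', t2, g2)) \<in> roof_eq C W Y Z"
    and 1: "u1 \<in> W U1 V1" "v1 \<in> chom C U1 V1'" "ccomp C U1 V1 Y f1 u1 = ccomp C U1 V1' Y t1 v1"
    and 2: "u2 \<in> W U2 V2" "v2 \<in> chom C U2 V2'" "ccomp C U2 V2 Y f2 u2 = ccomp C U2 V2' Y t2 v2"
  shows "((U1, ccomp C U1 V1 X s1 u1, ccomp C U1 V1' Z g1 v1),
          (U2, ccomp C U2 V2 X s2 u2, ccomp C U2 V2' Z g2 v2)) \<in> roof_eq C W X Z"
proof -
  obtain A a1 a2 where A: "V1 \<in> cobj C" "V2 \<in> cobj C" "s1 \<in> W V1 X" "s2 \<in> W V2 X" "f1 \<in> chom C V1 Y"
      "f2 \<in> chom C V2 Y" "A \<in> cobj C" "a1 \<in> chom C A V1" "a2 \<in> chom C A V2"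
      "ccomp C A V1 X s1 a1 = ccomp C A V2 X s2 a2" "ccomp C A V1 X s1 a1 \<in> W A X"
      "ccomp C A V1 Y f1 a1 = ccomp C A V2 Y f2 a2"
    using roof_eqE[OF 12] by metis
  obtain B b1 b2 where B: "V1' \<in> cobj C" "V2' \<in> cobj C" "t1 \<in> W V1' Y" "t2 \<in> W V2' Y" "g1 \<in> chom C V1' Z"
      "g2 \<in> chom C V2' Z" "B \<in> cobj C" "b1 \<in> chom C B V1'" "b2 \<in> chom C B V2'"
      "ccomp C B V1' Y t1 b1 = ccomp C B V2' Y t2 b2" "ccomp C B V1' Y t1 b1 \<in> W B Y"
      "ccomp C B V1' Z g1 b1 = ccomp C B V2' Z g2 b2"
    using roof_eqE[OF eq'] by metis
  have h: "s1 \<in> chom C V1 X" "s2 \<in> chom C V2 X" "t1 \<in> chom C V1' Y" "t2 \<in> chom C V2' Y"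
      "u1 \<in> chom C U1 V1" "u2 \<in> chom C U2 V2"
    using A(1-4) B(1-4) ob 1(1) 2(1) W_sub by auto
  note mem = ob A(1-9) B(1-9) h 1(1,2) 2(1,2)
  have su: "ccomp C U1 V1 X s1 u1 \<in> W U1 X" "ccomp C U2 V2 X s2 u2 \<in> W U2 X"
    using mem W_comp by metis+
  obtain D x1 x2 where D: "D \<in> cobj C" "x1 \<in> W D U1" "x2 \<in> chom C D U2"
      "ccomp C D U1 X (ccomp C U1 V1 X s1 u1) x1 = ccomp C D U2 X (ccomp C U2 V2 X s2 u2) x2"
    using ore[of U1 X U2 "ccomp C U1 V1 X s1 u1" "ccomp C U2 V2 X s2 u2"] su mem W_sub by metis
  have x1: "x1 \<in> chom C D U1" using D ob W_sub by auto
  have ux: "ccomp C D U1 V1 u1 x1 \<in> chom C D V1" "ccomp C D U2 V2 u2 x2 \<in> chom C D V2"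
    using mem D x1 comp_in by metis+
  have sux: "ccomp C D V1 X s1 (ccomp C D U1 V1 u1 x1) = ccomp C D V2 X s2 (ccomp C D U2 V2 u2 x2)"
    using D(4) mem D(1-3) x1 comp_assoc by metis
  obtain T y z where T: "T \<in> cobj C" "y \<in> W T D" "z \<in> chom C T A"
     "ccomp C T D V1 (ccomp C D U1 V1 u1 x1) y = ccomp C T A V1 a1 z"
     "ccomp C T D V2 (ccomp C D U2 V2 u2 x2) y = ccomp C T A V2 a2 z"
    using lift_to_apex[OF ob(1) A(1,2,7) D(1) A(3,4,8-11) ux sux] by metis
  have y: "y \<in> chom C T D" using T D W_sub by auto
  define p1 where "p1 = ccomp C T D U1 x1 y"
  define p2 where "p2 = ccomp C T D U2 x2 y"
  have p: "p1 \<in> W T U1" "p1 \<in> chom C T U1" "p2 \<in> chom C T U2"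
    unfolding p1_def p2_def using mem D T(1-3) x1 y comp_in W_comp by metis+
  have up: "ccomp C T U1 V1 u1 p1 = ccomp C T A V1 a1 z" "ccomp C T U2 V2 u2 p2 = ccomp C T A V2 a2 z"
    unfolding p1_def p2_def using T(4,5) mem D(1-3) T(1-3) x1 y comp_assoc by metis+
  have sup: "ccomp C T U1 X (ccomp C U1 V1 X s1 u1) p1 = ccomp C T U2 X (ccomp C U2 V2 X s2 u2) p2"
    using up A(10) mem T(1-3) p square_comp[OF _ _ _ _ _ _ _ _ _ _ A(10)] comp_assoc by metis
  have tv: "ccomp C T V1' Y t1 (ccomp C T U1 V1' v1 p1) = ccomp C T V2' Y t2 (ccomp C T U2 V2' v2 p2)"
  proof -
    have "ccomp C T V1' Y t1 (ccomp C T U1 V1' v1 p1) = ccomp C T V1 Y f1 (ccomp C T U1 V1 u1 p1)"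
      using square_comp[OF _ _ _ _ _ _ _ _ _ _ 1(3)] mem T(1-3) p by metis
    also have "\<dots> = ccomp C T V2 Y f2 (ccomp C T U2 V2 u2 p2)"
      unfolding up using square_comp[OF _ _ _ _ _ _ _ _ _ _ A(12)] mem T(1-3) by metis
    also have "\<dots> = ccomp C T V2' Y t2 (ccomp C T U2 V2' v2 p2)"
      using square_comp[OF _ _ _ _ _ _ _ _ _ _ 2(3)] mem T(1-3) p by metis
    finally show ?thesis .
  qed
  have vp: "ccomp C T U1 V1' v1 p1 \<in> chom C T V1'" "ccomp C T U2 V2' v2 p2 \<in> chom C T V2'"
    using mem T p comp_in by metis+
  obtain S x w where S: "S \<in> cobj C" "x \<in> W S T" "w \<in> chom C S B"
     "ccomp C S T V1' (ccomp C T U1 V1' v1 p1) x = ccomp C S B V1' b1 w"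
     "ccomp C S T V2' (ccomp C T U2 V2' v2 p2) x = ccomp C S B V2' b2 w"
    using lift_to_apex[OF ob(2) B(1,2,7) T(1) B(3,4,8-11) vp tv] by metis
  have x: "x \<in> chom C S T" using T S W_sub by auto
  note mem = mem T(1-3) S(1-3) x p
  have suin: "ccomp C U1 V1 X s1 u1 \<in> chom C U1 X" "ccomp C U2 V2 X s2 u2 \<in> chom C U2 X"
       "ccomp C U1 V1' Z g1 v1 \<in> chom C U1 Z" "ccomp C U2 V2' Z g2 v2 \<in> chom C U2 Z"
    using mem comp_in by metis+
  show ?thesis
  proof (rule roof_eqI)
    show "(U1, ccomp C U1 V1 X s1 u1, ccomp C U1 V1' Z g1 v1) \<in> roofs C W X Z"
      "(U2, ccomp C U2 V2 X s2 u2, ccomp C U2 V2' Z g2 v2) \<in> roofs C W X Z"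
      using mem su suin by (auto intro: roofsI)
    show "ccomp C S T U1 p1 x \<in> chom C S U1" "ccomp C S T U2 p2 x \<in> chom C S U2"
      using mem comp_in by metis+
    show "ccomp C S U1 X (ccomp C U1 V1 X s1 u1) (ccomp C S T U1 p1 x)
        = ccomp C S U2 X (ccomp C U2 V2 X s2 u2) (ccomp C S T U2 p2 x)"
      using square_comp[OF _ _ _ _ _ _ _ _ _ _ sup] mem suin by metis
    show "ccomp C S U1 X (ccomp C U1 V1 X s1 u1) (ccomp C S T U1 p1 x) \<in> W S X"
      using mem su W_comp by metis
    have "ccomp C S U1 V1' v1 (ccomp C S T U1 p1 x) = ccomp C S B V1' b1 w"
      "ccomp C S U2 V2' v2 (ccomp C S T U2 p2 x) = ccomp C S B V2' b2 w"
      using S(4,5) mem comp_assoc by metis+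
    moreover have "ccomp C S U1 Z (ccomp C U1 V1' Z g1 v1) (ccomp C S T U1 p1 x)
      = ccomp C S V1' Z g1 (ccomp C S U1 V1' v1 (ccomp C S T U1 p1 x))"
      "ccomp C S U2 Z (ccomp C U2 V2' Z g2 v2) (ccomp C S T U2 p2 x)
      = ccomp C S V2' Z g2 (ccomp C S U2 V2' v2 (ccomp C S T U2 p2 x))"
      using mem comp_in comp_assoc by metis+
    ultimately show "ccomp C S U1 Z (ccomp C U1 V1' Z g1 v1) (ccomp C S T U1 p1 x)
      = ccomp C S U2 Z (ccomp C U2 V2' Z g2 v2) (ccomp C S T U2 p2 x)"
      using square_comp[OF _ _ _ _ _ _ _ _ _ _ B(12)] mem by metis
  qed (use mem in auto)
qed

text \<open>The composite is defined as a union over all representatives and all Ore squares. All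
  members of the union coincide by \<open>roof_comp_cong\<close>, so any single choice computes
  it.\<close>

lemma localization_comp:
  assumes ob: "X \<in> cobj C" "Y \<in> cobj C" "Z \<in> cobj C" "U \<in> cobj C"
    and a: "(V, s, f) \<in> roofs C W X Y" and b: "(V', t, g) \<in> roofs C W Y Z"
    and u: "u \<in> W U V" "v \<in> chom C U V'" "ccomp C U V Y f u = ccomp C U V' Y t v"
  shows "ccomp (localization C W) X Y Z (roof_eq C W Y Z `` {(V', t, g)}) (roof_eq C W X Y `` {(V, s, f)})
    = roof_eq C W X Z `` {(U, ccomp C U V X s u, ccomp C U V' Z g v)}"
proof -
  let ?R = "roof_eq C W X Z `` {(U, ccomp C U V X s u, ccomp C U V' Z g v)}"
  have eq: "roof_eq C W X Z `` {(U2, ccomp C U2 V2 X s2 u2, ccomp C U2 V2' Z g2 v2)} = ?R"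
    if "((V, s, f), (V2, s2, f2)) \<in> roof_eq C W X Y" "((V', t, g), (V2', t2, g2)) \<in> roof_eq C W Y Z"
      "U2 \<in> cobj C" "u2 \<in> W U2 V2" "v2 \<in> chom C U2 V2'" "ccomp C U2 V2 Y f2 u2 = ccomp C U2 V2' Y t2 v2"
    for U2 u2 v2 V2 s2 f2 V2' t2 g2
    using equiv_class_eq[OF equiv_roof_eq[OF ob(1,3)]
        roof_comp_cong[OF ob(1-4) that(3,1,2) u that(4-6)]] by simp
  have r: "((V, s, f), (V, s, f)) \<in> roof_eq C W X Y" "((V', t, g), (V', t, g)) \<in> roof_eq C W Y Z"
    using a b equiv_roof_eq ob by (meson equiv_class_self Image_singleton_iff)+
  show ?thesis unfolding localization_def cat.simps
    apply (rule antisym)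
    subgoal by (rule Union_least) (use eq in blast)
    subgoal by (rule Union_upper) (use r u ob in blast)
    done
qed

lemma localization_hom:
  assumes "c \<in> chom (localization C W) X Y"
  obtains V s f where "c = roof_eq C W X Y `` {(V, s, f)}" "(V, s, f) \<in> roofs C W X Y"
    "V \<in> cobj C" "s \<in> W V X" "f \<in> chom C V Y"
  using assms by (auto simp: localization_def quotient_def roofs_def)

end

section \<open>Localizing a full subcategory\<close>

locale fractions_subcat = big: fractions C W + small: fractions "C\<lparr>cobj := F\<rparr>" W' for C :: "('o, 'a) cat"
    and W F W' +
  assumes F_sub: "F \<subseteq> cobj C"
    and W'_sub: "\<lbrakk>X \<in> F; Y \<in> F\<rbrakk> \<Longrightarrow> W' X Y \<subseteq> W X Y"
    and full: "\<lbrakk>X \<in> F; Y \<in> F; V \<in> cobj C; s \<in> W V X; f \<in> chom C V Y\<rbrakk>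
      \<Longrightarrow> \<exists>r\<in>roofs (C\<lparr>cobj := F\<rparr>) W' X Y. ((V, s, f), r) \<in> roof_eq C W X Y"
    and faithful: "\<lbrakk>X \<in> F; Y \<in> F; U \<in> cobj C; f \<in> chom C X Y; g \<in> chom C X Y; u \<in> W U X;
        ccomp C U X Y f u = ccomp C U X Y g u\<rbrakk>
      \<Longrightarrow> \<exists>V\<in>F. \<exists>v\<in>W' V X. ccomp C V X Y f v = ccomp C V X Y g v"
begin

abbreviation "C' \<equiv> C\<lparr>cobj := F\<rparr>"

lemma roofs_sub: "\<lbrakk>X \<in> F; Y \<in> F\<rbrakk> \<Longrightarrow> roofs C' W' X Y \<subseteq> roofs C W X Y"
  using F_sub W'_sub by (auto simp: roofs_def; blast)

lemma roof_eq_sub: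
  assumes "X \<in> F" "Y \<in> F" shows "roof_eq C' W' X Y \<subseteq> roof_eq C W X Y"
  using roofs_sub[OF assms] F_sub W'_sub assms unfolding roof_eq_def by (simp; blast)

lemma inclusion_class:
  assumes "X \<in> F" "Y \<in> F" "r \<in> roofs C' W' X Y"
  shows "roof_eq C W X Y `` (roof_eq C' W' X Y `` {r}) = roof_eq C W X Y `` {r}"
proof -
  have e: "equiv (roofs C W X Y) (roof_eq C W X Y)" using assms F_sub big.equiv_roof_eq by blast
  have e': "equiv (roofs C' W' X Y) (roof_eq C' W' X Y)" using assms small.equiv_roof_eq by simp
  have "(r, r) \<in> roof_eq C' W' X Y" using e' assms(3) by (meson equiv_class_self Image_singleton_iff)
  moreover have "roof_eq C W X Y `` {r'} = roof_eq C W X Y `` {r}" if "(r, r') \<in> roof_eq C' W' X Y" for r'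
    using that roof_eq_sub[OF assms(1,2)] equiv_class_eq[OF e] by blast
  ultimately show ?thesis by blast
qed

text \<open>The apex that witnesses equality in the large localization may lie outside
  \<open>F\<close>. The denominators are first aligned by an Ore square inside \<open>F\<close>.
  What is left is an equality of two parallel morphisms of \<open>F\<close> after a large
  denominator \<open>y\<close>, and there \<open>faithful\<close> applies.\<close>

lemma roof_eq_reflect:
  assumes X: "X \<in> F" and Y: "Y \<in> F" and r: "r1 \<in> roofs C' W' X Y" "r2 \<in> roofs C' W' X Y"
    and 12: "(r1, r2) \<in> roof_eq C W X Y"
  shows "(r1, r2) \<in> roof_eq C' W' X Y"
proof -
  obtain V1 s1 f1 where r1: "r1 = (V1, s1, f1)" "V1 \<in> F" "s1 \<in> W' V1 X" "f1 \<in> chom C V1 Y"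
    using r(1) by (auto simp: roofs_def)
  obtain V2 s2 f2 where r2: "r2 = (V2, s2, f2)" "V2 \<in> F" "s2 \<in> W' V2 X" "f2 \<in> chom C V2 Y"
    using r(2) by (auto simp: roofs_def)
  obtain A a1 a2 where A: "V1 \<in> cobj C" "V2 \<in> cobj C" "s1 \<in> W V1 X" "s2 \<in> W V2 X"
      "A \<in> cobj C" "a1 \<in> chom C A V1" "a2 \<in> chom C A V2"
      "ccomp C A V1 X s1 a1 = ccomp C A V2 X s2 a2" "ccomp C A V1 X s1 a1 \<in> W A X"
      "ccomp C A V1 Y f1 a1 = ccomp C A V2 Y f2 a2"
    using big.roof_eqE[OF 12[unfolded r1(1) r2(1)]] by metis
  have ob: "X \<in> cobj C" "Y \<in> cobj C" using X Y F_sub by auto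
  have s: "s1 \<in> chom C V1 X" "s2 \<in> chom C V2 X" using A ob big.W_sub by auto
  obtain D x1 x2 where D: "D \<in> F" "x1 \<in> W' D V1" "x2 \<in> chom C D V2"
      "ccomp C D V1 X s1 x1 = ccomp C D V2 X s2 x2"
    using small.ore[of V1 X V2 s1 s2] X r1 r2 s by auto
  have x1: "x1 \<in> chom C D V1" using small.W_sub[of D V1 x1] D r1 by auto
  have DC: "D \<in> cobj C" using D F_sub by auto
  obtain T y z where T: "T \<in> cobj C" "y \<in> W T D" "z \<in> chom C T A"
     "ccomp C T D V1 x1 y = ccomp C T A V1 a1 z" "ccomp C T D V2 x2 y = ccomp C T A V2 a2 z"
    using big.lift_to_apex[OF ob(1) A(1,2,5) DC A(3,4,6-9) x1 D(3,4)] by metis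
  have y: "y \<in> chom C T D" using T DC big.W_sub by auto
  note mem = ob A(1-7) s r1(4) r2(4) DC x1 D(3) T(1-3) y
  have fx: "ccomp C D V1 Y f1 x1 \<in> chom C D Y" "ccomp C D V2 Y f2 x2 \<in> chom C D Y"
    using mem big.comp_in by metis+
  have "ccomp C T V1 Y f1 (ccomp C T D V1 x1 y) = ccomp C T V2 Y f2 (ccomp C T D V2 x2 y)"
    unfolding T(4,5) using big.square_comp[OF _ _ _ _ _ _ _ _ _ _ A(10)] mem by metis
  hence "ccomp C T D Y (ccomp C D V1 Y f1 x1) y = ccomp C T D Y (ccomp C D V2 Y f2 x2) y"
    using mem big.comp_assoc by metis
  then obtain S v where S: "S \<in> F" "v \<in> W' S D"
     "ccomp C S D Y (ccomp C D V1 Y f1 x1) v = ccomp C S D Y (ccomp C D V2 Y f2 x2) v"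
    using faithful[OF D(1) Y T(1) fx T(2)] by metis
  have v: "v \<in> chom C S D" using small.W_sub[of S D v] S D by auto
  have SC: "S \<in> cobj C" using S F_sub by auto
  note mem = mem SC v
  show ?thesis unfolding r1(1) r2(1)
  proof (rule small.roof_eqI)
    show "ccomp C S D V1 x1 v \<in> chom C' S V1" "ccomp C S D V2 x2 v \<in> chom C' S V2"
      using mem big.comp_in by auto
    show "ccomp C' S V1 X s1 (ccomp C S D V1 x1 v) = ccomp C' S V2 X s2 (ccomp C S D V2 x2 v)"
      using mem D(4) big.comp_assoc[of S D V1 X v x1 s1] big.comp_assoc[of S D V2 X v x2 s2] by simp
    show "ccomp C' S V1 X s1 (ccomp C S D V1 x1 v) \<in> W' S X"
      using small.W_comp[of D V1 X x1 s1] small.W_comp[of S D X v "ccomp C D V1 X s1 x1"]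
        big.comp_assoc[of S D V1 X v x1 s1] mem X D S r1 by simp
    show "ccomp C' S V1 Y f1 (ccomp C S D V1 x1 v) = ccomp C' S V2 Y f2 (ccomp C S D V2 x2 v)"
      using mem S(3) big.comp_assoc[of S D V1 Y v x1 f1] big.comp_assoc[of S D V2 Y v x2 f2] by simp
  qed (use r r1 r2 S in auto)
qed

lemma fully_faithful_localization:
  "fully_faithful (localization C' W') (localization C W) id (\<lambda>X Y c. roof_eq C W X Y `` c)"
proof -
  let ?D = "localization C W" and ?D' = "localization C' W'"
  have ob: "cobj ?D' = F" "cobj ?D = cobj C" by (simp_all add: localization_def)
  have hom: "chom ?D X Y = roofs C W X Y // roof_eq C W X Y"
    "chom ?D' X Y = roofs C' W' X Y // roof_eq C' W' X Y" for X Y by (simp_all add: localization_def)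
  have bij: "bij_betw (\<lambda>c. roof_eq C W X Y `` c) (chom ?D' X Y) (chom ?D X Y)" if X: "X \<in> F" and Y: "Y \<in> F" for X Y
  proof -
    have e: "equiv (roofs C W X Y) (roof_eq C W X Y)" using X Y F_sub big.equiv_roof_eq by blast
    have e': "equiv (roofs C' W' X Y) (roof_eq C' W' X Y)" using X Y small.equiv_roof_eq by simp
    have inj: "c1 = c2" if c: "c1 \<in> chom ?D' X Y" "c2 \<in> chom ?D' X Y"
        "roof_eq C W X Y `` c1 = roof_eq C W X Y `` c2" for c1 c2
    proof -
      obtain r1 where r1: "c1 = roof_eq C' W' X Y `` {r1}" "r1 \<in> roofs C' W' X Y"
        using c(1) by (auto simp: hom quotient_def)
      obtain r2 where r2: "c2 = roof_eq C' W' X Y `` {r2}" "r2 \<in> roofs C' W' X Y"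
        using c(2) by (auto simp: hom quotient_def)
      have "roof_eq C W X Y `` {r1} = roof_eq C W X Y `` {r2}"
        using c(3) r1 r2 inclusion_class X Y by simp
      hence "(r1, r2) \<in> roof_eq C W X Y"
        using eq_equiv_class[OF _ e] r2 roofs_sub[OF X Y] by blast
      hence "(r1, r2) \<in> roof_eq C' W' X Y" using roof_eq_reflect X Y r1 r2 by blast
      thus ?thesis using equiv_class_eq[OF e'] r1 r2 by simp
    qed
    have into: "roof_eq C W X Y `` c \<in> chom ?D X Y" if "c \<in> chom ?D' X Y" for c
    proof -
      obtain r where r: "c = roof_eq C' W' X Y `` {r}" "r \<in> roofs C' W' X Y"
        using \<open>c \<in> chom ?D' X Y\<close> by (auto simp: hom quotient_def)
      have "r \<in> roofs C W X Y" using r roofs_sub X Y by blast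
      thus ?thesis using r inclusion_class[OF X Y] by (simp add: hom quotientI)
    qed
    have onto: "\<exists>c\<in>chom ?D' X Y. d = roof_eq C W X Y `` c" if dd: "d \<in> chom ?D X Y" for d
    proof -
      obtain V s f where d: "d = roof_eq C W X Y `` {(V, s, f)}" "V \<in> cobj C" "s \<in> W V X" "f \<in> chom C V Y"
        using big.localization_hom[OF dd] by metis
      obtain r where r: "r \<in> roofs C' W' X Y" "((V, s, f), r) \<in> roof_eq C W X Y"
        using full[OF X Y d(2-4)] by blast
      have "d = roof_eq C W X Y `` {r}" using d(1) equiv_class_eq[OF e r(2)] by simp
      moreover have "roof_eq C' W' X Y `` {r} \<in> chom ?D' X Y" using r by (simp add: hom quotientI)
      ultimately show ?thesis using inclusion_class[OF X Y r(1)] by metis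
    qed
    show ?thesis
      unfolding bij_betw_def inj_on_def image_def using inj into onto by blast
  qed
  have idc: "roof_eq C W X X `` cid ?D' X = cid ?D X" if X: "X \<in> F" for X
  proof -
    have "(X, cid C X, cid C X) \<in> roofs C' W' X X"
      using X small.W_id[of X] small.id_in[of X] by (simp add: roofs_def)
    thus ?thesis using inclusion_class[OF X X] by (simp add: localization_def)
  qed
  have comp: "roof_eq C W X Z `` ccomp ?D' X Y Z b a
      = ccomp ?D X Y Z (roof_eq C W Y Z `` b) (roof_eq C W X Y `` a)"
    if X: "X \<in> F" and Y: "Y \<in> F" and Z: "Z \<in> F" and a: "a \<in> chom ?D' X Y" and b: "b \<in> chom ?D' Y Z" for X Y Z a b
  proof -
    obtain V s f where a': "a = roof_eq C' W' X Y `` {(V, s, f)}" "(V, s, f) \<in> roofs C' W' X Y"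
        "V \<in> F" "s \<in> W' V X" "f \<in> chom C V Y"
      using small.localization_hom[OF a] by auto
    obtain V' t g where b': "b = roof_eq C' W' Y Z `` {(V', t, g)}" "(V', t, g) \<in> roofs C' W' Y Z"
        "V' \<in> F" "t \<in> W' V' Y" "g \<in> chom C V' Z"
      using small.localization_hom[OF b] by auto
    \<comment> \<open>An Ore square taken inside \<open>F\<close> is also one for the large
      localization, so one and the same triple represents both composites.\<close>
    obtain U u v where U: "U \<in> F" "u \<in> W' U V" "v \<in> chom C U V'" "ccomp C U V Y f u = ccomp C U V' Y t v"
      using small.ore[of V Y V' f t] a' b' Y by auto
    have uv: "u \<in> W U V" "s \<in> W V X" "t \<in> W V' Y" using W'_sub U a' b' X Y by blast+
    have res: "(U, ccomp C U V X s u, ccomp C U V' Z g v) \<in> roofs C' W' X Z"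
      using small.W_comp[of U V X u s] small.comp_in[of U V' Z v g] U a' b' X Z by (auto simp: roofs_def)
    have "ccomp ?D' X Y Z b a = roof_eq C' W' X Z `` {(U, ccomp C U V X s u, ccomp C U V' Z g v)}"
      using small.localization_comp[OF _ _ _ _ a'(2) b'(2), of U u v] U X Y Z a'(1) b'(1) by simp
    hence "roof_eq C W X Z `` ccomp ?D' X Y Z b a
       = roof_eq C W X Z `` {(U, ccomp C U V X s u, ccomp C U V' Z g v)}"
      using inclusion_class[OF X Z res] by simp
    also have "\<dots> = ccomp ?D X Y Z (roof_eq C W Y Z `` {(V', t, g)}) (roof_eq C W X Y `` {(V, s, f)})"
      using big.localization_comp[of X Y Z U V s f V' t g u v] roofs_sub X Y Z a'(2) b'(2) U uv(1) F_sub
      by (simp add: subset_iff)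
    finally show ?thesis using inclusion_class X Y Z a' b' by simp
  qed
  have into: "roof_eq C W X Y `` c \<in> chom ?D X Y" if "X \<in> F" "Y \<in> F" "c \<in> chom ?D' X Y" for X Y c
    using bij_betwE[OF bij[OF that(1,2)]] that(3) by blast
  show ?thesis
    unfolding fully_faithful_def is_functor_def ob id_apply
    using F_sub bij idc comp into by auto
qed

end

section \<open>Cones and triangles\<close>

context dg_category
begin

text \<open>The differential as a relation that also carries the conditions on objects and degree.
  The Leibniz rule can then be chained by \<open>OF\<close>, leaving only a ring identity to the
  simplifier.\<close>

definition dd :: "'o \<Rightarrow> 'o \<Rightarrow> 'g \<Rightarrow> 'm \<Rightarrow> 'm \<Rightarrow> bool" where
  "dd X Y n f f' \<longleftrightarrow> X \<in> Ob A \<and> Y \<in> Ob A \<and> f \<in> Hom A X Y n \<and> Diff A X Y n f = f'"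

lemma ksign_0: "ksign A 0 x = x"
proof -
  have "sform A 0 (gone A) = sform A 0 (gone A) + sform A 0 (gone A)" using sform_add[of 0 0 "gone A"] by simp
  thus ?thesis by (simp add: ksign_def sform_sym[of "gone A" 0])
qed

lemma ksign_gone: "ksign A (gone A) x = - x"
  using sform_gone by (simp add: ksign_def)

lemma ksign_ugone: "ksign A (- gone A) x = - x"
proof -
  have "sform A 0 (gone A) = sform A (- gone A) (gone A) + sform A (gone A) (gone A)"
    using sform_add[of "- gone A" "gone A" "gone A"] by simp
  moreover have "sform A 0 (gone A) = 0" using sform_add[of 0 0 "gone A"] by simp
  ultimately have "sform A (- gone A) (gone A) = 1" 
    using sform_gone by (cases "sform A (- gone A) (gone A)") auto
  thus ?thesis by (simp add: ksign_def sform_sym[of "gone A"])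
qed

lemma ksign_cases: "ksign A n x = x \<or> ksign A n x = - x"
  by (simp add: ksign_def)

lemma ksign_zero: "ksign A n 0 = 0"
  by (simp add: ksign_def)

lemma dd_ob: "dd X Y n f f' \<Longrightarrow> X \<in> Ob A \<and> Y \<in> Ob A"
  by (simp add: dd_def)

lemma dd_Hom: "dd X Y n f f' \<Longrightarrow> f \<in> Hom A X Y n"
  by (simp add: dd_def)

lemma dd_unique: "dd X Y n f f' \<Longrightarrow> dd X Y n f f'' \<Longrightarrow> f' = f''"
  by (simp add: dd_def)

lemma ddI: "X \<in> Ob A \<Longrightarrow> Y \<in> Ob A \<Longrightarrow> f \<in> Hom A X Y n \<Longrightarrow> dd X Y n f (Diff A X Y n f)"
  by (simp add: dd_def)

lemma dd_Cyc: "dd X Y n f 0 \<longleftrightarrow> X \<in> Ob A \<and> Y \<in> Ob A \<and> f \<in> Cyc A X Y n"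
  by (auto simp: dd_def Cyc_def)

lemma dd_comp: "dd Y Z j g g' \<Longrightarrow> dd X Y i f f' \<Longrightarrow> n = i + j \<Longrightarrow> dd X Z n (g * f) (g' * f + ksign A j (g * f'))"
  unfolding dd_def using comp_Hom Leibniz by blast

lemma dd_comp0: "dd Y Z 0 g g' \<Longrightarrow> dd X Y n f f' \<Longrightarrow> dd X Z n (g * f) (g' * f + g * f')"
  using dd_comp[of Y Z 0 g g' X n f f' n] by (simp add: ksign_0)

lemma dd_comp1: "dd Y Z (gone A) g g' \<Longrightarrow> dd X Y i f f' \<Longrightarrow> n = i + gone A \<Longrightarrow> dd X Z n (g * f) (g' * f - g * f')"
  using dd_comp[of Y Z "gone A" g g' X i f f' n] by (simp add: ksign_gone)

lemma dd_compm: "dd Y Z (- gone A) g g' \<Longrightarrow> dd X Y i f f' \<Longrightarrow> n = i - gone A \<Longrightarrow> dd X Z n (g * f) (g' * f - g * f')"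
  using dd_comp[of Y Z "- gone A" g g' X i f f' n] by (simp add: ksign_ugone)

lemma dd_compm0: "dd Y Z (- gone A) g g' \<Longrightarrow> dd X Y 0 f f' \<Longrightarrow> dd X Z (- gone A) (g * f) (g' * f - g * f')"
  using dd_compm by fastforce

lemma dd_compm1: "dd Y Z (- gone A) g g' \<Longrightarrow> dd X Y (gone A) f f' \<Longrightarrow> dd X Z 0 (g * f) (g' * f - g * f')"
  using dd_compm by fastforce

lemma dd_comp10: "dd Y Z (gone A) g g' \<Longrightarrow> dd X Y 0 f f' \<Longrightarrow> dd X Z (gone A) (g * f) (g' * f - g * f')"
  using dd_comp1 by fastforce

lemma dd_comp1m: "dd Y Z (gone A) g g' \<Longrightarrow> dd X Y (- gone A) f f' \<Longrightarrow> dd X Z 0 (g * f) (g' * f - g * f')"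
  using dd_comp1 by fastforce

lemma dd_closed_comp: "dd Y Z j g 0 \<Longrightarrow> dd X Y i f 0 \<Longrightarrow> n = i + j \<Longrightarrow> dd X Z n (g * f) 0"
  using dd_comp[of Y Z j g 0 X i f 0 n] by (simp add: ksign_zero)

lemma dd_add: "dd X Y n f f' \<Longrightarrow> dd X Y n g g' \<Longrightarrow> dd X Y n (f + g) (f' + g')"
  unfolding dd_def using add_Hom Diff_add by simp

lemma dd_zero: "X \<in> Ob A \<Longrightarrow> Y \<in> Ob A \<Longrightarrow> dd X Y n 0 0"
  unfolding dd_def using zero_Hom Diff_add[of X Y 0 n 0] by simp

lemma dd_minus: assumes "dd X Y n f f'" shows "dd X Y n (- f) (- f')"
proof -
  have m: "dd X Y n (- f) (Diff A X Y n (- f))" using assms uminus_Hom by (simp add: dd_def)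
  have "f' + Diff A X Y n (- f) = 0"
    using dd_unique[OF dd_add[OF assms m]] dd_zero assms by (simp add: dd_def)
  thus ?thesis using m by (metis add.inverse_unique)
qed

lemma dd_diff: "dd X Y n f f' \<Longrightarrow> dd X Y n g g' \<Longrightarrow> dd X Y n (f - g) (f' - g')"
  using dd_add[OF _ dd_minus] by fastforce

lemma dd_idt: assumes "X \<in> Ob A" shows "dd X X 0 (Idt A X) 0"
proof -
  have 1: "dd X X 0 (Idt A X) (Diff A X X 0 (Idt A X))" using assms Idt_Hom by (simp add: dd_def)
  have h: "Diff A X X 0 (Idt A X) \<in> Hom A X X (gone A)" using Diff_Hom[OF assms assms Idt_Hom[OF assms]] by simp
  let ?e = "Idt A X" and ?d = "Diff A X X 0 (Idt A X)"
  \<comment> \<open>The Leibniz rule applied to the idempotent identity gives d(1) = 2 d(1).\<close>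
  have "dd X X 0 (?e * ?e) (?d * ?e + ?e * ?d)" by (rule dd_comp0[OF 1 1])
  hence "?d = ?d + ?d"
    using 1 assms h Idt_left[OF assms assms] Idt_right[OF assms assms] Idt_Hom[OF assms] by (simp add: dd_def)
  thus ?thesis using 1 by simp
qed

lemma dd_deriv: "dd X Y n f f' \<Longrightarrow> m = n + gone A \<Longrightarrow> dd X Y m f' 0"
  unfolding dd_def using Diff_Hom Diff_Diff by auto

lemma dd_id:
  assumes "dd X Y n f f'"
  shows "Idt A Y * f = f" "f * Idt A X = f" "Idt A Y * (f * h) = f * h" "f * (Idt A X * h) = f * h"
    "Idt A Y * f' = f'" "f' * Idt A X = f'" "Idt A Y * (f' * h) = f' * h" "f' * (Idt A X * h) = f' * h"
proof -
  have "dd X Y (n + gone A) f' 0" using dd_deriv assms by blast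
  then show "Idt A Y * f = f" "f * Idt A X = f" "Idt A Y * f' = f'" "f' * Idt A X = f'"
    using assms Idt_left Idt_right by (auto simp: dd_def)
  then show "Idt A Y * (f * h) = f * h" "f * (Idt A X * h) = f * h"
    "Idt A Y * (f' * h) = f' * h" "f' * (Idt A X * h) = f' * h"
    by (metis mult.assoc)+
qed

section \<open>Coboundaries, homotopy equivalences and cones\<close>

definition Bd :: "'o \<Rightarrow> 'o \<Rightarrow> 'g \<Rightarrow> 'm set" where
  "Bd X Y n = {f. \<exists>h. dd X Y (n - gone A) h f}"

lemma BdI: "dd X Y m h f \<Longrightarrow> m = n - gone A \<Longrightarrow> f \<in> Bd X Y n"
  by (auto simp: Bd_def)

lemma Bd_closed: "f \<in> Bd X Y n \<Longrightarrow> dd X Y n f 0"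
  unfolding Bd_def using dd_deriv by fastforce

lemma Bd_zero: "X \<in> Ob A \<Longrightarrow> Y \<in> Ob A \<Longrightarrow> 0 \<in> Bd X Y n"
  unfolding Bd_def using dd_zero by blast

lemma Bd_add: "f \<in> Bd X Y n \<Longrightarrow> g \<in> Bd X Y n \<Longrightarrow> f + g \<in> Bd X Y n"
  unfolding Bd_def using dd_add by blast

lemma Bd_minus: "f \<in> Bd X Y n \<Longrightarrow> - f \<in> Bd X Y n"
  unfolding Bd_def using dd_minus by blast

lemma Bd_diff: "f \<in> Bd X Y n \<Longrightarrow> g \<in> Bd X Y n \<Longrightarrow> f - g \<in> Bd X Y n"
  unfolding Bd_def using dd_diff by blast

lemma Bd_right: assumes "dd X Y i f 0" "g \<in> Bd Y Z j" "n = i + j" shows "g * f \<in> Bd X Z n"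
proof -
  obtain h where h: "dd Y Z (j - gone A) h g" using assms(2) by (auto simp: Bd_def)
  show ?thesis
    by (rule BdI[of X Z "i + j - gone A" "h * f"]) (use dd_comp[OF h assms(1), of "i + j - gone A"] assms(3) in \<open>simp_all add: ksign_zero\<close>)
qed

lemma Bd_left: assumes "f \<in> Bd X Y i" "dd Y Z j g 0" "n = i + j" shows "g * f \<in> Bd X Z n"
proof -
  obtain h where h: "dd X Y (i - gone A) h f" using assms(1) by (auto simp: Bd_def)
  have d: "dd X Z (i - gone A + j) (g * h) (ksign A j (g * f))" using dd_comp[OF assms(2) h refl] by simp
  have "ksign A j (g * f) \<in> Bd X Z n" by (rule BdI[OF d]) (use assms(3) in simp)
  thus ?thesis using Bd_minus[of "- (g * f)"] ksign_cases[of j "g * f"] by auto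
qed

lemma Bd_obs: "f \<in> Bd X Y n \<Longrightarrow> X \<in> Ob A \<and> Y \<in> Ob A"
  by (auto simp: Bd_def dd_def)

definition hiso :: "'o \<Rightarrow> 'o \<Rightarrow> bool" where
  "hiso X Y \<longleftrightarrow> (\<exists>f g. dd X Y 0 f 0 \<and> dd Y X 0 g 0 \<and> g * f - Idt A X \<in> Bd X X 0 \<and> f * g - Idt A Y \<in> Bd Y Y 0)"

text \<open>The equational, self-dual form of \<open>is_cone\<close>, with the nonclosed injection \<open>i\<close>.\<close>

definition cone :: "'o \<Rightarrow> 'm \<Rightarrow> 'o \<Rightarrow> 'o \<Rightarrow> 'm \<Rightarrow> 'm \<Rightarrow> 'm \<Rightarrow> 'm \<Rightarrow> bool" where
  "cone X f Y C q p j i \<longleftrightarrow> dd X Y 0 f 0 \<and> dd C Y 0 q (- (f * p)) \<and> dd C X (gone A) p 0 \<and>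
     dd Y C 0 j 0 \<and> dd X C (- gone A) i (j * f) \<and>
     q * j = Idt A Y \<and> p * i = Idt A X \<and> q * i = 0 \<and> p * j = 0 \<and> j * q + i * p = Idt A C"

text \<open>Rewrite rules that eliminate \<open>j * q\<close> in favour of \<open>i * p\<close>. The
  versions with a trailing factor \<open>h\<close> let products associated to the right be
  normalized, which is how the identities for triangles are verified below.\<close>

lemma cone_eqs:
  assumes "cone X f Y C q p j i"
  shows "q * j = Idt A Y" "p * i = Idt A X" "q * i = 0" "p * j = 0"
   "q * (j * h) = Idt A Y * h" "p * (i * h) = Idt A X * h" "q * (i * h) = 0" "p * (j * h) = 0"
   "j * (q * h) = Idt A C * h - i * (p * h)" "j * q = Idt A C - i * p"
proof -
  have e: "q * j = Idt A Y" "p * i = Idt A X" "q * i = 0" "p * j = 0" "j * q + i * p = Idt A C"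
    using assms by (auto simp: cone_def)
  show "q * j = Idt A Y" "p * i = Idt A X" "q * i = 0" "p * j = 0" by (fact e)+
  show "q * (j * h) = Idt A Y * h" "p * (i * h) = Idt A X * h" "q * (i * h) = 0" "p * (j * h) = 0"
    using e(1-4) by (metis mult.assoc mult_zero_left)+
  show j: "j * q = Idt A C - i * p" using e(5) by (metis add_diff_cancel_right')
  show "j * (q * h) = Idt A C * h - i * (p * h)" using j by (metis mult.assoc left_diff_distrib)
qed

lemma cone_dd:
  assumes "cone X f Y C q p j i"
  shows "dd X Y 0 f 0" "dd C Y 0 q (- (f * p))" "dd C X (gone A) p 0" "dd Y C 0 j 0" "dd X C (- gone A) i (j * f)"
   "dd C C 0 (Idt A C) 0" "dd X X 0 (Idt A X) 0" "dd Y Y 0 (Idt A Y) 0"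
  using assms by (auto simp: cone_def dest: dd_ob intro: dd_idt)

lemma cone_imp_is_cone:
  assumes "cone X f Y C q p j i"
  shows "is_cone A X f Y C q p"
proof -
  note d = cone_dd[OF assms] note e = cone_eqs[OF assms]
  have ob: "X \<in> Ob A" "Y \<in> Ob A" "C \<in> Ob A" using d dd_ob by blast+
  have "\<exists>!h. h \<in> Hom A Z C n \<and> q * h = b \<and> p * h = a"
    if Z: "Z \<in> Ob A" and b: "b \<in> Hom A Z Y n" and a: "a \<in> Hom A Z X (n + gone A)" for Z n a b
  proof (rule ex1I)
    have db: "dd Z Y n b (Diff A Z Y n b)" using b Z ob by (simp add: dd_def)
    have da: "dd Z X (n + gone A) a (Diff A Z X (n + gone A) a)" using a Z ob by (simp add: dd_def)
    have "dd Z C n (j * b + i * a) (j * Diff A Z Y n b + (j * f * a - i * Diff A Z X (n + gone A) a))"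
      using dd_add[OF dd_comp0[OF d(4) db] dd_compm[OF d(5) da, of n]] by simp
    thus "j * b + i * a \<in> Hom A Z C n \<and> q * (j * b + i * a) = b \<and> p * (j * b + i * a) = a"
      using dd_id(1)[OF db] dd_id(1)[OF da] by (simp add: algebra_simps e dd_def)
  next
    fix h assume h: "h \<in> Hom A Z C n \<and> q * h = b \<and> p * h = a"
    have "Idt A C * h = h" using h Idt_left[OF Z ob(3)] by blast
    moreover have "(j * q + i * p) * h = j * b + i * a" using h by (auto simp: algebra_simps mult.assoc simp del: e)
    ultimately show "h = j * b + i * a" using assms by (simp add: cone_def)
  qed
  thus ?thesis unfolding is_cone_def using ob d by (auto simp: dd_def Cyc_def)
qed

lemma is_cone_imp_cone:
  assumes "is_cone A X f Y C q p"
  obtains j i where "cone X f Y C q p j i"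
proof -
  have ob: "X \<in> Ob A" "Y \<in> Ob A" "C \<in> Ob A" and f: "f \<in> Cyc A X Y 0"
    and q: "q \<in> Hom A C Y 0" and p: "p \<in> Hom A C X (gone A)"
    and dq: "Diff A C Y 0 q + f * p = 0" and dp: "Diff A C X (gone A) p = 0"
    and U: "\<And>Z n b a. \<lbrakk>Z \<in> Ob A; b \<in> Hom A Z Y n; a \<in> Hom A Z X (n + gone A)\<rbrakk>
        \<Longrightarrow> \<exists>!h. h \<in> Hom A Z C n \<and> q * h = b \<and> p * h = a"
    using assms unfolding is_cone_def by auto
  have df: "dd X Y 0 f 0" using ob f by (simp add: dd_Cyc)
  have Dq: "dd C Y 0 q (- (f * p))" using ob q dq by (simp add: dd_def eq_neg_iff_add_eq_0)
  have Dp: "dd C X (gone A) p 0" using ob p dp by (simp add: dd_def)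
  \<comment> \<open>\<open>j\<close> and \<open>i\<close> solve the universal problem for the pairs
    (1, 0) and (0, 1). Their differentials are found by differentiating the defining equations and
    comparing components with \<open>uniq\<close>.\<close>
  obtain j where j: "j \<in> Hom A Y C 0" "q * j = Idt A Y" "p * j = 0"
    using U[OF ob(2), of "Idt A Y" 0 0] Idt_Hom zero_Hom ob by auto
  obtain i where i: "i \<in> Hom A X C (- gone A)" "q * i = 0" "p * i = Idt A X"
    using U[OF ob(1), of 0 "- gone A" "Idt A X"] Idt_Hom zero_Hom ob by auto
  have uniq: "h = h'" if "dd Z C n h x" "dd Z C n h' y" "q * h = q * h'" "p * h = p * h'" for Z n h h' x y
  proof -
    have h: "Z \<in> Ob A" "h \<in> Hom A Z C n" "h' \<in> Hom A Z C n" using that by (auto simp: dd_def)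
    have "q * h \<in> Hom A Z Y n" "p * h \<in> Hom A Z X (n + gone A)"
      using comp_Hom[OF h(1) ob(3,2) h(2) q] comp_Hom[OF h(1) ob(3,1) h(2) p] by simp_all
    thus ?thesis using U[OF h(1), of "q * h" n "p * h"] h that(3,4) by metis
  qed
  have Dj: "dd Y C 0 j (Diff A Y C 0 j)" using ob j by (simp add: dd_def)
  have Di: "dd X C (- gone A) i (Diff A X C (- gone A) i)" using ob i by (simp add: dd_def)
  have Dj': "dd Y C (gone A) (Diff A Y C 0 j) 0" using dd_deriv[OF Dj] by simp
  have Di': "dd X C 0 (Diff A X C (- gone A) i) 0" using dd_deriv[OF Di] by simp
  have 1: "dd Y Y 0 (Idt A Y) (- (f * p * j) + q * Diff A Y C 0 j)"
    using dd_comp0[OF Dq Dj] j by simp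
  have "q * Diff A Y C 0 j = 0" using dd_unique[OF 1 dd_idt] ob j by (simp add: mult.assoc)
  moreover have 2: "dd Y X (gone A) (p * j) (0 * j - p * Diff A Y C 0 j)" using dd_comp1[OF Dp Dj] by simp
  have "p * Diff A Y C 0 j = 0"
    using dd_unique[OF 2[unfolded j(3)] dd_zero] ob by simp
  ultimately have j0: "Diff A Y C 0 j = 0" using uniq[OF Dj' dd_zero] ob by simp
  have jf: "dd X C 0 (j * f) 0" using dd_closed_comp[OF Dj[unfolded j0] df] by simp
  have 3: "dd X Y (- gone A) (q * i) (- (f * p * i) + q * Diff A X C (- gone A) i)"
    using dd_comp0[OF Dq Di] by simp
  have fi: "f * Idt A X = f" using dd_id(2)[OF df] .
  have "q * Diff A X C (- gone A) i = f"
    using dd_unique[OF 3[unfolded i(2)] dd_zero] ob i(3) fi by (simp add: mult.assoc)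
  moreover have 4: "dd X X 0 (p * i) (0 * i - p * Diff A X C (- gone A) i)" using dd_comp1[OF Dp Di] by simp
  have "p * Diff A X C (- gone A) i = 0"
    using dd_unique[OF 4[unfolded i(3)] dd_idt] ob by simp
  moreover have "q * (j * f) = f" "p * (j * f) = 0"
    using j(2,3) dd_id(1)[OF df] by (metis mult.assoc mult_zero_left)+
  ultimately have i0: "Diff A X C (- gone A) i = j * f" using uniq[OF Di' jf] by simp
  have "dd C C 0 (j * q) (j * - (f * p))" using dd_comp0[OF Dj[unfolded j0] Dq] by simp
  moreover have "dd C C 0 (i * p) (j * f * p)" using dd_compm[OF Di Dp] i0 by simp
  ultimately have t: "dd C C 0 (j * q + i * p) (j * - (f * p) + j * f * p)" by (rule dd_add)
  have "q * (j * q) = q" "q * (i * p) = 0" "p * (j * q) = 0" "p * (i * p) = p"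
    using j(2,3) i(2,3) dd_id(1)[OF Dq] dd_id(1)[OF Dp] by (metis mult.assoc mult_zero_left)+
  hence "j * q + i * p = Idt A C"
    using uniq[OF t dd_idt[OF ob(3)]] dd_id(2)[OF Dq] dd_id(2)[OF Dp] by (simp add: distrib_left)
  thus thesis using that[of j i] df Dq Dp Dj Di j i unfolding cone_def j0 i0 by simp
qed

lemma is_cone_iff: "is_cone A X f Y C q p \<longleftrightarrow> (\<exists>j i. cone X f Y C q p j i)"
  using cone_imp_is_cone is_cone_imp_cone by metis

text \<open>The homotopy is absorbed into the two nonclosed structure maps \<open>q\<close> and
  \<open>i\<close>, so homotopic morphisms share the same cone object.\<close>

lemma cone_homotopic:
  assumes c: "cone X f Y C q p j i" and h: "dd X Y (- gone A) h h'"
  shows "cone X (f + h') Y C (q - h * p) p j (i + j * h)"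
proof -
  note d = cone_dd[OF c] note e = cone_eqs[OF c]
  have hp: "dd C Y 0 (h * p) (h' * p)" using dd_compm[OF h d(3)] by simp
  have jh: "dd X C (- gone A) (j * h) (j * h')" using dd_comp0[OF d(4) h] by simp
  have "dd X Y 0 (f + h') 0" using dd_add[OF d(1) dd_deriv[OF h]] by simp
  moreover have "dd C Y 0 (q - h * p) (- ((f + h') * p))"
    using dd_diff[OF d(2) hp] by (simp add: algebra_simps)
  moreover have "dd X C (- gone A) (i + j * h) (j * (f + h'))"
    using dd_add[OF d(5) jh] by (simp add: algebra_simps)
  ultimately show ?thesis unfolding cone_def using d by (simp add: e dd_id[OF h] dd_id[OF d(3)] dd_id[OF d(4)] algebra_simps)
qed

section \<open>Exactness of Hom into and out of a cone triangle\<close>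

lemma cone_exact_C:
  assumes c: "cone X f Y C q p j i" and g: "dd Q C 0 g 0" and pg: "p * g \<in> Bd Q X (gone A)"
  obtains g' where "dd Q Y 0 g' 0" "g - j * g' \<in> Bd Q C 0"
proof -
  note d = cone_dd[OF c] note e = cone_eqs[OF c]
  obtain h where h: "dd Q X 0 h (p * g)" using pg by (auto simp: Bd_def)
  have 1: "dd Q Y 0 (q * g + f * h) 0" using dd_add[OF dd_comp0[OF d(2) g] dd_comp0[OF d(1) h]]
    by (simp add: algebra_simps)
  have 2: "dd Q C (- gone A) (i * h) (j * f * h - i * (p * g))" using dd_compm[OF d(5) h] by simp
  have "g - j * (q * g + f * h) = - (j * f * h - i * (p * g))"
    by (simp add: e dd_id[OF g] algebra_simps)
  hence "g - j * (q * g + f * h) \<in> Bd Q C 0" using Bd_minus[OF BdI[OF 2, of 0]] by simp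
  thus thesis using that 1 by blast
qed

lemma cone_exact_Y:
  assumes c: "cone X f Y C q p j i" and g: "dd Q Y 0 g 0" and jg: "j * g \<in> Bd Q C 0"
  obtains g' where "dd Q X 0 g' 0" "g - f * g' \<in> Bd Q Y 0"
proof -
  note d = cone_dd[OF c] note e = cone_eqs[OF c]
  obtain h where h: "dd Q C (- gone A) h (j * g)" using jg by (auto simp: Bd_def)
  have 1: "dd Q X 0 (p * h) 0" using dd_comp1m[OF d(3) h] by (simp add: e)
  have 2: "dd Q Y (- gone A) (q * h) (g - f * (p * h))"
    using dd_comp0[OF d(2) h] by (simp add: e dd_id[OF g] algebra_simps)
  show thesis using that[OF 1 BdI[OF 2]] by simp
qed

text \<open>The connecting map \<open>p\<close> has degree \<open>gone A\<close>, so the factor has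
  smaller degree than \<open>g\<close>. Leaving \<open>n\<close> free avoids passing to shifts of
  \<open>X\<close>. The factorization is strict, not just up to homotopy.\<close>

lemma cone_exact_X:
  assumes c: "cone X f Y C q p j i" and g: "dd Q X n g 0" and fg: "f * g \<in> Bd Q Y n" and m: "m = n - gone A"
  obtains g' where "dd Q C m g' 0" "g = p * g'"
proof -
  note d = cone_dd[OF c] note e = cone_eqs[OF c]
  obtain h where h: "dd Q Y m h (f * g)" using fg m by (auto simp: Bd_def)
  have 1: "dd Q C m (i * g - j * h) 0"
    using dd_diff[OF dd_compm[OF d(5) g m] dd_comp0[OF d(4) h]] by (simp add: algebra_simps)
  show thesis using that[OF 1] by (simp add: e dd_id[OF g] algebra_simps)
qed

lemma cone_coexact_Y:
  assumes c: "cone X f Y C q p j i" and g: "dd Y Q 0 g 0" and gf: "g * f \<in> Bd X Q 0"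
  obtains g' where "dd C Q 0 g' 0" "g = g' * j"
proof -
  note d = cone_dd[OF c] note e = cone_eqs[OF c]
  obtain h where h: "dd X Q (- gone A) h (g * f)" using gf by (auto simp: Bd_def)
  have 1: "dd C Q 0 (g * q + h * p) 0"
    using dd_add[OF dd_comp0[OF g d(2)] dd_compm[OF h d(3)]] by (simp add: algebra_simps)
  show thesis using that[OF 1] by (simp add: e dd_id[OF g] algebra_simps)
qed

lemma cone_coexact_X:
  assumes c: "cone X f Y C q p j i" and g: "dd X Q 0 g 0" and gp: "g * p \<in> Bd C Q (gone A)"
  obtains g' where "dd Y Q 0 g' 0" "g - g' * f \<in> Bd X Q 0"
proof -
  note d = cone_dd[OF c] note e = cone_eqs[OF c]
  obtain h where h: "dd C Q 0 h (g * p)" using gp by (auto simp: Bd_def)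
  have 1: "dd Y Q 0 (h * j) 0" using dd_comp0[OF h d(4)] by (simp add: e algebra_simps)
  have 2: "dd X Q (- gone A) (h * i) (g + h * j * f)"
    using dd_comp0[OF h d(5)] by (simp add: e dd_id[OF g] algebra_simps)
  show thesis using that[of "- (h * j)"] dd_minus[OF 1] BdI[OF 2, of 0] by (simp add: algebra_simps)
qed

lemma cone_coexact_C:
  assumes c: "cone X f Y C q p j i" and g: "dd C Q 0 g 0" and gj: "g * j \<in> Bd Y Q 0"
  obtains g' where "dd X Q (- gone A) g' 0" "g - g' * p \<in> Bd C Q 0"
proof -
  note d = cone_dd[OF c] note e = cone_eqs[OF c]
  obtain h where h: "dd Y Q (- gone A) h (g * j)" using gj by (auto simp: Bd_def)
  have 1: "dd X Q (- gone A) (g * i - h * f) 0"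
    using dd_diff[OF dd_comp0[OF g d(5)] dd_compm[OF h d(1)]] by (simp add: algebra_simps)
  have 2: "dd C Q (- gone A) (h * q) (g - (g * i - h * f) * p)"
    using dd_compm[OF h d(2)] by (simp add: e dd_id[OF g] algebra_simps)
  show thesis using that[OF 1 BdI[OF 2]] by simp
qed

text \<open>The two rotations of the triangle \<open>X \<rightarrow> Y \<rightarrow> C \<rightarrow> X[1]\<close>.\<close>

lemma rotate_cone:
  assumes c: "cone X f Y C q p j i" and D: "cone Y j C D Q P J I"
  obtains u v where "dd D X (gone A) u 0" "dd X D (- gone A) v 0" "u * v = Idt A X" "v * u - Idt A D \<in> Bd D D 0"
    "p = u * J"
proof -
  note d = cone_dd[OF c] note e = cone_eqs[OF c] note d' = cone_dd[OF D] note e' = cone_eqs[OF D]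
  note ids = d[THEN dd_id(1)] d[THEN dd_id(2)] d'[THEN dd_id(1)] d'[THEN dd_id(2)]
    d[THEN dd_id(3)] d[THEN dd_id(4)] d'[THEN dd_id(3)] d'[THEN dd_id(4)]
  have u: "dd D X (gone A) (p * Q) 0" using dd_comp10[OF d(3) d'(2)] by (simp add: algebra_simps e)
  have v: "dd X D (- gone A) (J * i - I * f) 0"
    using dd_diff[OF dd_comp0[OF d'(4) d(5)] dd_compm0[OF d'(5) d(1)]] by (simp add: algebra_simps)
  \<comment> \<open>As a graded object \<open>D\<close> is \<open>Y + X[1] + Y[1]\<close>. This
    homotopy cancels \<open>Y\<close> against \<open>Y[1]\<close> and leaves
    \<open>X[1]\<close>.\<close>
  have h: "dd D D (- gone A) (I * (q * Q)) (J * (j * (q * Q)) - I * (- (f * p * Q) + q * - (j * P)))"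
    using dd_compm0[OF d'(5) dd_comp0[OF d(2) d'(2)]] by (simp add: algebra_simps)
  have "(J * i - I * f) * (p * Q) - Idt A D
      = - (J * (j * (q * Q)) - I * (- (f * p * Q) + q * - (j * P)))"
    by (simp add: e e' ids algebra_simps)
  hence "(J * i - I * f) * (p * Q) - Idt A D \<in> Bd D D 0" using Bd_minus[OF BdI[OF h, of 0]] by simp
  thus thesis using that[OF u v] by (simp add: e e' ids algebra_simps)
qed

lemma rotate_cone_back:
  assumes c: "cone X f Y C q p j i" and s: "dd C C1 (gone A) s 0" "dd C1 C (- gone A) t 0"
      "t * s = Idt A C" "s * t = Idt A C1"
    and D: "cone C1 (p * t) X D Q P J I"
  shows "hiso Y D"
proof -
  note d = cone_dd[OF c] note e = cone_eqs[OF c] note d' = cone_dd[OF D] note e' = cone_eqs[OF D]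
  have P0: "dd D C 0 (t * P) 0" using dd_closed_comp[OF s(2) d'(3)] by simp
  have I0: "dd C D 0 (I * s) (J * p)"
    using dd_compm1[OF d'(5) s(1)] by (simp add: s(3) dd_id[OF d(3)] algebra_simps)
  have ts: "t * (s * x) = Idt A C * x" "s * (t * x) = Idt A C1 * x" for x
    using s(3,4) by (metis mult.assoc)+
  note ids = d[THEN dd_id(1)] d[THEN dd_id(2)] d'[THEN dd_id(1)] d'[THEN dd_id(2)]
    d[THEN dd_id(3)] d[THEN dd_id(4)] d'[THEN dd_id(3)] d'[THEN dd_id(4)]
    s(1,2)[THEN dd_id(1)] s(1,2)[THEN dd_id(2)] s(1,2)[THEN dd_id(3)] s(1,2)[THEN dd_id(4)]
  have u: "dd D Y 0 (q * (t * P) - f * Q) 0"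
    using dd_diff[OF dd_comp0[OF d(2) P0] dd_comp0[OF d(1) d'(2)]] by (simp add: algebra_simps)
  have v: "dd Y D 0 (I * s * j) 0"
    using dd_comp0[OF I0 d(4)] by (simp add: e algebra_simps)
  have uv: "(q * (t * P) - f * Q) * (I * s * j) = Idt A Y"
    by (simp add: e e' ts ids algebra_simps)
  \<comment> \<open>Here \<open>D\<close> is \<open>X + Y + X[1]\<close> as a graded object, the
    last two summands coming from \<open>C\<close>. The homotopy cancels \<open>X\<close> against
    \<open>X[1]\<close> and leaves \<open>Y\<close>.\<close>
  have h1: "dd D D (- gone A) (I * s * (i * Q)) (J * p * (i * Q) + I * s * (j * f * Q - i * (- (p * t * P))))"
    using dd_comp0[OF I0 dd_compm0[OF d(5) d'(2)]] by (simp add: algebra_simps)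
  have "(I * s * j) * (q * (t * P) - f * Q) - Idt A D
     = - (J * p * (i * Q) + I * s * (j * f * Q - i * (- (p * t * P))))"
    by (simp add: e e' ts ids algebra_simps)
  hence "(I * s * j) * (q * (t * P) - f * Q) - Idt A D \<in> Bd D D 0" using Bd_minus[OF BdI[OF h1, of 0]] by simp
  thus ?thesis unfolding hiso_def using u v uv Bd_zero dd_ob[OF u] by (metis cancel_comm_monoid_add_class.diff_cancel)
qed

text \<open>As a graded object \<open>D\<close> is \<open>Z + X[1] + Y[1] + X[2]\<close>. The
  homotopy \<open>I * (i1 * (p3 * Q))\<close> cancels \<open>X[1]\<close> against
  \<open>X[2]\<close>, leaving the summands \<open>Z + Y[1]\<close> of \<open>C2\<close>; the
  composite in the other direction is strictly the identity.\<close>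

lemma octahedron:
  assumes c1: "cone X f Y C1 q1 p1 j1 i1" and c2: "cone Y g Z C2 q2 p2 j2 i2"
    and c3: "cone X (g * f) Z C3 q3 p3 j3 i3"
    and D: "cone C1 \<phi> C3 D Q P J I" and \<phi>: "\<phi> = j3 * g * q1 + i3 * p1"
  shows "hiso C2 D"
proof -
  note d1 = cone_dd[OF c1] note e1 = cone_eqs[OF c1]
  note d2 = cone_dd[OF c2] note e2 = cone_eqs[OF c2]
  note d3 = cone_dd[OF c3] note e3 = cone_eqs[OF c3]
  note d = cone_dd[OF D] note e = cone_eqs[OF D]
  note ds = d1 d2 d3 d
  note ids = ds[THEN dd_id(1)] ds[THEN dd_id(2)] ds[THEN dd_id(3)] ds[THEN dd_id(4)]
  note es = e1 e2 e3 e
  let ?a = "J * (j3 * q2) + I * (j1 * p2)"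
  let ?b = "j2 * (q3 * Q) + i2 * (q1 * P) + i2 * (f * (p3 * Q))"
  have a: "dd C2 D 0 ?a 0"
    using dd_add[OF dd_comp0[OF d(4) dd_comp0[OF d3(4) d2(2)]] dd_compm1[OF d(5) dd_comp0[OF d1(4) d2(3)]]]
    by (simp add: \<phi> es ids algebra_simps)
  have b: "dd D C2 0 ?b 0"
    using dd_add[OF dd_add[OF dd_comp0[OF d2(4) dd_comp0[OF d3(2) d(2)]]
        dd_compm1[OF d2(5) dd_comp0[OF d1(2) d(3)]]]
        dd_compm1[OF d2(5) dd_comp0[OF d1(1) dd_comp10[OF d3(3) d(2)]]]]
    by (simp add: \<phi> es ids algebra_simps)
  have ba: "?b * ?a = Idt A C2" by (simp add: es ids algebra_simps)
  have h: "dd D D (- gone A) (I * (i1 * (p3 * Q)))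
     (\<phi> * 0 + J * \<phi> * (i1 * (p3 * Q)) - I * (j1 * f * (p3 * Q) - i1 * (- (p3 * - (\<phi> * P)))))"
    using dd_compm0[OF d(5) dd_compm1[OF d1(5) dd_comp10[OF d3(3) d(2)]]] by simp
  have "?a * ?b - Idt A D = - (\<phi> * 0 + J * \<phi> * (i1 * (p3 * Q)) - I * (j1 * f * (p3 * Q) - i1 * (- (p3 * - (\<phi> * P)))))"
    by (simp add: \<phi> es ids algebra_simps)
  hence "?a * ?b - Idt A D \<in> Bd D D 0" using Bd_minus[OF BdI[OF h, of 0]] by simp
  thus ?thesis unfolding hiso_def using a b ba Bd_zero dd_ob[OF a] by (metis cancel_comm_monoid_add_class.diff_cancel)
qed

end

section \<open>Triangulated subcategories and their classes of denominators\<close>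

text \<open>\<open>N\<close> is a full triangulated subcategory of \<open>H\<^sup>0(F)\<close>, where \<open>F\<close> is a full DG-subcategory
  of the ambient DG-category.\<close>

locale rel_triangulated = dg_category A for A :: "('g::ab_group_add, 'o, 'm::ring, 'z) dgcat_scheme" +
  fixes F N :: "'o set"
  assumes F_sub: "F \<subseteq> Ob A"
    and F_shifts: "closed_under_shifts A F"
    and F_cones: "closed_under_cones A F"
    and N_sub: "N \<subseteq> F"
    and N_nonempty: "N \<noteq> {}"
    and N_iso: "\<lbrakk>X \<in> N; Y \<in> F; hiso X Y\<rbrakk> \<Longrightarrow> Y \<in> N"
    and N_shift: "\<lbrakk>X \<in> N; X' \<in> F; i \<in> {gone A, - gone A}; is_shift A X i X' s t\<rbrakk> \<Longrightarrow> X' \<in> N"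
    and N_cone: "\<lbrakk>X \<in> N; Y \<in> N; C \<in> F; is_cone A X f Y C q p\<rbrakk> \<Longrightarrow> C \<in> N"

context dg_category
begin

lemma hiso_sym: "hiso X Y \<Longrightarrow> hiso Y X"
  unfolding hiso_def by blast

lemma shiftE:
  assumes "F \<subseteq> Ob A" "closed_under_shifts A F" "X \<in> F"
  obtains X' s t where "X' \<in> F" "dd X X' (- i) s 0" "dd X' X i t 0" "t * s = Idt A X" "s * t = Idt A X'"
    "is_shift A X i X' s t"
proof -
  obtain X' s t where "X' \<in> F" and s: "is_shift A X i X' s t"
    using assms unfolding closed_under_shifts_def by metis
  thus thesis using that[of X' s t] s by (auto simp: is_shift_def dd_Cyc)
qed

lemma coneE:
  assumes "closed_under_cones A F" "X \<in> F" "Y \<in> F" "dd X Y 0 f 0"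
  obtains C q p j i where "C \<in> F" "cone X f Y C q p j i"
  using assms unfolding closed_under_cones_def by (metis dd_Cyc is_cone_iff)

lemma contractible_hiso:
  assumes "Idt A X \<in> Bd X X 0" "Idt A Y \<in> Bd Y Y 0"
  shows "hiso X Y"
proof -
  have "X \<in> Ob A" "Y \<in> Ob A" using assms Bd_obs by blast+
  thus ?thesis unfolding hiso_def using assms[THEN Bd_minus] dd_zero by (metis diff_0 mult_zero_left)
qed

lemma cone_idt_contractible:
  assumes c: "cone X (Idt A X) X C q p j i"
  shows "Idt A C \<in> Bd C C 0"
proof -
  note d = cone_dd[OF c] note e = cone_eqs[OF c]
  have "dd C C (- gone A) (i * q) (j * q + i * p)"
    using dd_compm0[OF d(5) d(2)] by (simp add: dd_id[OF d(3)] dd_id[OF d(2)] dd_id[OF d(4)] algebra_simps)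
  thus ?thesis using c BdI[of C C _ _ _ 0] by (simp add: cone_def)
qed

end

context rel_triangulated
begin

lemma N_Ob: "X \<in> N \<Longrightarrow> X \<in> Ob A" using N_sub F_sub by blast

lemma N_shiftE:
  assumes "X \<in> N" "i \<in> {gone A, - gone A}"
  obtains X' s t where "X' \<in> N" "dd X X' (- i) s 0" "dd X' X i t 0" "t * s = Idt A X" "s * t = Idt A X'"
  using shiftE[OF F_sub F_shifts, of X i] assms N_shift N_sub by (metis subsetD)

text \<open>Composing with a shift of \<open>X\<close> that lies in \<open>N\<close> turns the given
  maps into a homotopy equivalence of degree 0. This lets rotations of triangles be used without
  choosing shifts.\<close>

lemma N_degree_iso:
  assumes X: "X \<in> N" and Y: "Y \<in> F" and i: "i \<in> {gone A, - gone A}"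
    and u: "dd X Y i u 0" and v: "dd Y X (- i) v 0"
    and uv: "u * v - Idt A Y \<in> Bd Y Y 0" and vu: "v * u - Idt A X \<in> Bd X X 0"
  shows "Y \<in> N"
proof -
  have "- i \<in> {gone A, - gone A}" using i by auto
  then obtain X' s t where X': "X' \<in> N" and s: "dd X X' i s 0" and t: "dd X' X (- i) t 0"
      and ts: "t * s = Idt A X" and st: "s * t = Idt A X'"
    using N_shiftE[OF X, of "- i"] by (metis add.inverse_inverse)
  have 1: "dd X' Y 0 (u * t) 0" using dd_closed_comp[OF u t] by simp
  have 2: "dd Y X' 0 (s * v) 0" using dd_closed_comp[OF s v] by simp
  have "u * t * (s * v) = u * v" using ts dd_id[OF v] by (metis mult.assoc)
  moreover have "s * v * (u * t) - Idt A X' = s * ((v * u - Idt A X) * t)"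
    using st dd_id[OF t] by (simp add: algebra_simps)
  moreover have "s * ((v * u - Idt A X) * t) \<in> Bd X' X' 0"
    using Bd_left[OF Bd_right[OF t vu] s, of "- i + 0" 0] by simp
  ultimately have "hiso X' Y" unfolding hiso_def using 1 2 uv by metis
  thus ?thesis using N_iso X' Y by blast
qed

text \<open>Up to homotopy equivalence, \<open>Y\<close> is recovered as the cone of
  \<open>C[-1] -> X\<close>.\<close>

lemma N_two_of_three_Y:
  assumes c: "cone X f Y C q p j i" and X: "X \<in> N" and C: "C \<in> N" and Y: "Y \<in> F"
  shows "Y \<in> N"
proof -
  obtain C1 s t where C1: "C1 \<in> N" and s: "dd C C1 (gone A) s 0" "dd C1 C (- gone A) t 0"
      "t * s = Idt A C" "s * t = Idt A C1"
    using N_shiftE[OF C, of "- gone A"] by (metis add.inverse_inverse insertI1 insertI2)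
  have "dd C1 X 0 (p * t) 0" using dd_closed_comp[OF cone_dd(3)[OF c] s(2)] by simp
  then obtain D Q P J I where D: "D \<in> F" "cone C1 (p * t) X D Q P J I"
    using coneE[OF F_cones] C1 X N_sub by (metis subsetD)
  have "D \<in> N" using N_cone C1 X D is_cone_iff by blast
  thus ?thesis using rotate_cone_back[OF c s D(2)] hiso_sym N_iso Y by blast
qed

lemma rotate_coneE:
  assumes c: "cone X f Y C q p j i" and F: "X \<in> F" "Y \<in> F" "C \<in> F"
  obtains D Q P J I where "D \<in> F" "cone Y j C D Q P J I" "X \<in> N \<longleftrightarrow> D \<in> N"
proof -
  obtain D Q P J I where D: "D \<in> F" "cone Y j C D Q P J I"
    using coneE[OF F_cones F(2,3) cone_dd(4)[OF c]] by metis
  obtain u v where u: "dd D X (gone A) u 0" "dd X D (- gone A) v 0" "u * v = Idt A X" "v * u - Idt A D \<in> Bd D D 0"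
    using rotate_cone[OF c D(2)] by metis
  have 0: "u * v - Idt A X \<in> Bd X X 0" using u Bd_zero dd_ob by simp
  have "X \<in> N \<Longrightarrow> D \<in> N" using N_degree_iso[of X D "- gone A" v u] u 0 D by simp
  moreover have "D \<in> N \<Longrightarrow> X \<in> N" using N_degree_iso[of D X "gone A" u v] u 0 F by simp
  ultimately show thesis using that D by blast
qed

section \<open>Morphisms with cone in \<open>N\<close> and morphisms that factor through
  \<open>N\<close>\<close>

definition qis :: "'o \<Rightarrow> 'o \<Rightarrow> 'm \<Rightarrow> bool" where
  "qis X Y f \<longleftrightarrow> X \<in> F \<and> Y \<in> F \<and> (\<exists>C\<in>N. \<exists>q p j i. cone X f Y C q p j i)"

lemma qis_closed: "qis X Y f \<Longrightarrow> dd X Y 0 f 0"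
  unfolding qis_def using cone_dd by blast

lemma qis_homotopic:
  assumes "qis X Y f" "g - f \<in> Bd X Y 0" shows "qis X Y g"
proof -
  obtain h where h: "dd X Y (- gone A) h (g - f)" using assms(2) by (auto simp: Bd_def)
  show ?thesis using assms(1) cone_homotopic[OF _ h] unfolding qis_def by fastforce
qed

text \<open>The cone of an identity is contractible, and all contractible objects are homotopy
  equivalent. One of them lies in \<open>N\<close>, namely the cone of the identity of an object of
  \<open>N\<close>.\<close>

lemma qis_idt: assumes X: "X \<in> F" shows "qis X X (Idt A X)"
proof -
  have ob: "X \<in> Ob A" using X F_sub by blast
  obtain X0 where X0: "X0 \<in> N" using N_nonempty by blast
  obtain C0 q0 p0 j0 i0 where C0: "C0 \<in> F" "cone X0 (Idt A X0) X0 C0 q0 p0 j0 i0"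
    using coneE[OF F_cones _ _ dd_idt[OF N_Ob[OF X0]]] X0 N_sub by (metis subsetD)
  obtain C q p j i where C: "C \<in> F" "cone X (Idt A X) X C q p j i"
    using coneE[OF F_cones X X dd_idt[OF ob]] by metis
  have "C0 \<in> N" using N_cone X0 C0 is_cone_iff by blast
  hence "C \<in> N" using N_iso C(1) contractible_hiso[OF cone_idt_contractible[OF C0(2)] cone_idt_contractible[OF C(2)]]
    by blast
  thus ?thesis unfolding qis_def using X C by blast
qed

text \<open>The octahedron gives a triangle on the three cones in which the cone of the composite is
  the middle term.\<close>

lemma qis_comp: assumes f: "qis X Y f" and g: "qis Y Z g" shows "qis X Z (g * f)"
proof -
  obtain C1 q1 p1 j1 i1 where C1: "C1 \<in> N" and c1: "cone X f Y C1 q1 p1 j1 i1"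
    using f by (auto simp: qis_def)
  obtain C2 q2 p2 j2 i2 where C2: "C2 \<in> N" and c2: "cone Y g Z C2 q2 p2 j2 i2"
    using g by (auto simp: qis_def)
  have F: "X \<in> F" "Y \<in> F" "Z \<in> F" using f g by (auto simp: qis_def)
  have gf: "dd X Z 0 (g * f) 0" using dd_closed_comp[OF qis_closed[OF g] qis_closed[OF f]] by simp
  obtain C3 q3 p3 j3 i3 where C3: "C3 \<in> F" and c3: "cone X (g * f) Z C3 q3 p3 j3 i3"
    using coneE[OF F_cones F(1,3) gf] by metis
  note d1 = cone_dd[OF c1] note d2 = cone_dd[OF c2] note d3 = cone_dd[OF c3]
  have \<phi>: "dd C1 C3 0 (j3 * g * q1 + i3 * p1) 0"
    using dd_add[OF dd_comp0[OF dd_comp0[OF d3(4) d2(1)] d1(2)] dd_compm1[OF d3(5) d1(3)]]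
    by (simp add: algebra_simps)
  obtain D Q P J I where D: "D \<in> F" "cone C1 (j3 * g * q1 + i3 * p1) C3 D Q P J I"
    using coneE[OF F_cones _ C3 \<phi>] C1 N_sub by (metis subsetD)
  have "D \<in> N" using octahedron[OF c1 c2 c3 D(2) refl] N_iso C2 D(1) by blast
  hence "C3 \<in> N" using N_two_of_three_Y[OF D(2) C1 _ C3] by blast
  thus ?thesis unfolding qis_def using F c3 by blast
qed

text \<open>These are the morphisms that become zero in the quotient by \<open>N\<close>. The next
  lemmas show that this amounts to being killed by a \<open>qis\<close> on the source side, and also
  to being killed by one on the target side; the symmetric notion is the way from one side to the
  other.\<close>

definition null_morphism :: "'o \<Rightarrow> 'o \<Rightarrow> 'm \<Rightarrow> bool" where
  "null_morphism X Y k \<longleftrightarrow> (\<exists>Z\<in>N. \<exists>a b. dd X Z 0 a 0 \<and> dd Z Y 0 b 0 \<and> k - b * a \<in> Bd X Y 0)"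

lemma N_factors: "X \<in> N \<Longrightarrow> dd Y X 0 f 0 \<Longrightarrow> null_morphism Y X f"
  "X \<in> N \<Longrightarrow> dd X Y 0 f 0 \<Longrightarrow> null_morphism X Y f"
proof -
  assume X: "X \<in> N" note id = dd_idt[OF N_Ob[OF X]]
  { assume f: "dd Y X 0 f 0"
    have "f - Idt A X * f \<in> Bd Y X 0" using dd_id(1)[OF f] Bd_zero dd_ob[OF f] by simp
    thus "null_morphism Y X f" unfolding null_morphism_def using X f id by blast }
  { assume f: "dd X Y 0 f 0"
    have "f - f * Idt A X \<in> Bd X Y 0" using dd_id(2)[OF f] Bd_zero dd_ob[OF f] by simp
    thus "null_morphism X Y f" unfolding null_morphism_def using X f id by blast }
qed

text \<open>The denominator is the fibre of \<open>a : X -> Z\<close>, that is,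
  \<open>C[-1] -> X\<close> for the cone \<open>C\<close> of \<open>a\<close>. The cone of this map
  is \<open>Z\<close> again up to homotopy, and \<open>a * p\<close> is minus the differential of
  \<open>q\<close>.\<close>

lemma null_killed_right:
  assumes X: "X \<in> F" and k: "null_morphism X Y k"
  obtains V u where "qis V X u" "k * u \<in> Bd V Y 0"
proof -
  obtain Z a b where Z: "Z \<in> N" and a: "dd X Z 0 a 0" and b: "dd Z Y 0 b 0" and kb: "k - b * a \<in> Bd X Y 0"
    using k by (auto simp: null_morphism_def)
  obtain C q p j i where C: "C \<in> F" and c: "cone X a Z C q p j i"
    using coneE[OF F_cones X _ a] Z N_sub by (metis subsetD)
  note d = cone_dd[OF c]
  obtain V s t where V: "V \<in> F" and s: "dd C V (gone A) s 0" "dd V C (- gone A) t 0" "t * s = Idt A C" "s * t = Idt A V"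
    using shiftE[OF F_sub F_shifts C, of "- gone A"] by (metis add.inverse_inverse)
  have u: "dd V X 0 (p * t) 0" using dd_closed_comp[OF d(3) s(2)] by simp
  obtain D Q P J I where D: "D \<in> F" "cone V (p * t) X D Q P J I"
    using coneE[OF F_cones V X u] by metis
  have "D \<in> N" using rotate_cone_back[OF c s D(2)] N_iso Z D by blast
  hence "qis V X (p * t)" unfolding qis_def using V X D by blast
  moreover have "a * p \<in> Bd C Z (gone A)" using Bd_minus[OF BdI[OF d(2), of "gone A"]] by simp
  hence "b * (a * p * t) \<in> Bd V Y 0" using Bd_left[OF Bd_right[OF s(2)] b, of _ _ 0 0] by simp
  hence "k * (p * t) \<in> Bd V Y 0" using Bd_add[OF Bd_right[OF u kb, of 0], of "b * (a * p * t)"]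
    by (simp add: algebra_simps)
  ultimately show thesis using that by blast
qed

text \<open>The denominator is \<open>j : Y -> C\<close> for the cone \<open>C\<close> of
  \<open>b : Z -> Y\<close>. Its own cone is a shift of \<open>Z\<close> up to homotopy, and
  \<open>j * b\<close> is the differential of \<open>i\<close>.\<close>

lemma null_killed_left:
  assumes Y: "Y \<in> F" and k: "null_morphism X Y k"
  obtains V v where "qis Y V v" "v * k \<in> Bd X V 0"
proof -
  obtain Z a b where Z: "Z \<in> N" and a: "dd X Z 0 a 0" and b: "dd Z Y 0 b 0" and kb: "k - b * a \<in> Bd X Y 0"
    using k by (auto simp: null_morphism_def)
  obtain C q p j i where C: "C \<in> F" and c: "cone Z b Y C q p j i"
    using coneE[OF F_cones _ Y b] Z N_sub by (metis subsetD)
  note d = cone_dd[OF c]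
  have ZF: "Z \<in> F" using Z N_sub by blast
  obtain D Q P J I where "D \<in> F" and D: "cone Y j C D Q P J I" "Z \<in> N \<longleftrightarrow> D \<in> N"
    by (rule rotate_coneE[OF c ZF Y C])
  have "qis Y C j" unfolding qis_def using Y C D Z by blast
  moreover have "j * b \<in> Bd Z C 0" using BdI[OF d(5)] by simp
  hence "j * b * a \<in> Bd X C 0" using Bd_right[OF a] by simp
  hence "j * k \<in> Bd X C 0" using Bd_add[OF Bd_left[OF kb d(4), of 0], of "j * b * a"]
    by (simp add: algebra_simps)
  ultimately show thesis using that by blast
qed

lemma killed_right_null:
  assumes u: "qis V X u" and k: "dd X Y 0 k 0" and ku: "k * u \<in> Bd V Y 0"
  shows "null_morphism X Y k"
proof -
  obtain C q p j i where C: "C \<in> N" and c: "cone V u X C q p j i" using u by (auto simp: qis_def)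
  obtain g where g: "dd C Y 0 g 0" "k = g * j" using cone_coexact_Y[OF c k ku] by metis
  show ?thesis unfolding null_morphism_def
    using C g cone_dd(4)[OF c] Bd_zero dd_ob[OF k] by (metis cancel_comm_monoid_add_class.diff_cancel)
qed

lemma killed_left_null:
  assumes v: "qis Y V v" and k: "dd X Y 0 k 0" and vk: "v * k \<in> Bd X V 0"
  shows "null_morphism X Y k"
proof -
  obtain C q p j i where C: "C \<in> N" and c: "cone Y v V C q p j i" using v by (auto simp: qis_def)
  obtain g where g: "dd X C (- gone A) g 0" "k = p * g" using cone_exact_X[OF c k vk, of "- gone A"] by auto
  \<comment> \<open>\<open>g\<close> has degree \<open>- gone A\<close>. A shift of \<open>C\<close>
    turns \<open>g\<close> and \<open>p\<close> into morphisms of degree 0 through an object of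
    \<open>N\<close>.\<close>
  obtain C1 s t where C1: "C1 \<in> N" and s: "dd C C1 (gone A) s 0" "dd C1 C (- gone A) t 0" "t * s = Idt A C"
    using N_shiftE[OF C, of "- gone A"] by (metis add.inverse_inverse insertI1 insertI2)
  have "dd X C1 0 (s * g) 0" using dd_closed_comp[OF s(1) g(1)] by simp
  moreover have "dd C1 Y 0 (p * t) 0" using dd_closed_comp[OF cone_dd(3)[OF c] s(2)] by simp
  moreover have "k - p * t * (s * g) = 0" using s(3) g dd_id[OF g(1)] by (metis mult.assoc diff_self)
  ultimately show ?thesis unfolding null_morphism_def
    using C1 Bd_zero dd_ob[OF k] by metis
qed

text \<open>The cone \<open>C\<close> of \<open>s\<close> lies in \<open>N\<close>, so
  \<open>j * f\<close> is killed by a denominator \<open>u\<close>. Exactness at \<open>Y\<close>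
  then lifts \<open>f * u\<close> to \<open>Z\<close>.\<close>

lemma qis_ore:
  assumes f: "dd X Y 0 f 0" and X: "X \<in> F" and s: "qis Z Y s"
  obtains U u v where "qis U X u" "dd U Z 0 v 0" "f * u - s * v \<in> Bd U Y 0"
proof -
  obtain C q p j i where C: "C \<in> N" and c: "cone Z s Y C q p j i" using s by (auto simp: qis_def)
  note d = cone_dd[OF c]
  have jf: "dd X C 0 (j * f) 0" using dd_closed_comp[OF d(4) f] by simp
  obtain U u where u: "qis U X u" and ju: "j * f * u \<in> Bd U C 0"
    using null_killed_right[OF X N_factors(1)[OF C jf]] by metis
  have fu: "dd U Y 0 (f * u) 0" using dd_closed_comp[OF f qis_closed[OF u]] by simp
  show thesis using cone_exact_Y[OF c fu] ju that u by (metis mult.assoc)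
qed

lemma qis_cancel:
  assumes k: "dd X Z 0 k 0" and X: "X \<in> F" and s: "qis Z Y s" and sk: "s * k \<in> Bd X Y 0"
  obtains U u where "qis U X u" "k * u \<in> Bd U Z 0"
  using null_killed_right[OF X killed_left_null[OF s k sk]] by metis

end

subsection \<open>The homotopy category\<close>

context dg_category
begin

lemma hclass_Bd:
  assumes "X \<in> Ob A" "Y \<in> Ob A" shows "hclass A X Y f = {g. g - f \<in> Bd X Y 0}"
proof (intro set_eqI iffI)
  fix g assume "g \<in> hclass A X Y f"
  then obtain h where "h \<in> Hom A X Y (- gone A)" "g = f + Diff A X Y (- gone A) h" by (auto simp: hclass_def)
  moreover have "Diff A X Y (- gone A) h \<in> Bd X Y 0"
    by (rule BdI[OF ddI[OF assms]]) (use calculation(1) in simp_all)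
  ultimately show "g \<in> {g. g - f \<in> Bd X Y 0}" by (metis mem_Collect_eq add_diff_cancel_left')
next
  fix g assume "g \<in> {g. g - f \<in> Bd X Y 0}"
  then obtain h where h: "h \<in> Hom A X Y (- gone A)" "Diff A X Y (- gone A) h = g - f"
    by (auto simp: Bd_def dd_def)
  have "g = f + Diff A X Y (- gone A) h" using h(2) by simp
  thus "g \<in> hclass A X Y f" unfolding hclass_def using h(1) by blast
qed

lemma hclass_eq_iff:
  assumes "X \<in> Ob A" "Y \<in> Ob A"
  shows "hclass A X Y f = hclass A X Y g \<longleftrightarrow> f - g \<in> Bd X Y 0"
proof
  assume "hclass A X Y f = hclass A X Y g"
  moreover have "f \<in> hclass A X Y f" using assms Bd_zero by (simp add: hclass_Bd)
  ultimately show "f - g \<in> Bd X Y 0" using assms by (auto simp: hclass_Bd)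
next
  assume fg: "f - g \<in> Bd X Y 0"
  have "h - f \<in> Bd X Y 0 \<longleftrightarrow> h - g \<in> Bd X Y 0" for h
    using Bd_add[OF _ fg, of "h - f"] Bd_diff[OF _ fg, of "h - g"] by auto
  thus "hclass A X Y f = hclass A X Y g" using assms by (simp add: hclass_Bd)
qed

lemma H0_simps:
  "cobj (H0 A) = Ob A" "chom (H0 A) X Y = hclass A X Y ` Cyc A X Y 0" "cid (H0 A) X = hclass A X X (Idt A X)"
  by (simp_all add: H0_def)

lemma H0_homI: "dd X Y 0 f 0 \<Longrightarrow> hclass A X Y f \<in> chom (H0 A) X Y"
  by (simp add: H0_simps dd_Cyc)

lemma H0_homE:
  assumes "c \<in> chom (H0 A) X Y" "X \<in> Ob A" "Y \<in> Ob A"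
  obtains f where "c = hclass A X Y f" "dd X Y 0 f 0"
  using assms by (auto simp: H0_simps dd_Cyc)

lemma H0_comp:
  assumes f: "dd X Y 0 f 0" and g: "dd Y Z 0 g 0"
  shows "ccomp (H0 A) X Y Z (hclass A Y Z g) (hclass A X Y f) = hclass A X Z (g * f)"
proof -
  have ob: "X \<in> Ob A" "Y \<in> Ob A" "Z \<in> Ob A" using f g dd_ob by blast+
  have *: "hclass A X Z (g' * f') = hclass A X Z (g * f)"
    if "f' - f \<in> Bd X Y 0" "g' - g \<in> Bd Y Z 0" for f' g'
  proof -
    have "dd X Y 0 ((f' - f) + f) (0 + 0)" using dd_add[OF Bd_closed[OF that(1)] f] .
    hence f': "dd X Y 0 f' 0" by simp
    have "(g' - g) * f' + g * (f' - f) \<in> Bd X Z 0"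
      using Bd_add[OF Bd_right[OF f' that(2)] Bd_left[OF that(1) g]] by simp
    thus ?thesis unfolding hclass_eq_iff[OF ob(1,3)] by (simp add: algebra_simps)
  qed
  have mem: "f \<in> hclass A X Y f" "g \<in> hclass A Y Z g" using Bd_zero ob by (simp_all add: hclass_Bd)
  have all: "hclass A X Z (g' * f') = hclass A X Z (g * f)" if "f' \<in> hclass A X Y f" "g' \<in> hclass A Y Z g" for f' g'
    using * that ob by (simp add: hclass_Bd)
  have "(\<Union>g'\<in>hclass A Y Z g. \<Union>f'\<in>hclass A X Y f. hclass A X Z (g' * f')) = hclass A X Z (g * f)"
  proof
    show "(\<Union>g'\<in>hclass A Y Z g. \<Union>f'\<in>hclass A X Y f. hclass A X Z (g' * f')) \<subseteq> hclass A X Z (g * f)"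
      by (intro UN_least) (simp add: all)
    show "hclass A X Z (g * f) \<subseteq> (\<Union>g'\<in>hclass A Y Z g. \<Union>f'\<in>hclass A X Y f. hclass A X Z (g' * f'))"
      using mem by blast
  qed
  thus ?thesis by (simp add: H0_def)
qed

lemma H0_iso: "cat_isomorphic (H0 A) X Y \<longleftrightarrow> hiso X Y"
proof
  assume "cat_isomorphic (H0 A) X Y"
  then obtain a b where ob: "X \<in> Ob A" "Y \<in> Ob A" and ab: "a \<in> chom (H0 A) X Y" "b \<in> chom (H0 A) Y X"
      "ccomp (H0 A) X Y X b a = cid (H0 A) X" "ccomp (H0 A) Y X Y a b = cid (H0 A) Y"
    by (auto simp: cat_isomorphic_def H0_simps(1))
  obtain f g where "a = hclass A X Y f" "dd X Y 0 f 0" "b = hclass A Y X g" "dd Y X 0 g 0"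
    using H0_homE ab ob by metis
  thus "hiso X Y" using ab ob unfolding hiso_def by (auto simp: H0_comp H0_simps hclass_eq_iff)
next
  assume "hiso X Y"
  then obtain f g where fg: "dd X Y 0 f 0" "dd Y X 0 g 0" "g * f - Idt A X \<in> Bd X X 0" "f * g - Idt A Y \<in> Bd Y Y 0"
    by (auto simp: hiso_def)
  moreover have "X \<in> Ob A" "Y \<in> Ob A" using fg dd_ob by blast+
  ultimately show "cat_isomorphic (H0 A) X Y" unfolding cat_isomorphic_def
    using H0_homI H0_comp by (metis H0_simps(1,3) hclass_eq_iff)
qed

lemma H0_retract: "cat_retract (H0 A) X Y \<longleftrightarrow>
    (\<exists>f g. dd X Y 0 f 0 \<and> dd Y X 0 g 0 \<and> g * f - Idt A X \<in> Bd X X 0)"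
proof
  assume "cat_retract (H0 A) X Y"
  then obtain a b where ob: "X \<in> Ob A" "Y \<in> Ob A" and ab: "a \<in> chom (H0 A) X Y" "b \<in> chom (H0 A) Y X"
      "ccomp (H0 A) X Y X b a = cid (H0 A) X"
    by (auto simp: cat_retract_def H0_simps(1))
  obtain f g where "a = hclass A X Y f" "dd X Y 0 f 0" "b = hclass A Y X g" "dd Y X 0 g 0"
    using H0_homE ab ob by metis
  thus "\<exists>f g. dd X Y 0 f 0 \<and> dd Y X 0 g 0 \<and> g * f - Idt A X \<in> Bd X X 0"
    using ab ob by (auto simp: H0_comp H0_simps hclass_eq_iff)
next
  assume "\<exists>f g. dd X Y 0 f 0 \<and> dd Y X 0 g 0 \<and> g * f - Idt A X \<in> Bd X X 0"
  then obtain f g where fg: "dd X Y 0 f 0" "dd Y X 0 g 0" "g * f - Idt A X \<in> Bd X X 0" by blast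
  moreover have "X \<in> Ob A" "Y \<in> Ob A" using fg dd_ob by blast+
  ultimately show "cat_retract (H0 A) X Y" unfolding cat_retract_def
    using H0_homI H0_comp by (metis H0_simps(1,3) hclass_eq_iff)
qed

end

context rel_triangulated
begin

definition denominators :: "'o \<Rightarrow> 'o \<Rightarrow> 'm set set" where
  "denominators X Y = {hclass A X Y f | f. qis X Y f}"

lemma denominatorsI: "qis X Y f \<Longrightarrow> hclass A X Y f \<in> denominators X Y"
  by (auto simp: denominators_def)

lemma denominatorsE:
  assumes "c \<in> denominators X Y" obtains f where "c = hclass A X Y f" "qis X Y f" "dd X Y 0 f 0"
  using assms qis_closed by (auto simp: denominators_def)

lemma F_homE:
  assumes "c \<in> chom (H0 A) X Y" "X \<in> F" "Y \<in> F"
  obtains f where "c = hclass A X Y f" "dd X Y 0 f 0"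
  using assms F_sub H0_homE by (metis subsetD)

lemma fractions_H0: "fractions (H0 A\<lparr>cobj := F\<rparr>) denominators"
proof (unfold_locales, goal_cases)
  case (1 X Y Z f g)
  then show ?case using F_sub by (auto elim!: H0_homE[of _ X Y] H0_homE[of _ Y Z] simp: H0_comp subset_iff
      intro!: H0_homI dd_closed_comp[of Y Z 0 _ X 0 _ 0])
next
  case (2 X) then show ?case using F_sub by (auto simp: H0_simps(3) intro!: H0_homI dd_idt)
next
  case (3 X Y f)
  then obtain f' where "f = hclass A X Y f'" "dd X Y 0 f' 0" using F_homE[of f X Y] by auto
  then show ?case using H0_comp[of X Y f' Y "Idt A Y"] dd_idt dd_ob dd_id(1) by (auto simp: H0_simps(3))
next
  case (4 X Y f)
  then obtain f' where "f = hclass A X Y f'" "dd X Y 0 f' 0" using F_homE[of f X Y] by auto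
  then show ?case using H0_comp[of X X "Idt A X" Y f'] dd_idt dd_ob dd_id(2) by (auto simp: H0_simps(3))
next
  case (5 X Y Z V f g h)
  obtain f' where f: "f = hclass A X Y f'" "dd X Y 0 f' 0" using 5 F_homE[of f X Y] by auto
  obtain g' where g: "g = hclass A Y Z g'" "dd Y Z 0 g' 0" using 5 F_homE[of g Y Z] by auto
  obtain h' where h: "h = hclass A Z V h'" "dd Z V 0 h' 0" using 5 F_homE[of h Z V] by auto
  have "dd X Z 0 (g' * f') 0" "dd Y V 0 (h' * g') 0" using f g h dd_closed_comp by fastforce+
  then show ?case using f g h by (simp add: H0_comp mult.assoc)
next
  case (6 X Y s) then show ?case by (auto elim!: denominatorsE intro: H0_homI)
next
  case (7 X) then show ?case by (auto simp: H0_simps(3) intro: denominatorsI qis_idt)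
next
  case (8 X Y Z s t) then show ?case
    by (auto elim!: denominatorsE simp: H0_comp intro!: denominatorsI qis_comp)
next
  case (9 X Y Z f s)
  obtain f' where f: "f = hclass A X Y f'" "dd X Y 0 f' 0" using 9 F_homE[of f X Y] by auto
  obtain s' where s: "s = hclass A Z Y s'" "qis Z Y s'" "dd Z Y 0 s' 0" using 9 denominatorsE by metis
  obtain U u v where u: "qis U X u" "dd U Z 0 v 0" "f' * u - s' * v \<in> Bd U Y 0"
    using qis_ore[OF f(2) _ s(2)] 9 by auto
  have U: "U \<in> F" "dd U X 0 u 0" using u(1) qis_closed by (auto simp: qis_def)
  have "hclass A U Y (f' * u) = hclass A U Y (s' * v)" using u(3) hclass_eq_iff Bd_obs by blast
  hence "ccomp (H0 A) U X Y f (hclass A U X u) = ccomp (H0 A) U Z Y s (hclass A U Z v)"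
    using U(2) u(2) f s by (simp add: H0_comp)
  hence "\<exists>U\<in>F. \<exists>u\<in>denominators U X. \<exists>v\<in>chom (H0 A) U Z. ccomp (H0 A) U X Y f u = ccomp (H0 A) U Z Y s v"
    using U denominatorsI[OF u(1)] H0_homI[OF u(2)] by blast
  then show ?case by simp
next
  case (10 X Y Z f g s)
  obtain f' where f: "f = hclass A X Z f'" "dd X Z 0 f' 0" using 10 F_homE[of f X Z] by auto
  obtain g' where g: "g = hclass A X Z g'" "dd X Z 0 g' 0" using 10 F_homE[of g X Z] by auto
  obtain s' where s: "s = hclass A Z Y s'" "qis Z Y s'" "dd Z Y 0 s' 0" using 10 denominatorsE by metis
  have fg: "dd X Z 0 (f' - g') 0" using dd_diff[OF f(2) g(2)] by simp
  have "s' * f' - s' * g' \<in> Bd X Y 0" using 10(7) f g s dd_ob by (simp add: H0_comp hclass_eq_iff)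
  hence "s' * (f' - g') \<in> Bd X Y 0" by (simp add: algebra_simps)
  then obtain U u where u: "qis U X u" "(f' - g') * u \<in> Bd U Z 0"
    using qis_cancel[OF fg _ s(2)] 10 by auto
  have U: "U \<in> F" "dd U X 0 u 0" using u(1) qis_closed by (auto simp: qis_def)
  have "hclass A U Z (f' * u) = hclass A U Z (g' * u)"
    using u(2) hclass_eq_iff Bd_obs[OF u(2)] by (simp add: algebra_simps)
  hence "ccomp (H0 A) U X Z f (hclass A U X u) = ccomp (H0 A) U X Z g (hclass A U X u)"
    using U(2) f g by (simp add: H0_comp)
  hence "\<exists>U\<in>F. \<exists>u\<in>denominators U X. ccomp (H0 A) U X Z f u = ccomp (H0 A) U X Z g u"
    using U denominatorsI[OF u(1)] by blast
  then show ?case by simp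
qed

end

subsection \<open>The criterion of full faithfulness\<close>

locale triangulated_pair = dg_category A + big: rel_triangulated A "Ob A" N + small: rel_triangulated A F N'
  for A :: "('g::ab_group_add, 'o, 'm::ring, 'z) dgcat_scheme" and N F N' :: "'o set" +
  assumes N'_sub: "N' \<subseteq> N"
begin

lemma small_qis: "small.qis X Y f \<Longrightarrow> big.qis X Y f"
  unfolding big.qis_def small.qis_def using N'_sub small.F_sub by blast

text \<open>Equality of fractions spelled out on representatives: \<open>x\<close> and
  \<open>y\<close> are the legs of a common refinement \<open>D\<close> of a roof of the ambient
  category and a roof in \<open>F\<close>. The second condition gives faithfulness because a
  morphism killed by a large denominator is null.\<close>

lemma fractions_subcatI:
  assumes full: "\<And>X Y V s f. \<lbrakk>X \<in> F; Y \<in> F; big.qis V X s; dd V Y 0 f 0\<rbrakk>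
      \<Longrightarrow> \<exists>U u g D x y. small.qis U X u \<and> dd U Y 0 g 0 \<and> dd D V 0 x 0 \<and> dd D U 0 y 0 \<and>
            s * x - u * y \<in> Bd D X 0 \<and> big.qis D X (s * x) \<and> f * x - g * y \<in> Bd D Y 0"
    and null: "\<And>X Y k. \<lbrakk>X \<in> F; Y \<in> F; dd X Y 0 k 0; big.null_morphism X Y k\<rbrakk> \<Longrightarrow> small.null_morphism X Y k"
  shows "fractions_subcat (H0 A) big.denominators F small.denominators"
proof -
  have b: "fractions (H0 A) big.denominators" using big.fractions_H0 by (simp add: H0_def)
  note s = small.fractions_H0
  interpret b: fractions "H0 A" big.denominators by (fact b)
  interpret s: fractions "H0 A\<lparr>cobj := F\<rparr>" small.denominators by (fact s)
  show ?thesis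
  proof (unfold_locales, goal_cases)
    case 1 then show ?case using small.F_sub by (simp add: H0_simps)
  next
    case (2 X Y) then show ?case using small_qis by (auto simp: small.denominators_def big.denominators_def)
  next
    case (3 X Y V s f)
    have ob: "X \<in> Ob A" "Y \<in> Ob A" "V \<in> Ob A" using 3 small.F_sub by (auto simp: H0_simps)
    obtain f' where f: "f = hclass A V Y f'" "dd V Y 0 f' 0" using 3 ob H0_homE[of f V Y] by auto
    obtain s' where s: "s = hclass A V X s'" "big.qis V X s'" "dd V X 0 s' 0" using 3 big.denominatorsE by metis
    obtain U u g D x y where U: "small.qis U X u" "dd U Y 0 g 0" "dd D V 0 x 0" "dd D U 0 y 0"
        "s' * x - u * y \<in> Bd D X 0" "big.qis D X (s' * x)" "f' * x - g * y \<in> Bd D Y 0"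
      using full[OF 3(1,2) s(2) f(2)] by blast
    have u: "dd U X 0 u 0" "U \<in> F" "big.qis U X u" "D \<in> Ob A"
      using U(1,3) small.qis_closed small_qis dd_ob by (auto simp: small.qis_def)
    have r: "(U, hclass A U X u, hclass A U Y g) \<in> roofs (H0 A\<lparr>cobj := F\<rparr>) small.denominators X Y"
      using u U by (auto simp: roofs_def intro: small.denominatorsI H0_homI)
    have "((V, s, f), (U, hclass A U X u, hclass A U Y g)) \<in> roof_eq (H0 A) big.denominators X Y"
    proof (rule b.roof_eqI)
      show "(V, s, f) \<in> roofs (H0 A) big.denominators X Y" using 3 by (simp add: roofs_def)
      show "(U, hclass A U X u, hclass A U Y g) \<in> roofs (H0 A) big.denominators X Y"
        using u U small.F_sub by (auto simp: roofs_def H0_simps(1) intro: big.denominatorsI H0_homI)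
      show "hclass A D V x \<in> chom (H0 A) D V" "hclass A D U y \<in> chom (H0 A) D U" using U H0_homI by auto
      show "ccomp (H0 A) D V X s (hclass A D V x) = ccomp (H0 A) D U X (hclass A U X u) (hclass A D U y)"
        using U u s ob by (simp add: H0_comp hclass_eq_iff)
      show "ccomp (H0 A) D V X s (hclass A D V x) \<in> big.denominators D X"
        using U s by (simp add: H0_comp big.denominatorsI)
      show "ccomp (H0 A) D V Y f (hclass A D V x) = ccomp (H0 A) D U Y (hclass A U Y g) (hclass A D U y)"
        using U u f ob by (simp add: H0_comp hclass_eq_iff)
    qed (use u in \<open>simp add: H0_simps\<close>)
    then show ?case using r by blast
  next
    case (4 X Y U f g u)
    have ob: "X \<in> Ob A" "Y \<in> Ob A" "U \<in> Ob A" using 4 small.F_sub by (auto simp: H0_simps)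
    obtain f' where f: "f = hclass A X Y f'" "dd X Y 0 f' 0" using 4 ob H0_homE[of f X Y] by auto
    obtain g' where g: "g = hclass A X Y g'" "dd X Y 0 g' 0" using 4 ob H0_homE[of g X Y] by auto
    obtain u' where u: "u = hclass A U X u'" "big.qis U X u'" "dd U X 0 u' 0" using 4 big.denominatorsE by metis
    have k: "dd X Y 0 (f' - g') 0" using dd_diff[OF f(2) g(2)] by simp
    have "f' * u' - g' * u' \<in> Bd U Y 0" using 4(7) f g u ob by (simp add: H0_comp hclass_eq_iff)
    hence "(f' - g') * u' \<in> Bd U Y 0" by (simp add: algebra_simps)
    hence "small.null_morphism X Y (f' - g')" using null[OF 4(1,2) k] big.killed_right_null[OF u(2) k] by blast
    then obtain V v where v: "small.qis V X v" "(f' - g') * v \<in> Bd V Y 0"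
      using small.null_killed_right 4(1) by metis
    have V: "V \<in> F" "dd V X 0 v 0" using v(1) small.qis_closed by (auto simp: small.qis_def)
    have "hclass A V Y (f' * v) = hclass A V Y (g' * v)"
      using v(2) hclass_eq_iff Bd_obs[OF v(2)] by (simp add: algebra_simps)
    hence "ccomp (H0 A) V X Y f (hclass A V X v) = ccomp (H0 A) V X Y g (hclass A V X v)"
      using V(2) f g by (simp add: H0_comp)
    thus ?case using V small.denominatorsI[OF v(1)] by blast
  qed
qed

text \<open>The map \<open>j : X -> C\<close> to the cone of a denominator \<open>s\<close> ends in
  \<open>N\<close>, so it is killed by a denominator \<open>u\<close> of \<open>F\<close>. Then
  \<open>u\<close> lifts through \<open>s\<close> to some \<open>x\<close>, and
  \<open>(U, u, f * x)\<close> is a fraction with apex in \<open>F\<close> equivalent to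
  \<open>(V, s, f)\<close>.\<close>

lemma fractions_subcat_from:
  assumes factor: "\<And>X Y f. \<lbrakk>X \<in> N; Y \<in> F; dd Y X 0 f 0\<rbrakk> \<Longrightarrow> small.null_morphism Y X f"
  shows "fractions_subcat (H0 A) big.denominators F small.denominators"
proof (rule fractions_subcatI)
  fix X Y V s f assume X: "X \<in> F" and Y: "Y \<in> F" and s: "big.qis V X s" and f: "dd V Y 0 f 0"
  obtain C q p j i where C: "C \<in> N" and c: "cone V s X C q p j i" using s by (auto simp: big.qis_def)
  obtain U u where u: "small.qis U X u" "j * u \<in> Bd U C 0"
    using small.null_killed_right[OF X factor[OF C X cone_dd(4)[OF c]]] by metis
  obtain x where x: "dd U V 0 x 0" "u - s * x \<in> Bd U X 0"
    using cone_exact_Y[OF c small.qis_closed[OF u(1)] u(2)] by metis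
  have ob: "U \<in> Ob A" "Y \<in> Ob A" using x(1) dd_ob f by blast+
  have fx: "dd U Y 0 (f * x) 0" using dd_closed_comp[OF f x(1)] by simp
  have sx: "s * x - u \<in> Bd U X 0" using Bd_minus[OF x(2)] by simp
  show "\<exists>U u g D x y. small.qis U X u \<and> dd U Y 0 g 0 \<and> dd D V 0 x 0 \<and> dd D U 0 y 0 \<and>
            s * x - u * y \<in> Bd D X 0 \<and> big.qis D X (s * x) \<and> f * x - g * y \<in> Bd D Y 0"
  proof (intro exI conjI)
    show "small.qis U X u" by (fact u)
    show "dd U Y 0 (f * x) 0" by (fact fx)
    show "dd U V 0 x 0" by (fact x)
    show "dd U U 0 (Idt A U) 0" using dd_idt ob by blast
    show "s * x - u * Idt A U \<in> Bd U X 0" using sx dd_id(2)[OF small.qis_closed[OF u(1)]] by simp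
    show "big.qis U X (s * x)" using big.qis_homotopic[OF small_qis[OF u(1)] sx] .
    show "f * x - f * x * Idt A U \<in> Bd U Y 0" using dd_id(2)[OF fx] Bd_zero[OF ob] by simp
  qed
next
  fix X Y k assume X: "X \<in> F" and Y: "Y \<in> F" and k: "dd X Y 0 k 0" and n: "big.null_morphism X Y k"
  obtain Z a b where Z: "Z \<in> N" and a: "dd X Z 0 a 0" and b: "dd Z Y 0 b 0" and kb: "k - b * a \<in> Bd X Y 0"
    using n by (auto simp: big.null_morphism_def)
  obtain V u where u: "small.qis V X u" "a * u \<in> Bd V Z 0"
    using small.null_killed_right[OF X factor[OF Z X a]] by metis
  have "(k - b * a) * u + b * (a * u) \<in> Bd V Y 0"
    using Bd_add[OF Bd_right[OF small.qis_closed[OF u(1)] kb] Bd_left[OF u(2) b]] by simp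
  hence "k * u \<in> Bd V Y 0" by (simp add: algebra_simps)
  thus "small.null_morphism X Y k" using small.killed_right_null[OF u(1) k] by blast
qed

text \<open>The hypothesis controls morphisms out of \<open>N\<close>, while roofs have their
  denominator on the source side. So the roof is first turned around: \<open>f\<close> restricted to
  the fibre \<open>C[-1] -> V\<close> of \<open>s\<close> is killed by a denominator
  \<open>t\<close> of \<open>F\<close>, whence \<open>t * f\<close> is homotopic to some
  \<open>h * s\<close>. An Ore square in \<open>F\<close> turns the pair of \<open>h\<close> and
  \<open>t\<close> back into a roof.\<close>

lemma fractions_subcat_to:
  assumes factor: "\<And>X Y f. \<lbrakk>X \<in> N; Y \<in> F; dd X Y 0 f 0\<rbrakk> \<Longrightarrow> small.null_morphism X Y f"
  shows "fractions_subcat (H0 A) big.denominators F small.denominators"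
proof (rule fractions_subcatI)
  fix X Y V s f assume X: "X \<in> F" and Y: "Y \<in> F" and s: "big.qis V X s" and f: "dd V Y 0 f 0"
  obtain C q p j i where C: "C \<in> N" and c: "cone V s X C q p j i" using s by (auto simp: big.qis_def)
  obtain C1 s1 t1 where C1: "C1 \<in> N" and s1: "dd C C1 (gone A) s1 0" "dd C1 C (- gone A) t1 0" "t1 * s1 = Idt A C"
    using big.N_shiftE[OF C, of "- gone A"] by (metis add.inverse_inverse insertI1 insertI2)
  note d = cone_dd[OF c]
  have fpt: "dd C1 Y 0 (f * p * t1) 0"
    using dd_closed_comp[OF dd_closed_comp[OF f d(3), of "gone A"] s1(2), of 0] by simp
  obtain T t where t: "small.qis Y T t" "t * (f * p * t1) \<in> Bd C1 T 0"
    using small.null_killed_left[OF Y factor[OF C1 Y fpt]] by metis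
  have tc: "dd Y T 0 t 0" using small.qis_closed[OF t(1)] .
  have "t * (f * p * t1) * s1 \<in> Bd C T (gone A)" using Bd_right[OF s1(1) t(2)] by simp
  hence "t * f * p \<in> Bd C T (gone A)" using s1(3) dd_id[OF d(3)] by (simp add: mult.assoc)
  then obtain h where h: "dd X T 0 h 0" "t * f - h * s \<in> Bd V T 0"
    using cone_coexact_X[OF c dd_closed_comp[OF tc f, of 0]] by auto
  obtain U u v where u: "small.qis U X u" "dd U Y 0 v 0" "h * u - t * v \<in> Bd U T 0"
    using small.qis_ore[OF h(1) X t(1)] by metis
  have uc: "dd U X 0 u 0" "U \<in> F" using small.qis_closed[OF u(1)] u(1) by (auto simp: small.qis_def)
  \<comment> \<open>It remains to compare the new roof with the old one. An Ore square in the
    ambient category refines both; their numerators agree after \<open>t\<close>, which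
    \<open>qis_cancel\<close> then removes.\<close>
  obtain D x y where D: "big.qis D U x" "dd D V 0 y 0" "u * x - s * y \<in> Bd D X 0"
    using big.qis_ore[OF uc(1) _ s] uc small.F_sub by blast
  have xc: "dd D U 0 x 0" using big.qis_closed D by blast
  have k: "dd D Y 0 (f * y - v * x) 0"
    using dd_diff[OF dd_closed_comp[OF f D(2), of 0] dd_closed_comp[OF u(2) xc, of 0]] by simp
  have "(t * f - h * s) * y - h * (u * x - s * y) + (h * u - t * v) * x \<in> Bd D T 0"
    using Bd_add[OF Bd_diff[OF Bd_right[OF D(2) h(2), of 0] Bd_left[OF D(3) h(1), of 0]] Bd_right[OF xc u(3), of 0]] by simp
  hence "t * (f * y - v * x) \<in> Bd D T 0" by (simp add: algebra_simps)
  then obtain S z where z: "big.qis S D z" "(f * y - v * x) * z \<in> Bd S Y 0"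
    using big.qis_cancel[OF k _ small_qis[OF t(1)]] dd_ob[OF k] by metis
  have zc: "dd S D 0 z 0" using big.qis_closed z by blast
  show "\<exists>U u g D x y. small.qis U X u \<and> dd U Y 0 g 0 \<and> dd D V 0 x 0 \<and> dd D U 0 y 0 \<and>
            s * x - u * y \<in> Bd D X 0 \<and> big.qis D X (s * x) \<and> f * x - g * y \<in> Bd D Y 0"
  proof (intro exI conjI)
    show "small.qis U X u" "dd U Y 0 v 0" by (fact u)+
    show "dd S V 0 (y * z) 0" using dd_closed_comp[OF D(2) zc] by simp
    show "dd S U 0 (x * z) 0" using dd_closed_comp[OF xc zc] by simp
    have "- (u * x - s * y) * z \<in> Bd S X 0" using Bd_right[OF zc Bd_minus[OF D(3)]] by simp
    thus *: "s * (y * z) - u * (x * z) \<in> Bd S X 0" by (simp add: algebra_simps)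
    have "big.qis S X (u * (x * z))" using big.qis_comp[OF big.qis_comp[OF z(1) D(1)] small_qis[OF u(1)]] .
    thus "big.qis S X (s * (y * z))" using big.qis_homotopic * by blast
    show "f * (y * z) - v * (x * z) \<in> Bd S Y 0" using z(2) by (simp add: algebra_simps)
  qed
next
  fix X Y k assume X: "X \<in> F" and Y: "Y \<in> F" and k: "dd X Y 0 k 0" and n: "big.null_morphism X Y k"
  obtain Z a b where Z: "Z \<in> N" and a: "dd X Z 0 a 0" and b: "dd Z Y 0 b 0" and kb: "k - b * a \<in> Bd X Y 0"
    using n by (auto simp: big.null_morphism_def)
  obtain V v where v: "small.qis Y V v" "v * b \<in> Bd Z V 0"
    using small.null_killed_left[OF Y factor[OF Z Y b]] by metis
  have "v * (k - b * a) + v * b * a \<in> Bd X V 0"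
    using Bd_add[OF Bd_left[OF kb small.qis_closed[OF v(1)], of 0] Bd_right[OF a v(2)]] by simp
  hence "v * k \<in> Bd X V 0" by (simp add: algebra_simps)
  thus "small.null_morphism X Y k" using small.killed_left_null[OF v(1) k] by blast
qed

end

section \<open>Factorization through a triangulated subcategory\<close>

context rel_triangulated
begin

definition factor_from :: "'o set" where
  "factor_from = {X \<in> Ob A. \<forall>Y\<in>F. \<forall>f. dd Y X 0 f 0 \<longrightarrow> null_morphism Y X f}"

definition factor_to :: "'o set" where
  "factor_to = {X \<in> Ob A. \<forall>Y\<in>F. \<forall>f. dd X Y 0 f 0 \<longrightarrow> null_morphism X Y f}"

lemma factor_from_retract:
  assumes X: "X \<in> factor_from" and u: "dd X Y 0 u 0" and v: "dd Y X 0 v 0" and uv: "u * v - Idt A Y \<in> Bd Y Y 0"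
  shows "Y \<in> factor_from"
proof -
  have "null_morphism T Y f" if T: "T \<in> F" and f: "dd T Y 0 f 0" for T f
  proof -
    have vf: "dd T X 0 (v * f) 0" using dd_closed_comp[OF v f] by simp
    obtain Z a b where Z: "Z \<in> N" and a: "dd T Z 0 a 0" and b: "dd Z X 0 b 0" and e: "v * f - b * a \<in> Bd T X 0"
      using X T vf unfolding factor_from_def null_morphism_def by blast
    have "u * (v * f - b * a) - (u * v - Idt A Y) * f \<in> Bd T Y 0"
      using Bd_diff[OF Bd_left[OF e u] Bd_right[OF f uv]] by simp
    hence "f - u * b * a \<in> Bd T Y 0" using dd_id(1)[OF f] by (simp add: algebra_simps)
    moreover have "dd Z Y 0 (u * b) 0" using dd_closed_comp[OF u b] by simp
    ultimately show ?thesis unfolding null_morphism_def using Z a by blast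
  qed
  thus ?thesis using dd_ob[OF u] by (simp add: factor_from_def)
qed

lemma factor_to_retract:
  assumes X: "X \<in> factor_to" and u: "dd X Y 0 u 0" and v: "dd Y X 0 v 0" and uv: "u * v - Idt A Y \<in> Bd Y Y 0"
  shows "Y \<in> factor_to"
proof -
  have "null_morphism Y T f" if T: "T \<in> F" and f: "dd Y T 0 f 0" for T f
  proof -
    have fu: "dd X T 0 (f * u) 0" using dd_closed_comp[OF f u] by simp
    obtain Z a b where Z: "Z \<in> N" and a: "dd X Z 0 a 0" and b: "dd Z T 0 b 0" and e: "f * u - b * a \<in> Bd X T 0"
      using X T fu unfolding factor_to_def null_morphism_def by blast
    have "(f * u - b * a) * v - f * (u * v - Idt A Y) \<in> Bd Y T 0"
      using Bd_diff[OF Bd_right[OF v e] Bd_left[OF uv f]] by simp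
    hence "f - b * (a * v) \<in> Bd Y T 0" using dd_id(2)[OF f] by (simp add: algebra_simps)
    moreover have "dd Y Z 0 (a * v) 0" using dd_closed_comp[OF a v] by simp
    ultimately show ?thesis unfolding null_morphism_def using Z b by blast
  qed
  thus ?thesis using dd_ob[OF u] by (simp add: factor_to_def)
qed

lemma factor_from_degree:
  assumes X: "X \<in> factor_from" and T: "T \<in> F" and f: "dd T X k f 0" and k: "k \<in> {gone A, - gone A}"
  obtains Z a b where "Z \<in> N" "dd T Z 0 a 0" "dd Z X k b 0" "f - b * a \<in> Bd T X k"
proof -
  obtain T1 \<sigma> \<tau> where T1: "T1 \<in> F" and s: "dd T T1 k \<sigma> 0" "dd T1 T (- k) \<tau> 0" and ts: "\<tau> * \<sigma> = Idt A T"
    using shiftE[OF F_sub F_shifts T, of "- k"] by (metis add.inverse_inverse)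
  have "dd T1 X 0 (f * \<tau>) 0" using dd_closed_comp[OF f s(2)] by simp
  then obtain Z a b where Z: "Z \<in> N" and a: "dd T1 Z 0 a 0" and b: "dd Z X 0 b 0" and e: "f * \<tau> - b * a \<in> Bd T1 X 0"
    using X T1 unfolding factor_from_def null_morphism_def by blast
  obtain Z' s' t' where Z': "Z' \<in> N" and s': "dd Z Z' (- k) s' 0" "dd Z' Z k t' 0" and ts': "t' * s' = Idt A Z"
    using N_shiftE[OF Z k] by metis
  have 1: "dd T Z k (a * \<sigma>) 0" using dd_closed_comp[OF a s(1)] by simp
  have 2: "dd T Z' 0 (s' * (a * \<sigma>)) 0" using dd_closed_comp[OF s'(1) 1] by simp
  have 3: "dd Z' X k (b * t') 0" using dd_closed_comp[OF b s'(2)] by simp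
  have "b * t' * (s' * (a * \<sigma>)) = b * a * \<sigma>" using ts' dd_id(1)[OF 1] by (metis mult.assoc)
  moreover have "f * \<tau> * \<sigma> = f" using ts dd_id(2)[OF f] by (simp add: mult.assoc)
  moreover have "(f * \<tau> - b * a) * \<sigma> \<in> Bd T X k" using Bd_right[OF s(1) e] by simp
  ultimately have "f - b * t' * (s' * (a * \<sigma>)) \<in> Bd T X k" by (simp add: algebra_simps)
  thus thesis using that Z' 2 3 by blast
qed

lemma factor_to_degree:
  assumes X: "X \<in> factor_to" and T: "T \<in> F" and f: "dd X T k f 0" and k: "k \<in> {gone A, - gone A}"
  obtains Z a b where "Z \<in> N" "dd X Z k a 0" "dd Z T 0 b 0" "f - b * a \<in> Bd X T k"
proof -
  obtain T1 \<sigma> \<tau> where T1: "T1 \<in> F" and s: "dd T T1 (- k) \<sigma> 0" "dd T1 T k \<tau> 0" and ts: "\<tau> * \<sigma> = Idt A T"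
    using shiftE[OF F_sub F_shifts T, of k] by metis
  have "dd X T1 0 (\<sigma> * f) 0" using dd_closed_comp[OF s(1) f] by simp
  then obtain Z a b where Z: "Z \<in> N" and a: "dd X Z 0 a 0" and b: "dd Z T1 0 b 0" and e: "\<sigma> * f - b * a \<in> Bd X T1 0"
    using X T1 unfolding factor_to_def null_morphism_def by blast
  have k': "- k \<in> {gone A, - gone A}" using k by auto
  obtain Z' s' t' where Z': "Z' \<in> N" and s': "dd Z Z' k s' 0" "dd Z' Z (- k) t' 0" and ts': "t' * s' = Idt A Z"
    using N_shiftE[OF Z k'] by (metis add.inverse_inverse)
  have 1: "dd Z T k (\<tau> * b) 0" using dd_closed_comp[OF s(2) b] by simp
  have 2: "dd Z' T 0 (\<tau> * b * t') 0" using dd_closed_comp[OF 1 s'(2)] by simp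
  have 3: "dd X Z' k (s' * a) 0" using dd_closed_comp[OF s'(1) a] by simp
  have "\<tau> * b * t' * (s' * a) = \<tau> * (b * a)" using ts' dd_id(1)[OF a] by (metis mult.assoc)
  moreover have "\<tau> * (\<sigma> * f) = f" using ts dd_id(1)[OF f] by (metis mult.assoc)
  moreover have "\<tau> * (\<sigma> * f - b * a) \<in> Bd X T k" using Bd_left[OF e s(2)] by simp
  ultimately have "f - \<tau> * b * t' * (s' * a) \<in> Bd X T k" by (simp add: algebra_simps)
  thus thesis using that Z' 2 3 by blast
qed

lemma contractible_in_N:
  assumes X: "X \<in> F" and c: "Idt A X \<in> Bd X X 0" shows "X \<in> N"
proof -
  obtain X0 where X0: "X0 \<in> N" using N_nonempty by blast
  obtain C0 q0 p0 j0 i0 where C0: "C0 \<in> F" "cone X0 (Idt A X0) X0 C0 q0 p0 j0 i0"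
    using coneE[OF F_cones _ _ dd_idt[OF N_Ob[OF X0]]] X0 N_sub by (metis subsetD)
  have "C0 \<in> N" using N_cone X0 C0 is_cone_iff by blast
  thus ?thesis using N_iso X contractible_hiso[OF cone_idt_contractible[OF C0(2)] c] by blast
qed

lemma N_sub_factor: "N \<subseteq> factor_from" "N \<subseteq> factor_to"
  unfolding factor_from_def factor_to_def using N_factors N_Ob by blast+

lemma factor_from_triangulated: "triangulated_sub A factor_from"
  unfolding triangulated_sub_def
proof (intro conjI ballI allI impI)
  show "factor_from \<subseteq> Ob A" by (auto simp: factor_from_def)
  show "factor_from \<noteq> {}" using N_nonempty N_sub_factor by blast
next
  fix X Y assume "X \<in> factor_from" "cat_isomorphic (H0 A) X Y"
  thus "Y \<in> factor_from" using factor_from_retract unfolding H0_iso hiso_def by blast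
next
  fix X i X' s t assume X: "X \<in> factor_from" and i: "i \<in> {gone A, - gone A}" and "is_shift A X i X' s t"
  hence s: "dd X X' (- i) s 0" "dd X' X i t 0" and st: "s * t = Idt A X'" and X': "X' \<in> Ob A"
    by (auto simp: is_shift_def dd_Cyc)
  have "null_morphism T X' f" if T: "T \<in> F" and f: "dd T X' 0 f 0" for T f
  proof -
    have "dd T X i (t * f) 0" using dd_closed_comp[OF s(2) f] by simp
    then obtain Z a b where Z: "Z \<in> N" and a: "dd T Z 0 a 0" and b: "dd Z X i b 0" and e: "t * f - b * a \<in> Bd T X i"
      using factor_from_degree[OF X T _ i] by metis
    have "s * (t * f - b * a) \<in> Bd T X' 0" using Bd_left[OF e s(1)] by simp
    moreover have "s * (t * f) = f" using st dd_id(1)[OF f] by (metis mult.assoc)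
    ultimately have "f - s * b * a \<in> Bd T X' 0" by (simp add: algebra_simps)
    moreover have "dd Z X' 0 (s * b) 0" using dd_closed_comp[OF s(1) b] by simp
    ultimately show ?thesis unfolding null_morphism_def using Z a by blast
  qed
  thus "X' \<in> factor_from" using X' by (simp add: factor_from_def)
next
  fix X1 X2 c C q p assume X1: "X1 \<in> factor_from" and X2: "X2 \<in> factor_from" and "is_cone A X1 c X2 C q p"
  then obtain j i where c: "cone X1 c X2 C q p j i" using is_cone_iff by blast
  note d = cone_dd[OF c]
  have "null_morphism T C f" if T: "T \<in> F" and f: "dd T C 0 f 0" for T f
  proof -
    \<comment> \<open>First \<open>p * f\<close> is killed by a denominator \<open>u\<close>, so
      \<open>f * u\<close> comes from \<open>X2\<close> up to homotopy. This lift is killed by a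
      further denominator \<open>u'\<close>, and so \<open>f\<close> is killed by
      \<open>u * u'\<close>.\<close>
    have "dd T X1 (gone A) (p * f) 0" using dd_closed_comp[OF d(3) f] by simp
    then obtain Z a b where Z: "Z \<in> N" and a: "dd T Z 0 a 0" and b: "dd Z X1 (gone A) b 0"
        and e: "p * f - b * a \<in> Bd T X1 (gone A)"
      using factor_from_degree[OF X1 T, of "gone A"] by blast
    obtain V u where u: "qis V T u" "a * u \<in> Bd V Z 0" using null_killed_right[OF T N_factors(1)[OF Z a]] by metis
    have V: "V \<in> F" "dd V T 0 u 0" using u qis_closed by (auto simp: qis_def)
    have "(p * f - b * a) * u + b * (a * u) \<in> Bd V X1 (gone A)"
      using Bd_add[OF Bd_right[OF V(2) e] Bd_left[OF u(2) b]] by simp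
    hence "p * (f * u) \<in> Bd V X1 (gone A)" by (simp add: algebra_simps)
    moreover have fu: "dd V C 0 (f * u) 0" using dd_closed_comp[OF f V(2)] by simp
    ultimately obtain g where g: "dd V X2 0 g 0" "f * u - j * g \<in> Bd V C 0"
      using cone_exact_C[OF c] by metis
    have "null_morphism V X2 g" using X2 V(1) g(1) by (simp add: factor_from_def)
    then obtain V' u' where u': "qis V' V u'" "g * u' \<in> Bd V' X2 0" using null_killed_right[OF V(1)] by metis
    have "(f * u - j * g) * u' + j * (g * u') \<in> Bd V' C 0"
      using Bd_add[OF Bd_right[OF qis_closed[OF u'(1)] g(2)] Bd_left[OF u'(2) d(4)]] by simp
    hence "f * (u * u') \<in> Bd V' C 0" by (simp add: algebra_simps)
    thus ?thesis using killed_right_null[OF qis_comp[OF u'(1) u(1)] f] by blast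
  qed
  thus "C \<in> factor_from" using dd_ob[OF d(4)] by (simp add: factor_from_def)
qed

lemma factor_to_triangulated: "triangulated_sub A factor_to"
  unfolding triangulated_sub_def
proof (intro conjI ballI allI impI)
  show "factor_to \<subseteq> Ob A" by (auto simp: factor_to_def)
  show "factor_to \<noteq> {}" using N_nonempty N_sub_factor by blast
next
  fix X Y assume "X \<in> factor_to" "cat_isomorphic (H0 A) X Y"
  thus "Y \<in> factor_to" using factor_to_retract unfolding H0_iso hiso_def by blast
next
  fix X i X' s t assume X: "X \<in> factor_to" and i: "i \<in> {gone A, - gone A}" and "is_shift A X i X' s t"
  hence s: "dd X X' (- i) s 0" "dd X' X i t 0" and st: "s * t = Idt A X'" and X': "X' \<in> Ob A"
    by (auto simp: is_shift_def dd_Cyc)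
  have i': "- i \<in> {gone A, - gone A}" using i by auto
  have "null_morphism X' T f" if T: "T \<in> F" and f: "dd X' T 0 f 0" for T f
  proof -
    have "dd X T (- i) (f * s) 0" using dd_closed_comp[OF f s(1)] by simp
    then obtain Z a b where Z: "Z \<in> N" and a: "dd X Z (- i) a 0" and b: "dd Z T 0 b 0" and e: "f * s - b * a \<in> Bd X T (- i)"
      using factor_to_degree[OF X T _ i'] by metis
    have "(f * s - b * a) * t \<in> Bd X' T 0" using Bd_right[OF s(2) e] by simp
    moreover have "f * s * t = f" using st dd_id(2)[OF f] by (simp add: mult.assoc)
    ultimately have "f - b * (a * t) \<in> Bd X' T 0" by (simp add: algebra_simps)
    moreover have "dd X' Z 0 (a * t) 0" using dd_closed_comp[OF a s(2)] by simp
    ultimately show ?thesis unfolding null_morphism_def using Z b by blast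
  qed
  thus "X' \<in> factor_to" using X' by (simp add: factor_to_def)
next
  fix X1 X2 c C q p assume X1: "X1 \<in> factor_to" and X2: "X2 \<in> factor_to" and "is_cone A X1 c X2 C q p"
  then obtain j i where c: "cone X1 c X2 C q p j i" using is_cone_iff by blast
  note d = cone_dd[OF c]
  have "null_morphism C T f" if T: "T \<in> F" and f: "dd C T 0 f 0" for T f
  proof -
    have fj: "dd X2 T 0 (f * j) 0" using dd_closed_comp[OF f d(4)] by simp
    hence "null_morphism X2 T (f * j)" using X2 T by (simp add: factor_to_def)
    then obtain V v where v: "qis T V v" "v * (f * j) \<in> Bd X2 V 0" using null_killed_left[OF T] by metis
    have V: "V \<in> F" "dd T V 0 v 0" using v qis_closed by (auto simp: qis_def)
    have vf: "dd C V 0 (v * f) 0" using dd_closed_comp[OF V(2) f] by simp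
    \<comment> \<open>Since \<open>v * f\<close> vanishes on \<open>X2\<close> up to homotopy, it
      comes from a morphism \<open>g\<close> of degree \<open>- gone A\<close> on \<open>X1\<close>.
      That one factors through an object of \<open>N\<close>, whose map to \<open>V\<close> is
      killed by \<open>v'\<close>.\<close>
    obtain g where g: "dd X1 V (- gone A) g 0" "v * f - g * p \<in> Bd C V 0"
      using cone_coexact_C[OF c vf] v(2) by (metis mult.assoc)
    obtain Z a b where Z: "Z \<in> N" and a: "dd X1 Z (- gone A) a 0" and b: "dd Z V 0 b 0"
        and e: "g - b * a \<in> Bd X1 V (- gone A)"
      using factor_to_degree[OF X1 V(1) g(1)] by blast
    obtain V' v' where v': "qis V V' v'" "v' * b \<in> Bd Z V' 0" using null_killed_left[OF V(1) N_factors(2)[OF Z b]] by metis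
    note v'c = qis_closed[OF v'(1)]
    have ap: "dd C Z 0 (a * p) 0" using dd_closed_comp[OF a d(3)] by simp
    have ep: "(g - b * a) * p \<in> Bd C V 0" using Bd_right[OF d(3) e] by simp
    have "v' * (v * f - g * p) + v' * ((g - b * a) * p) + v' * b * (a * p) \<in> Bd C V' 0"
      using Bd_add[OF Bd_add[OF Bd_left[OF g(2) v'c] Bd_left[OF ep v'c]] Bd_right[OF ap v'(2)]] by simp
    hence "v' * v * f \<in> Bd C V' 0" by (simp add: algebra_simps)
    thus ?thesis using killed_left_null[OF qis_comp[OF v(1) v'(1)] f] by blast
  qed
  thus "C \<in> factor_to" using dd_ob[OF d(4)] by (simp add: factor_to_def)
qed

lemma factor_from_thick: "thick_sub A factor_from"
  unfolding thick_sub_def H0_retract using factor_from_triangulated factor_from_retract by blast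

lemma factor_to_thick: "thick_sub A factor_to"
  unfolding thick_sub_def H0_retract using factor_to_triangulated factor_to_retract by blast

end

subsection \<open>Products and coproducts\<close>

context dg_category
begin

lemma productD:
  assumes "is_product A I X P \<pi>"
  shows "P \<in> Ob A" "i \<in> I \<Longrightarrow> X i \<in> Ob A" "i \<in> I \<Longrightarrow> dd P (X i) 0 (\<pi> i) 0"
  using assms by (auto simp: is_product_def dd_Cyc)

lemma product_universal:
  assumes "is_product A I X P \<pi>" "Z \<in> Ob A" "\<And>i. i \<in> I \<Longrightarrow> h i \<in> Hom A Z (X i) n"
  shows "\<exists>!g. g \<in> Hom A Z P n \<and> (\<forall>i\<in>I. \<pi> i * g = h i)"
  using assms unfolding is_product_def by blast

lemma product_unique:
  assumes P: "is_product A I X P \<pi>" and g: "dd Z P n g x" "dd Z P n g' y" and e: "\<And>i. i \<in> I \<Longrightarrow> \<pi> i * g = \<pi> i * g'"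
  shows "g = g'"
proof -
  have Z: "Z \<in> Ob A" using dd_ob g by blast
  have "\<pi> i * g \<in> Hom A Z (X i) n" if "i \<in> I" for i
    using dd_Hom[OF dd_comp0[OF productD(3)[OF P that] g(1)]] .
  hence "\<exists>!k. k \<in> Hom A Z P n \<and> (\<forall>i\<in>I. \<pi> i * k = \<pi> i * g)"
    using product_universal[OF P Z, of "\<lambda>i. \<pi> i * g"] by blast
  thus ?thesis using dd_Hom[OF g(1)] dd_Hom[OF g(2)] e by metis
qed

text \<open>The projections are closed, so the differential of the induced map is computed
  componentwise. Allowing nonclosed families is what makes it possible to assemble
  homotopies.\<close>

lemma product_map:
  assumes P: "is_product A I X P \<pi>" and Z: "Z \<in> Ob A" and h: "\<And>i. i \<in> I \<Longrightarrow> dd Z (X i) n (h i) (h' i)"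
  obtains g g' where "dd Z P n g g'" "\<And>i. i \<in> I \<Longrightarrow> \<pi> i * g = h i" "\<And>i. i \<in> I \<Longrightarrow> \<pi> i * g' = h' i"
proof -
  have "\<forall>i\<in>I. h i \<in> Hom A Z (X i) n" using h dd_Hom by blast
  then obtain g where g: "g \<in> Hom A Z P n" "\<And>i. i \<in> I \<Longrightarrow> \<pi> i * g = h i"
    using product_universal[OF P Z, of h n] by blast
  have d: "dd Z P n g (Diff A Z P n g)" using ddI Z productD(1)[OF P] g(1) by blast
  have "\<pi> i * Diff A Z P n g = h' i" if "i \<in> I" for i
    using dd_unique[OF dd_comp0[OF productD(3)[OF P that] d]] h[OF that] g(2)[OF that] by force
  thus thesis using that d g(2) by blast
qed

lemma product_map_closed:
  assumes P: "is_product A I X P \<pi>" and Z: "Z \<in> Ob A" and h: "\<And>i. i \<in> I \<Longrightarrow> dd Z (X i) n (h i) 0"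
  obtains g where "dd Z P n g 0" "\<And>i. i \<in> I \<Longrightarrow> \<pi> i * g = h i"
proof -
  obtain g g' where g: "dd Z P n g g'" "\<And>i. i \<in> I \<Longrightarrow> \<pi> i * g = h i" "\<And>i. i \<in> I \<Longrightarrow> \<pi> i * g' = 0"
    using product_map[OF P Z h] by blast
  have "g' = 0" by (rule product_unique[OF P dd_deriv[OF g(1) refl] dd_zero[OF Z productD(1)[OF P]]]) (simp add: g)
  thus thesis using that g by blast
qed

lemma product_hiso:
  assumes P: "is_product A I X P \<pi>" and Q: "is_product A I X Q \<rho>"
  shows "hiso P Q"
proof -
  note p = productD[OF P] note q = productD[OF Q]
  obtain g where g: "dd P Q 0 g 0" "\<And>i. i \<in> I \<Longrightarrow> \<rho> i * g = \<pi> i" using product_map_closed[OF Q p(1) p(3)] by metis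
  obtain h where h: "dd Q P 0 h 0" "\<And>i. i \<in> I \<Longrightarrow> \<pi> i * h = \<rho> i" using product_map_closed[OF P q(1) q(3)] by metis
  have "h * g = Idt A P"
    by (rule product_unique[OF P dd_comp0[OF h(1) g(1)] dd_idt[OF p(1)]])
      (use g(2) h(2) dd_id(2)[OF p(3)] in \<open>metis mult.assoc\<close>)
  moreover have "g * h = Idt A Q"
    by (rule product_unique[OF Q dd_comp0[OF g(1) h(1)] dd_idt[OF q(1)]])
      (use g(2) h(2) dd_id(2)[OF q(3)] in \<open>metis mult.assoc\<close>)
  ultimately show ?thesis unfolding hiso_def using g h Bd_zero p(1) q(1) by (metis diff_self)
qed

lemma coproductD:
  assumes "is_coproduct A I X P \<pi>"
  shows "P \<in> Ob A" "i \<in> I \<Longrightarrow> X i \<in> Ob A" "i \<in> I \<Longrightarrow> dd (X i) P 0 (\<pi> i) 0"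
  using assms by (auto simp: is_coproduct_def dd_Cyc)

lemma coproduct_universal:
  assumes "is_coproduct A I X P \<pi>" "Z \<in> Ob A" "\<And>i. i \<in> I \<Longrightarrow> h i \<in> Hom A (X i) Z n"
  shows "\<exists>!g. g \<in> Hom A P Z n \<and> (\<forall>i\<in>I. g * \<pi> i = h i)"
  using assms unfolding is_coproduct_def by blast

lemma coproduct_unique:
  assumes P: "is_coproduct A I X P \<pi>" and g: "dd P Z n g x" "dd P Z n g' y" and e: "\<And>i. i \<in> I \<Longrightarrow> g * \<pi> i = g' * \<pi> i"
  shows "g = g'"
proof -
  have Z: "Z \<in> Ob A" using dd_ob g by blast
  have "g * \<pi> i \<in> Hom A (X i) Z n" if "i \<in> I" for i
    using dd_Hom[OF dd_comp[OF g(1) coproductD(3)[OF P that], of n]] by simp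
  hence "\<exists>!k. k \<in> Hom A P Z n \<and> (\<forall>i\<in>I. k * \<pi> i = g * \<pi> i)"
    using coproduct_universal[OF P Z, of "\<lambda>i. g * \<pi> i"] by blast
  thus ?thesis using dd_Hom[OF g(1)] dd_Hom[OF g(2)] e by metis
qed

lemma coproduct_map:
  assumes P: "is_coproduct A I X P \<pi>" and Z: "Z \<in> Ob A" and h: "\<And>i. i \<in> I \<Longrightarrow> dd (X i) Z n (h i) (h' i)"
  obtains g g' where "dd P Z n g g'" "\<And>i. i \<in> I \<Longrightarrow> g * \<pi> i = h i" "\<And>i. i \<in> I \<Longrightarrow> g' * \<pi> i = h' i"
proof -
  have "\<forall>i\<in>I. h i \<in> Hom A (X i) Z n" using h dd_Hom by blast
  then obtain g where g: "g \<in> Hom A P Z n" "\<And>i. i \<in> I \<Longrightarrow> g * \<pi> i = h i"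
    using coproduct_universal[OF P Z, of h n] by blast
  have d: "dd P Z n g (Diff A P Z n g)" using ddI Z coproductD(1)[OF P] g(1) by blast
  have "Diff A P Z n g * \<pi> i = h' i" if "i \<in> I" for i
    using dd_unique[OF dd_comp[OF d coproductD(3)[OF P that], of n]] h[OF that] g(2)[OF that]
    by (simp add: ksign_zero)
  thus thesis using that d g(2) by blast
qed

lemma coproduct_map_closed:
  assumes P: "is_coproduct A I X P \<pi>" and Z: "Z \<in> Ob A" and h: "\<And>i. i \<in> I \<Longrightarrow> dd (X i) Z n (h i) 0"
  obtains g where "dd P Z n g 0" "\<And>i. i \<in> I \<Longrightarrow> g * \<pi> i = h i"
proof -
  obtain g g' where g: "dd P Z n g g'" "\<And>i. i \<in> I \<Longrightarrow> g * \<pi> i = h i" "\<And>i. i \<in> I \<Longrightarrow> g' * \<pi> i = 0"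
    using coproduct_map[OF P Z h] by blast
  have "g' = 0" by (rule coproduct_unique[OF P dd_deriv[OF g(1) refl] dd_zero[OF coproductD(1)[OF P] Z]]) (simp add: g)
  thus thesis using that g by blast
qed

lemma coproduct_hiso:
  assumes P: "is_coproduct A I X P \<pi>" and Q: "is_coproduct A I X Q \<rho>"
  shows "hiso P Q"
proof -
  note p = coproductD[OF P] note q = coproductD[OF Q]
  obtain g where g: "dd Q P 0 g 0" "\<And>i. i \<in> I \<Longrightarrow> g * \<rho> i = \<pi> i" using coproduct_map_closed[OF Q p(1) p(3)] by metis
  obtain h where h: "dd P Q 0 h 0" "\<And>i. i \<in> I \<Longrightarrow> h * \<pi> i = \<rho> i" using coproduct_map_closed[OF P q(1) q(3)] by metis
  have "g * h = Idt A P"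
    by (rule coproduct_unique[OF P dd_comp0[OF g(1) h(1)] dd_idt[OF p(1)]])
      (use g(2) h(2) dd_id(1)[OF p(3)] in \<open>metis mult.assoc\<close>)
  moreover have "h * g = Idt A Q"
    by (rule coproduct_unique[OF Q dd_comp0[OF h(1) g(1)] dd_idt[OF q(1)]])
      (use g(2) h(2) dd_id(1)[OF q(3)] in \<open>metis mult.assoc\<close>)
  ultimately show ?thesis unfolding hiso_def using g h Bd_zero p(1) q(1) by (metis diff_self)
qed

end

subsection \<open>Full DG-subcategories\<close>

text \<open>\<open>A'\<close> is a separate record, possibly of another type, that shares the
  grading data, Hom groups, identities and differentials with \<open>A\<close>; taking
  \<open>F\<close> to be all objects covers \<open>A\<close> itself. The contractible object of
  \<open>F\<close> keeps intersections of triangulated subcategories nonempty.\<close>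

locale full_dg_subcategory = dg_category A
  for A :: "('g::ab_group_add, 'o, 'm::ring, 'z) dgcat_scheme"
    and A' :: "('g, 'o, 'm, 'y) dgcat_scheme" and F +
  assumes F_sub: "F \<subseteq> Ob A" and F_shifts: "closed_under_shifts A F" and F_cones: "closed_under_cones A F"
    and F_contractible: "\<exists>X\<in>F. Idt A X \<in> Bd X X 0"
    and same: "sform A' = sform A" "gone A' = gone A" "Hom A' = Hom A" "Idt A' = Idt A" "Diff A' = Diff A"
    and Ob': "Ob A' = F"

sublocale full_dg_subcategory \<subseteq> sub: dg_category A'
proof -
  have k: "ksign A' = ksign A" by (intro ext) (simp add: ksign_def same)
  have s: "X \<in> F \<Longrightarrow> X \<in> Ob A" for X using F_sub by blast
  show "dg_category A'"
  proof (unfold_locales, unfold same Ob' k, goal_cases)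
    case 1 thus ?case using s sform_sym by blast
  next
    case 2 thus ?case using s sform_add by blast
  next
    case 3 thus ?case using s sform_gone by blast
  next
    case 4 thus ?case using s zero_Hom by blast
  next
    case 5 thus ?case using s add_Hom by blast
  next
    case 6 thus ?case using s uminus_Hom by blast
  next
    case 7 thus ?case using s comp_Hom by blast
  next
    case 8 thus ?case using s Idt_Hom by blast
  next
    case 9 thus ?case using s Idt_left by blast
  next
    case 10 thus ?case using s Idt_right by blast
  next
    case 11 thus ?case using s Diff_Hom by blast
  next
    case 12 thus ?case using s Diff_add by blast
  next
    case 13 thus ?case using s Diff_Diff by blast
  next
    case 14 thus ?case using s Leibniz by blast
  qed
qed

context full_dg_subcategory
begin

lemma sub_dd: "sub.dd X Y n f f' \<longleftrightarrow> X \<in> F \<and> Y \<in> F \<and> dd X Y n f f'"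
  using F_sub by (auto simp: sub.dd_def dd_def same Ob')

lemma sub_Bd: "X \<in> F \<Longrightarrow> Y \<in> F \<Longrightarrow> sub.Bd X Y n = Bd X Y n"
  by (simp add: sub.Bd_def Bd_def sub_dd same)

lemma sub_hiso: "sub.hiso X Y \<longleftrightarrow> X \<in> F \<and> Y \<in> F \<and> hiso X Y"
  unfolding sub.hiso_def hiso_def sub_dd same using sub_Bd by metis

lemma sub_cone: "sub.cone X f Y C q p j i \<longleftrightarrow> X \<in> F \<and> Y \<in> F \<and> C \<in> F \<and> cone X f Y C q p j i"
  by (auto simp: sub.cone_def cone_def sub_dd same)

lemma sub_is_cone: "is_cone A' X f Y C q p \<longleftrightarrow> X \<in> F \<and> Y \<in> F \<and> C \<in> F \<and> is_cone A X f Y C q p"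
  by (auto simp: sub.is_cone_iff is_cone_iff sub_cone)

lemma sub_Cyc: "Cyc A' = Cyc A"
  by (intro ext) (simp add: Cyc_def same)

lemma sub_is_shift: "is_shift A' X i X' s t \<longleftrightarrow> X \<in> F \<and> X' \<in> F \<and> is_shift A X i X' s t"
  using F_sub by (auto simp: is_shift_def sub_Cyc same Ob')

lemma sub_H0: "H0 A' = H0 A\<lparr>cobj := F\<rparr>"
proof -
  have "hclass A' = hclass A" by (intro ext) (simp add: hclass_def same)
  thus ?thesis by (simp add: H0_def Ob' sub_Cyc same)
qed

text \<open>The bridge from statements inside \<open>A'\<close> to the relative notion, in which all
  morphisms and homotopies are those of \<open>A\<close>.\<close>

lemma triangulated_sub_iff: "triangulated_sub A' N \<longleftrightarrow> rel_triangulated A F N"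
proof
  assume t: "triangulated_sub A' N"
  have N: "N \<subseteq> F" using t by (simp add: triangulated_sub_def Ob')
  show "rel_triangulated A F N"
  proof unfold_locales
    fix X Y assume "X \<in> N" "Y \<in> F" "hiso X Y"
    thus "Y \<in> N" using t N unfolding triangulated_sub_def sub.H0_iso sub_hiso by blast
  next
    fix X X' i s t' assume "X \<in> N" "X' \<in> F" "i \<in> {gone A, - gone A}" "is_shift A X i X' s t'"
    thus "X' \<in> N" using t N unfolding triangulated_sub_def sub_is_shift same by (metis subsetD)
  next
    fix X Y C f q p assume "X \<in> N" "Y \<in> N" "C \<in> F" "is_cone A X f Y C q p"
    thus "C \<in> N" using t N unfolding triangulated_sub_def sub_is_cone by blast
  qed (use t F_sub F_shifts F_cones N in \<open>auto simp: triangulated_sub_def\<close>)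
next
  assume "rel_triangulated A F N"
  then interpret r: rel_triangulated A F N .
  show "triangulated_sub A' N"
    unfolding triangulated_sub_def sub.H0_iso sub_hiso sub_is_shift sub_is_cone same Ob'
  proof (intro conjI ballI allI impI)
    show "N \<subseteq> F" "N \<noteq> {}" by (fact r.N_sub r.N_nonempty)+
  next
    fix X Y assume "X \<in> N" "X \<in> F \<and> Y \<in> F \<and> hiso X Y"
    thus "Y \<in> N" using r.N_iso by blast
  next
    fix X i X' s t assume "X \<in> N" "i \<in> {gone A, - gone A}" "X \<in> F \<and> X' \<in> F \<and> is_shift A X i X' s t"
    thus "X' \<in> N" using r.N_shift by blast
  next
    fix X Y f C q p assume "X \<in> N" "Y \<in> N" "X \<in> F \<and> Y \<in> F \<and> C \<in> F \<and> is_cone A X f Y C q p"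
    thus "C \<in> N" using r.N_cone by blast
  qed
qed

lemma triangulated_sub_whole: "triangulated_sub A' F"
  using F_contractible F_sub F_shifts F_cones
  by (subst triangulated_sub_iff, unfold_locales) auto

text \<open>A contractible object of \<open>F\<close> lies in every member of the family by
  \<open>contractible_in_N\<close>, which settles nonemptiness; the closure properties pass to
  intersections.\<close>

lemma triangulated_sub_Inter:
  assumes ne: "\<N> \<noteq> {}" and t: "\<And>N. N \<in> \<N> \<Longrightarrow> triangulated_sub A' N"
  shows "triangulated_sub A' (\<Inter>\<N>)"
proof -
  have r: "rel_triangulated A F N" if "N \<in> \<N>" for N using t[OF that] by (simp add: triangulated_sub_iff)
  obtain Z where Z: "Z \<in> F" "Idt A Z \<in> Bd Z Z 0" using F_contractible by blast
  have "Z \<in> \<Inter>\<N>" using rel_triangulated.contractible_in_N[OF r Z] by blast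
  moreover have "\<Inter>\<N> \<subseteq> F" using ne rel_triangulated.N_sub[OF r] by blast
  ultimately have "rel_triangulated A F (\<Inter>\<N>)"
  proof (unfold_locales, goal_cases)
    case (6 X Y) then show ?case using rel_triangulated.N_iso[OF r] by blast
  next
    case (7 X X' i s t) then show ?case using rel_triangulated.N_shift[OF r] by blast
  next
    case (8 X Y C f q p) then show ?case using rel_triangulated.N_cone[OF r] by blast
  qed (use F_sub F_shifts F_cones in blast)+
  thus ?thesis by (simp add: triangulated_sub_iff)
qed

lemma sub_denominators:
  assumes "rel_triangulated A F N"
  shows "cone_in A' N = rel_triangulated.denominators A F N"
proof -
  interpret r: rel_triangulated A F N by fact
  have h: "hclass A' = hclass A" by (intro ext) (simp add: hclass_def same)
  show ?thesis
    unfolding cone_in_def r.denominators_def r.qis_def sub_is_cone h is_cone_iff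
    using r.N_sub by (intro ext) blast
qed

lemma triangulated_sub_restrict:
  assumes "rel_triangulated A (Ob A) N" shows "triangulated_sub A' (N \<inter> F)"
proof -
  interpret r: rel_triangulated A "Ob A" N by fact
  have "N \<inter> F \<noteq> {}" using F_contractible F_sub r.contractible_in_N by blast
  then have "rel_triangulated A F (N \<inter> F)"
  proof (unfold_locales, goal_cases)
    case (6 X Y) then show ?case using r.N_iso F_sub by blast
  next
    case (7 X X' i s t) then show ?case using r.N_shift F_sub by blast
  next
    case (8 X Y C f q p) then show ?case using r.N_cone F_sub by blast
  qed (use F_sub F_shifts F_cones in blast)+
  thus ?thesis by (simp add: triangulated_sub_iff)
qed

lemma thick_sub_restrict:
  assumes r: "rel_triangulated A (Ob A) N" and t: "thick_sub A N" shows "thick_sub A' (N \<inter> F)"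
proof -
  have "X \<in> N \<inter> F" if "Y \<in> N \<inter> F" "cat_retract (H0 A') X Y" for X Y
  proof -
    have X: "X \<in> F" using that(2) by (auto simp: cat_retract_def sub_H0)
    have "cat_retract (H0 A) X Y" using that(2) that(1) X F_sub
      unfolding sub.H0_retract H0_retract sub_dd same using sub_Bd by blast
    thus ?thesis using t that X unfolding thick_sub_def by blast
  qed
  thus ?thesis using triangulated_sub_restrict[OF r] unfolding thick_sub_def by blast
qed

lemma sub_product:
  assumes "is_product A I X P \<pi>" "X \<in> I \<rightarrow> F" "P \<in> F"
  shows "is_product A' I X P \<pi>"
  using assms F_sub unfolding is_product_def same sub_Cyc Ob' by blast

lemma sub_coproduct:
  assumes "is_coproduct A I X P \<pi>" "X \<in> I \<rightarrow> F" "P \<in> F"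
  shows "is_coproduct A' I X P \<pi>"
  using assms F_sub unfolding is_coproduct_def same sub_Cyc Ob' by blast

end

section \<open>Exact DG-pairs\<close>

context exact_category
begin

lemma preadd: "preadditive_category C"
  using additive by (simp add: additive_category_def)

lemmas zero_mor = preadditive_category.zero_mor[OF preadd]
  and add_mor = preadditive_category.add_mor[OF preadd]
  and comp_mor = preadditive_category.comp_mor[OF preadd]
  and idm_mor = preadditive_category.idm_mor[OF preadd]
  and idm_left = preadditive_category.idm_left[OF preadd]
  and idm_right = preadditive_category.idm_right[OF preadd]

lemma iso_idm: "X \<in> obj C \<Longrightarrow> iso_mor C X (idm C X) X"
  unfolding iso_mor_def using idm_mor idm_left by blast

text \<open>Kernels are unique up to isomorphism, and the admissible sequences are closed under
  isomorphism.\<close>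

lemma ses_of_kernel:
  assumes e: "adm_epi S Y p Z" and X: "X \<in> obj C" and k: "is_kernel C X i Y p Z"
  shows "(X, i, Y, p, Z) \<in> S"
proof -
  obtain X0 i0 where s: "(X0, i0, Y, p, Z) \<in> S" using e by (auto simp: adm_epi_def)
  have ob: "X0 \<in> obj C" "Y \<in> obj C" "Z \<in> obj C" using ses_obj[OF s] by auto
  have k0: "is_kernel C X0 i0 Y p Z" using ses_kernel[OF s] .
  have i: "i \<in> mor C X Y" "p * i = 0" "p \<in> mor C Y Z" using k by (auto simp: is_kernel_def)
  have i0: "i0 \<in> mor C X0 Y" "p * i0 = 0" using k0 by (auto simp: is_kernel_def)
  obtain a where a: "a \<in> mor C X0 X" "i * a = i0" using k i0 ob unfolding is_kernel_def by blast
  obtain b where b: "b \<in> mor C X X0" "i0 * b = i" using k0 i X unfolding is_kernel_def by blast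
  have ba: "b * a \<in> mor C X0 X0" and ab: "a * b \<in> mor C X X" using a b comp_mor X ob by blast+
  have u0: "\<exists>!k. k \<in> mor C X0 X0 \<and> i0 * k = i0" using k0 i0 ob(1) unfolding is_kernel_def by blast
  have u: "\<exists>!k. k \<in> mor C X X \<and> i * k = i" using k i X unfolding is_kernel_def by blast
  have "i0 * (b * a) = i0" "i * (a * b) = i" using a b by (metis mult.assoc)+
  hence "b * a = idm C X0" "a * b = idm C X"
    using u0 u ba ab idm_mor[OF ob(1)] idm_mor[OF X] idm_right[OF ob(1,2) i0(1)] idm_right[OF X ob(2) i(1)] by blast+
  hence "iso_mor C X0 a X" unfolding iso_mor_def using X ob a b by blast
  from ses_iso[OF s this iso_idm[OF ob(2)] iso_idm[OF ob(3)] i(1) i(3)]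
  show ?thesis using a idm_left[OF ob(1,2) i0(1)] idm_left[OF ob(2,3) i(3)] idm_right[OF ob(2,3) i(3)] by simp
qed

text \<open>The zero map \<open>X -> Z0\<close> is an admissible epimorphism, being a cokernel of
  the identity of \<open>X\<close>. Its pullback along \<open>0 : Z -> Z0\<close> has the universal
  property of a product of \<open>X\<close> and \<open>Z\<close>, hence is isomorphic to
  \<open>B\<close>, and so \<open>q\<close> is an admissible epimorphism.\<close>

lemma split_ses:
  assumes ob: "X \<in> obj C" "B \<in> obj C" "Z \<in> obj C"
    and m: "i \<in> mor C X B" "j \<in> mor C Z B" "p \<in> mor C B X" "q \<in> mor C B Z"
    and e: "p * i = idm C X" "q * j = idm C Z" "q * i = 0" "p * j = 0" "i * p + j * q = idm C B"
  shows "(X, i, B, q, Z) \<in> S"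
proof -
  obtain p0 Z0 where s0: "(X, idm C X, X, p0, Z0) \<in> S" using idm_mono[OF ob(1)] by (auto simp: adm_mono_def)
  have Z0: "Z0 \<in> obj C" using ses_obj[OF s0] by blast
  have p0: "p0 \<in> mor C X Z0" "p0 * idm C X = 0" using ses_kernel[OF s0] by (auto simp: is_kernel_def)
  hence "p0 = 0" using idm_right[OF ob(1) Z0] by simp
  hence "adm_epi S X 0 Z0" using s0 by (auto simp: adm_epi_def)
  then obtain f' p' Y' where pb: "is_pullback C X 0 Z0 0 Z f' p' Y'" and ep: "adm_epi S Y' p' Z"
    using pullback_epi[OF _ ob(3) zero_mor[OF ob(3) Z0]] by metis
  have Y': "Y' \<in> obj C" "f' \<in> mor C Y' X" "p' \<in> mor C Y' Z" using pb by (auto simp: is_pullback_def)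
  have uni: "\<exists>!w. w \<in> mor C W Y' \<and> f' * w = u \<and> p' * w = v" if "W \<in> obj C" "u \<in> mor C W X" "v \<in> mor C W Z" for W u v
    using pb that unfolding is_pullback_def by simp
  obtain b where b: "b \<in> mor C B Y'" "f' * b = p" "p' * b = q" using uni[OF ob(2) m(3,4)] by blast
  define a where "a = i * f' + j * p'"
  have a: "a \<in> mor C Y' B" unfolding a_def using add_mor comp_mor Y' ob m by blast
  have ab: "a * b = idm C B" using e(5) b by (simp add: a_def distrib_right mult.assoc)
  have pa: "p * a = f'" "q * a = p'"
    using e(1-4) idm_left[OF Y'(1) ob(1) Y'(2)] idm_left[OF Y'(1) ob(3) Y'(3)]
    by (simp_all add: a_def distrib_left mult.assoc[symmetric])
  have "b * a \<in> mor C Y' Y'" using a b comp_mor Y' ob by blast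
  moreover have "f' * (b * a) = f'" "p' * (b * a) = p'" using b pa by (simp_all add: mult.assoc[symmetric])
  ultimately have ba: "b * a = idm C Y'"
    using uni[OF Y'] idm_mor[OF Y'(1)] idm_right[OF Y'(1) ob(1) Y'(2)] idm_right[OF Y'(1) ob(3) Y'(3)] by blast
  have iso: "iso_mor C Y' a B" unfolding iso_mor_def using a b ab ba Y' ob by blast
  obtain K k where s: "(K, k, Y', p', Z) \<in> S" using ep by (auto simp: adm_epi_def)
  have K: "K \<in> obj C" "k \<in> mor C K Y'" using ses_obj[OF s] ses_kernel[OF s] by (auto simp: is_kernel_def)
  have ak: "a * k \<in> mor C K B" using comp_mor[OF K(1) Y'(1) ob(2) K(2) a] .
  have "(K, a * k, B, q, Z) \<in> S"
    using ses_iso[OF s iso_idm[OF K(1)] iso iso_idm[OF ob(3)] ak m(4)]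
      idm_right[OF K(1) ob(2) ak] idm_left[OF Y'(1) ob(3) Y'(3)] pa by simp
  hence "adm_epi S B q Z" by (auto simp: adm_epi_def)
  moreover have "is_kernel C X i B q Z" unfolding is_kernel_def
  proof (intro conjI ballI impI)
    fix W h assume W: "W \<in> obj C" and h: "h \<in> mor C W B" and qh: "q * h = 0"
    have "i * (p * h) = h"
      using idm_left[OF W ob(2) h] qh e(5) by (metis add.right_neutral distrib_right mult.assoc mult_zero_right)
    moreover have "k = p * h" if "k \<in> mor C W X" "i * k = h" for k
      using that e(1) idm_left[OF W ob(1) that(1)] by (metis mult.assoc)
    ultimately show "\<exists>!k. k \<in> mor C W X \<and> i * k = h" using comp_mor[OF W ob(2,1) h m(3)] by blast
  qed (use m e in auto)
  ultimately show ?thesis using ses_of_kernel ob(1) by blast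
qed

end

section \<open>The functor Phi and its adjunctions with Psi^+\<close>

context dg_category
begin

definition nat_ob :: "'o \<Rightarrow> 'm \<Rightarrow> bool" where
  "nat_ob X s \<longleftrightarrow> dd X X (- gone A) s (Idt A X) \<and> s * s = 0"

definition nat_hom :: "'o \<Rightarrow> 'm \<Rightarrow> 'o \<Rightarrow> 'm \<Rightarrow> 'm \<Rightarrow> bool" where
  "nat_hom X s Y t f \<longleftrightarrow> dd X Y 0 f 0 \<and> t * f = f * s"

lemma nat_ob_iff: "(X, s) \<in> Ob (natural_dg A) \<longleftrightarrow> nat_ob X s"
  by (auto simp: natural_dg_def nat_ob_def dd_def)

lemma nat_hom_iff:
  assumes "nat_ob X s" "nat_ob Y t"
  shows "f \<in> mor (Z0 (natural_dg A)) (X, s) (Y, t) \<longleftrightarrow> nat_hom X s Y t f"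
proof -
  have "Hom (natural_dg A) (X, s) (Y, t) 0 = Cyc A X Y 0" by (simp add: natural_dg_def)
  moreover have "Diff (natural_dg A) (X, s) (Y, t) 0 f = t * f - f * s" by (simp add: natural_dg_def ksign_0)
  moreover have "X \<in> Ob A" "Y \<in> Ob A" using assms dd_ob by (auto simp: nat_ob_def)
  ultimately show ?thesis by (auto simp: Z0_def Cyc_def[of "natural_dg A"] nat_hom_def dd_Cyc)
qed

text \<open>\<open>\<Phi>(X)\<close> is \<open>(B, s)\<close>, with closed maps \<open>j\<close> and \<open>p\<close> identifying the graded object underlying \<open>B\<close> with a sum of two
  shifts of \<open>X\<close>.  Normally \<open>(m, k) = (1, 0)\<close>; \<open>(m, k) = (0, 1)\<close> describes \<open>\<Phi>(X[1])\<close> in terms of \<open>X\<close>.\<close>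

definition phi :: "'g \<Rightarrow> 'g \<Rightarrow> 'o \<Rightarrow> 'o \<Rightarrow> 'm \<Rightarrow> 'm \<Rightarrow> 'm \<Rightarrow> bool" where
  "phi m k X B s j p \<longleftrightarrow> (m, k) \<in> {(gone A, 0), (0, gone A)} \<and> nat_ob B s \<and> dd X B m j 0 \<and> dd B X k p 0 \<and>
     p * s * j = Idt A X \<and> j * p * s + s * j * p = Idt A B"

lemma phiD:
  assumes "phi m k X B s j p"
  shows "nat_ob B s" "dd B B (- gone A) s (Idt A B)" "dd X B m j 0" "dd B X k p 0"
    "s * s = 0" "s * (s * h) = 0" "p * (s * j) = Idt A X" "p * (s * (j * h)) = Idt A X * h"
    "p * j = 0" "p * (j * h) = 0" "j * (p * s) = Idt A B - s * (j * p)"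
    "j * (p * (s * h)) = Idt A B * h - s * (j * (p * h))"
proof -
  note a = assms[unfolded phi_def nat_ob_def]
  show "nat_ob B s" using assms by (simp add: phi_def)
  show d: "dd B B (- gone A) s (Idt A B)" "dd X B m j 0" "dd B X k p 0" "s * s = 0" "p * (s * j) = Idt A X"
    using a by (simp_all add: mult.assoc)
  then show "s * (s * h) = 0" "p * (s * (j * h)) = Idt A X * h" by (metis mult.assoc mult_zero_left)+
  show 1: "j * (p * s) = Idt A B - s * (j * p)" using a by (simp add: mult.assoc eq_diff_eq)
  then show "j * (p * (s * h)) = Idt A B * h - s * (j * (p * h))" by (metis left_diff_distrib mult.assoc)
  \<comment> \<open>The decomposition of the identity gives \<open>p * j * p * s = 0\<close>.
    Composing with \<open>j\<close> and using \<open>p * s * j = Idt A X\<close> yields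
    \<open>p * j = 0\<close>.\<close>
  have "p * (j * (p * s)) = p - p * (s * (j * p))" using 1 dd_id(2)[OF d(3)] by (simp add: right_diff_distrib)
  also have "p * (s * (j * p)) = p" using d(5) dd_id(1)[OF d(3)] by (metis mult.assoc)
  finally have "p * j * (p * s * j) = 0" by (metis diff_self mult.assoc mult_zero_left)
  thus pj: "p * j = 0" using d(5) dd_id(2)[OF d(2)] by (metis mult.assoc)
  thus "p * (j * h) = 0" by (metis mult.assoc mult_zero_left)
qed

lemma phi_degree: "phi m k X B s j p \<Longrightarrow> (m = gone A \<and> k = 0) \<or> (m = 0 \<and> k = gone A)"
  by (auto simp: phi_def)

text \<open>Together with \<open>phi_map_unique\<close> this says that Phi is right adjoint to
  Psi^+, up to the shift recorded by \<open>k\<close>. The decomposition of the identity of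
  \<open>B\<close>, and commutation with the contracting homotopies, reconstruct a morphism to
  \<open>B\<close> from its composite \<open>c\<close> with \<open>p\<close>; the formula is this
  reconstruction.\<close>

lemma phi_map:
  assumes ph: "phi m k W B s j p" and X: "nat_ob X t" and c: "dd X W k c 0"
  shows "nat_hom X t B s (j * c * t + s * j * c)" "p * (j * c * t + s * j * c) = c"
proof -
  note d = phiD[OF ph]
  have t: "dd X X (- gone A) t (Idt A X)" "t * t = 0" "t * (t * h) = 0" for h
    using X by (auto simp: nat_ob_def mult.assoc[symmetric])
  have "dd X B 0 (j * (c * t)) (- (j * c))"
    using phi_degree[OF ph]
  proof
    assume "m = gone A \<and> k = 0"
    thus ?thesis using dd_comp1m[OF _ dd_comp0[OF _ t(1)], of W B j 0 c 0] d c dd_id[OF c] by simp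
  next
    assume "m = 0 \<and> k = gone A"
    thus ?thesis using dd_comp0[OF _ dd_comp1m[OF _ t(1)], of W B j 0 c 0] d c dd_id[OF c] by simp
  qed
  moreover have jc: "dd X B (gone A) (j * c) 0"
    using dd_closed_comp[OF d(3) c, of "gone A"] phi_degree[OF ph] by auto
  have "dd X B 0 (s * (j * c)) (j * c)" using dd_compm1[OF d(2) jc] dd_id[OF jc] by simp
  ultimately have 1: "dd X B 0 (j * c * t + s * j * c) 0"
    using dd_add[of X B 0 "j * (c * t)" "- (j * c)" "s * (j * c)" "j * c"] by (simp add: mult.assoc)
  show "nat_hom X t B s (j * c * t + s * j * c)"
    unfolding nat_hom_def using 1 by (simp add: algebra_simps t d)
  show "p * (j * c * t + s * j * c) = c" by (simp add: algebra_simps d dd_id[OF c])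
qed

lemma phi_map_unique:
  assumes ph: "phi m k W B s j p" and f: "nat_hom X t B s f" and g: "nat_hom X t B s g" and e: "p * f = p * g"
  shows "f = g"
proof -
  note d = phiD[OF ph]
  have "f = j * (p * f) * t + s * j * (p * f)" if f: "nat_hom X t B s f" for f
  proof -
    have "dd X B 0 f 0" using f by (simp add: nat_hom_def)
    hence "j * (p * (s * f)) + s * (j * (p * f)) = f" by (simp add: d dd_id)
    thus ?thesis using f by (simp add: nat_hom_def mult.assoc)
  qed
  thus ?thesis using f g e by metis
qed

text \<open>The adjunction on the other side, where a morphism out of \<open>Phi(W)\<close> is
  prescribed by its composite with the closed injection \<open>j\<close>.\<close>

lemma phi_comap:
  assumes ph: "phi m k W B s j p" and X: "nat_ob X t" and c: "dd W X m c 0"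
  shows "nat_hom B s X t (c * p * s + t * c * p)" "(c * p * s + t * c * p) * j = c"
proof -
  note d = phiD[OF ph]
  have t: "dd X X (- gone A) t (Idt A X)" "t * t = 0" "t * (t * h) = 0" for h
    using X by (auto simp: nat_ob_def mult.assoc[symmetric])
  have "dd B X 0 (c * (p * s)) (- (c * p))"
    using phi_degree[OF ph]
  proof
    assume "m = gone A \<and> k = 0"
    thus ?thesis using dd_comp1m[OF _ dd_comp0[OF _ d(2)], of W X c 0 p 0] d c dd_id[OF d(4)] by simp
  next
    assume "m = 0 \<and> k = gone A"
    thus ?thesis using dd_comp0[OF _ dd_comp1m[OF _ d(2)], of W X c 0 p 0] d c dd_id[OF d(4)] by simp
  qed
  moreover have cp: "dd B X (gone A) (c * p) 0"
    using dd_closed_comp[OF c d(4), of "gone A"] phi_degree[OF ph] by auto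
  have "dd B X 0 (t * (c * p)) (c * p)" using dd_compm1[OF t(1) cp] dd_id[OF cp] by simp
  ultimately have 1: "dd B X 0 (c * p * s + t * c * p) 0"
    using dd_add[of B X 0 "c * (p * s)" "- (c * p)" "t * (c * p)" "c * p"] by (simp add: mult.assoc)
  show "nat_hom B s X t (c * p * s + t * c * p)"
    unfolding nat_hom_def using 1 by (simp add: algebra_simps t d)
  show "(c * p * s + t * c * p) * j = c" by (simp add: algebra_simps d dd_id[OF c])
qed

text \<open>Here \<open>X1\<close> is \<open>X[1]\<close>. Composing with the shift maps moves the
  degree from \<open>j\<close> to \<open>p\<close>.\<close>

lemma phi_shift:
  assumes ph: "phi (gone A) 0 X1 B s j p" and s: "dd X X1 (- gone A) a 0" "dd X1 X (gone A) b 0"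
    "b * a = Idt A X" "a * b = Idt A X1"
  shows "phi 0 (gone A) X B s (j * a) (b * p)"
proof -
  note d = phiD[OF ph]
  have ab: "a * (b * h) = Idt A X1 * h" "b * (a * h) = Idt A X * h" for h using s(3,4) by (metis mult.assoc)+
  have "dd X B 0 (j * a) 0" "dd B X (gone A) (b * p) 0"
    using dd_closed_comp[OF d(3) s(1), of 0] dd_closed_comp[OF s(2) d(4)] by simp_all
  thus ?thesis unfolding phi_def using d(1) s dd_id[OF s(1)] dd_id[OF d(4)] dd_id[OF d(2)]
    by (simp add: d ab algebra_simps)
qed

lemma is_Phi_phi:
  assumes "is_Phi A X X1 s t q p (B, \<sigma>)"
  obtains j where "phi (gone A) 0 X B \<sigma> j (t * p)" "t * p * \<sigma> = t * q" "s * t = Idt A X1" "t * s = Idt A X"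
proof -
  obtain \<iota> where sh: "is_shift A X (- gone A) X1 s t" and co: "is_cone A X1 (Idt A X1) X1 B q p"
    and \<iota>: "\<iota> \<in> Hom A X B 0" "q * \<iota> = 0" "p * \<iota> = s" "\<sigma> = \<iota> * (t * q)"
    using assms by (auto simp: is_Phi_def)
  have s: "dd X X1 (gone A) s 0" "dd X1 X (- gone A) t 0" "t * s = Idt A X" "s * t = Idt A X1"
    using sh by (auto simp: is_shift_def dd_Cyc)
  have st: "s * (t * h) = Idt A X1 * h" "t * (s * h) = Idt A X * h" for h using s(3,4) by (metis mult.assoc)+
  obtain j i where c: "cone X1 (Idt A X1) X1 B q p j i" using co is_cone_iff by blast
  note d = cone_dd[OF c] note e = cone_eqs[OF c]
  note ids = d[THEN dd_id(1)] d[THEN dd_id(2)] d[THEN dd_id(3)] d[THEN dd_id(4)]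
    s(1,2)[THEN dd_id(1)] s(1,2)[THEN dd_id(2)] s(1,2)[THEN dd_id(3)] s(1,2)[THEN dd_id(4)]
  have "B \<in> Ob A" "X \<in> Ob A" using d s dd_ob by blast+
  \<comment> \<open>The equations for \<open>\<iota>\<close> force \<open>\<iota> = i * s\<close>,
    so the contracting homotopy of the cone is \<open>i * q\<close>.\<close>
  hence "Idt A B * \<iota> = \<iota>" using Idt_left \<iota>(1) by blast
  hence "\<iota> = (j * q + i * p) * \<iota>" using c by (simp add: cone_def)
  hence "\<iota> = i * s" using \<iota>(2,3) by (simp add: distrib_right mult.assoc)
  hence \<sigma>: "\<sigma> = i * q" using \<iota>(4) by (simp add: mult.assoc st ids)
  have "dd B B (- gone A) (i * q) (Idt A B)"
    using dd_compm0[OF d(5) d(2)] by (simp add: e ids algebra_simps)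
  hence n: "nat_ob B \<sigma>" by (simp add: nat_ob_def \<sigma> mult.assoc e)
  have "phi (gone A) 0 X B \<sigma> (j * s) (t * p)"
    unfolding phi_def using n dd_closed_comp[OF d(4) s(1)] dd_closed_comp[OF s(2) d(3), of 0] s(3)
    by (simp add: \<sigma> algebra_simps e ids st)
  moreover have "t * p * \<sigma> = t * q" by (simp add: \<sigma> mult.assoc e ids)
  ultimately show thesis using that s by blast
qed

end

section \<open>Short exact sequences and the functor Phi\<close>

locale dg_pair =
  fixes E :: "('g::ab_group_add, 'o, 'm::ring) exact_dgcat" and K :: "('o \<times> 'm) set"
  assumes pair: "exact_dg_pair E K"

sublocale dg_pair \<subseteq> exact_dg_category E
  using pair by (simp add: exact_dg_pair_def)

sublocale dg_pair \<subseteq> dg_category E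
  by (rule dg)

context dg_pair
begin

lemma ses_dd:
  assumes "(U, f, V, g, W) \<in> ses E"
  shows "dd U V 0 f 0" "dd V W 0 g 0" "g * f = 0"
  using exact_category.ses_obj[OF exact assms] exact_category.ses_kernel[OF exact assms]
  by (auto simp: is_kernel_def Z0_def dd_Cyc)

lemma K_nat: "(B, s) \<in> K \<Longrightarrow> nat_ob B s"
  using pair nat_ob_iff by (auto simp: exact_dg_pair_def)

lemma PhiE:
  assumes "X \<in> Ob E"
  obtains B \<sigma> X1 s t q p where "(B, \<sigma>) \<in> K" "is_Phi E X X1 s t q p (B, \<sigma>)"
  using pair assms unfolding exact_dg_pair_def Phi_rep_def by (metis surj_pair)

lemma phiE:
  assumes "X \<in> Ob E"
  obtains B s j p where "(B, s) \<in> K" "phi (gone E) 0 X B s j p"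
  using PhiE[OF assms] is_Phi_phi by metis

lemma pair_exact: "exact_category (pair_cat E K) (pair_ses E K)"
  using pair by (simp add: exact_dg_pair_def inherits_exact_def pair_cat_def pair_ses_def)

lemma pair_mor:
  assumes "(X, s) \<in> K" "(Y, t) \<in> K"
  shows "f \<in> mor (pair_cat E K) (X, s) (Y, t) \<longleftrightarrow> nat_hom X s Y t f"
  using nat_hom_iff[OF assms[THEN K_nat]] by (simp add: pair_cat_def)

text \<open>By adjunction \<open>f'\<close> and \<open>g'\<close> are determined by their
  \<open>p\<close>-components. The \<open>q\<close>-components that \<open>Phi_seq\<close> asks for
  follow, because \<open>t * q\<close> is \<open>t * p\<close> composed with the contracting
  homotopy, and \<open>f'\<close> and \<open>g'\<close> commute with these homotopies.\<close>

lemma Phi_sesI: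
  assumes P: "is_Phi E X X1 sx tx qx px (B1, s1)" and p1: "p1 = tx * px"
    and Q: "is_Phi E Y Y1 sy ty qy py (B2, s2)" and p2: "p2 = ty * py"
    and R: "is_Phi E Z Z1 sz tz qz pz (B3, s3)" and p3: "p3 = tz * pz"
    and f: "dd X Y 0 f 0" and g: "dd Y Z 0 g 0"
    and f': "nat_hom B1 s1 B2 s2 f'" "p2 * f' = f * p1" and g': "nat_hom B2 s2 B3 s3 g'" "p3 * g' = g * p2"
  shows "Phi_seq E (X, f, Y, g, Z) ((B1, s1), f', (B2, s2), g', (B3, s3))"
proof -
  obtain j1 where 1: "phi (gone E) 0 X B1 s1 j1 p1" "p1 * s1 = tx * qx" using is_Phi_phi[OF P] p1 by metis
  obtain j2 where 2: "phi (gone E) 0 Y B2 s2 j2 p2" "p2 * s2 = ty * qy" "sy * ty = Idt E Y1" using is_Phi_phi[OF Q] p2 by metis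
  obtain j3 where 3: "phi (gone E) 0 Z B3 s3 j3 p3" "p3 * s3 = tz * qz" "sz * tz = Idt E Z1" using is_Phi_phi[OF R] p3 by metis
  have q: "dd B2 Y1 0 qy (- (Idt E Y1 * py))" "dd B2 Y1 (gone E) py 0" "dd B3 Z1 0 qz (- (Idt E Z1 * pz))" "dd B3 Z1 (gone E) pz 0"
    using Q R is_cone_iff cone_dd unfolding is_Phi_def by (metis fst_conv)+
  have qf: "ty * (qy * f') = f * (tx * qx)" "tz * (qz * g') = g * (ty * qy)"
    using f' g' 1(2) 2(2) 3(2) unfolding nat_hom_def by (metis mult.assoc)+
  have "qy * f' = sy * (ty * (qy * f'))" "qz * g' = sz * (tz * (qz * g'))"
    using 2(3) 3(3) dd_id(1)[OF q(1)] dd_id(1)[OF q(3)] by (metis mult.assoc)+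
  hence A: "qy * f' = sy * f * tx * qx" "qz * g' = sz * g * ty * qy" unfolding qf by (simp_all add: mult.assoc)
  have "py * f' = sy * (ty * py * f')" "pz * g' = sz * (tz * pz * g')"
    using 2(3) 3(3) dd_id(1)[OF q(2)] dd_id(1)[OF q(4)] by (metis mult.assoc)+
  hence B: "py * f' = sy * f * tx * px" "pz * g' = sz * g * ty * py"
    using f'(2) g'(2) p1 p2 p3 by (simp_all add: mult.assoc)
  show ?thesis unfolding Phi_seq.simps fst_conv
  proof (intro conjI)
    show "f \<in> Cyc E X Y 0" "g \<in> Cyc E Y Z 0" "f' \<in> Cyc E B1 B2 0" "g' \<in> Cyc E B2 B3 0"
      using f g f'(1) g'(1) by (auto simp: nat_hom_def dd_Cyc)
  qed (use A B P Q R in blast)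
qed

text \<open>\<open>f'\<close> and \<open>g'\<close> are obtained from \<open>f * p1\<close> and
  \<open>g * p2\<close> by adjunction. Lifting problems use the \<open>p\<close>-component of
  \<open>g'\<close>, extension problems the restriction of \<open>f'\<close> along
  \<open>j1\<close>, so both are recorded.\<close>

lemma ses_Phi:
  assumes ses: "(U, f, V, g, W) \<in> ses E"
  obtains B1 s1 j1 p1 B2 s2 j2 p2 B3 s3 j3 p3 f' g'
  where "phi (gone E) 0 U B1 s1 j1 p1" "phi (gone E) 0 V B2 s2 j2 p2" "phi (gone E) 0 W B3 s3 j3 p3"
    "((B1, s1), f', (B2, s2), g', (B3, s3)) \<in> pair_ses E K"
    "nat_hom B1 s1 B2 s2 f'" "nat_hom B2 s2 B3 s3 g'" "f' * j1 = j2 * f" "p3 * g' = g * p2"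
proof -
  note fg = ses_dd[OF ses]
  obtain B1 s1 U1 sx tx qx px where P: "(B1, s1) \<in> K" "is_Phi E U U1 sx tx qx px (B1, s1)"
    using PhiE dd_ob[OF fg(1)] by metis
  obtain B2 s2 V1 sy ty qy py where Q: "(B2, s2) \<in> K" "is_Phi E V V1 sy ty qy py (B2, s2)"
    using PhiE dd_ob[OF fg(1)] by metis
  obtain B3 s3 W1 sz tz qz pz where R: "(B3, s3) \<in> K" "is_Phi E W W1 sz tz qz pz (B3, s3)"
    using PhiE dd_ob[OF fg(2)] by metis
  obtain j1 where 1: "phi (gone E) 0 U B1 s1 j1 (tx * px)" using is_Phi_phi[OF P(2)] by metis
  obtain j2 where 2: "phi (gone E) 0 V B2 s2 j2 (ty * py)" using is_Phi_phi[OF Q(2)] by metis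
  obtain j3 where 3: "phi (gone E) 0 W B3 s3 j3 (tz * pz)" using is_Phi_phi[OF R(2)] by metis
  note d1 = phiD[OF 1]
  have c: "dd B1 V 0 (f * (tx * px)) 0" "dd B2 W 0 (g * (ty * py)) 0"
    using dd_closed_comp[OF fg(1) d1(4), of 0] dd_closed_comp[OF fg(2) phiD(4)[OF 2], of 0] by simp_all
  define f' where "f' = j2 * (f * (tx * px)) * s1 + s2 * j2 * (f * (tx * px))"
  define g' where "g' = j3 * (g * (ty * py)) * s2 + s3 * j3 * (g * (ty * py))"
  have f': "nat_hom B1 s1 B2 s2 f'" "ty * py * f' = f * (tx * px)"
    unfolding f'_def using phi_map[OF 2 d1(1) c(1)] by simp_all
  have g': "nat_hom B2 s2 B3 s3 g'" "tz * pz * g' = g * (ty * py)"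
    unfolding g'_def using phi_map[OF 3 phiD(1)[OF 2] c(2)] by simp_all
  have "((B1, s1), f', (B2, s2), g', (B3, s3)) \<in> nses E"
    using Phi_exact[OF Phi_sesI[OF P(2) refl Q(2) refl R(2) refl fg(1,2) f' g']] ses by blast
  hence "((B1, s1), f', (B2, s2), g', (B3, s3)) \<in> pair_ses E K"
    using P Q R by (simp add: pair_ses_def seqs_in_def)
  moreover have "f' * j1 = j2 * f"
  proof -
    have "tx * (px * (s1 * j1)) = Idt E U" "tx * (px * j1) = 0" using d1(7,9) by (simp_all add: mult.assoc)
    thus ?thesis unfolding f'_def using dd_id(2)[OF fg(1)] by (simp add: distrib_right mult.assoc)
  qed
  ultimately show thesis using that 1 2 3 f'(1) g' by blast
qed

text \<open>The functor \<open>\<Phi>\<close> takes \<open>Y[-1] \<rightarrow> \<Psi>\<^sup>+\<Phi>(Y) \<rightarrow> Y\<close> to a split sequence, and it reflects admissibility.\<close>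

lemma counit_ses:
  assumes P: "is_Phi E Y Y0 s0 t0 q0 p0 (B, \<sigma>)" and ph: "phi (gone E) 0 Y B \<sigma> j (t0 * p0)"
    and s: "dd Y Y1 (gone E) s 0" "dd Y1 Y (- gone E) t 0" "t * s = Idt E Y" "s * t = Idt E Y1"
  shows "(Y1, j * t, B, t0 * p0, Y) \<in> ses E"
proof -
  define p where "p = t0 * p0"
  note d = phiD[OF ph[folded p_def]]
  have ob: "Y1 \<in> Ob E" "B \<in> Ob E" using s d dd_ob by blast+
  obtain B1 s1 X1 sx tx qx px where P1: "(B1, s1) \<in> K" "is_Phi E Y1 X1 sx tx qx px (B1, s1)"
    using PhiE ob by metis
  obtain B2 s2 X2 sy ty qy py where P2: "(B2, s2) \<in> K" "is_Phi E B X2 sy ty qy py (B2, s2)"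
    using PhiE ob by metis
  define p1 where "p1 = tx * px"
  define p2 where "p2 = ty * py"
  obtain j1 where 1: "phi (gone E) 0 Y1 B1 s1 j1 p1" using is_Phi_phi[OF P1(2)] p1_def by metis
  obtain j2 where 2: "phi (gone E) 0 B B2 s2 j2 p2" using is_Phi_phi[OF P2(2)] p2_def by metis
  note d1 = phiD[OF 1] note d2 = phiD[OF 2]
  note ids = d(2-4)[THEN dd_id(1)] d(2-4)[THEN dd_id(2)] d(2-4)[THEN dd_id(3)] d(2-4)[THEN dd_id(4)]
    d1(2-4)[THEN dd_id(1)] d1(2-4)[THEN dd_id(2)] d1(2-4)[THEN dd_id(3)] d1(2-4)[THEN dd_id(4)]
    d2(2-4)[THEN dd_id(1)] d2(2-4)[THEN dd_id(2)] d2(2-4)[THEN dd_id(3)] d2(2-4)[THEN dd_id(4)]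
    s(1,2)[THEN dd_id(1)] s(1,2)[THEN dd_id(2)] s(1,2)[THEN dd_id(3)] s(1,2)[THEN dd_id(4)]
  have st: "s * (t * h) = Idt E Y1 * h" "t * (s * h) = Idt E Y * h" for h using s(3,4) by (metis mult.assoc)+
  have jt: "dd Y1 B 0 (j * t) 0" using dd_closed_comp[OF d(3) s(2)] by simp
  have c1: "dd B1 B 0 (j * t * p1) 0" using dd_closed_comp[OF jt d1(4)] by simp
  have c2: "dd B2 Y 0 (p * p2) 0" using dd_closed_comp[OF d(4) d2(4)] by simp
  have c3: "dd B B 0 (Idt E B) 0" using dd_idt ob by blast
  \<comment> \<open>Both \<open>p * (\<sigma> * p2)\<close> and \<open>p * (p2 * s2)\<close> have
    differential \<open>p * p2\<close>, so their difference is closed. Shifted to \<open>Y1\<close>,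
    it corresponds by adjunction to the retraction \<open>r\<close> of \<open>f'\<close>.\<close>
  have "dd B2 Y (- gone E) (p * (\<sigma> * p2) - p * (p2 * s2)) 0"
    using dd_diff[OF dd_comp0[OF d(4) dd_compm0[OF d(2) d2(4)]] dd_comp0[OF d(4) dd_comp0[OF d2(4) d2(2)]]]
    by (simp add: ids)
  hence c4: "dd B2 Y1 0 (s * (p * (\<sigma> * p2) - p * (p2 * s2))) 0"
    using dd_closed_comp[OF s(1), of B2 "- gone E" _ 0] by simp
  define f' where "f' = j2 * (j * t * p1) * s1 + s2 * j2 * (j * t * p1)"
  define g' where "g' = j * (p * p2) * s2 + \<sigma> * j * (p * p2)"
  \<comment> \<open>\<open>S\<close> is the unit of the adjunction at \<open>(B, \<sigma>)\<close>
    and \<open>g'\<close> is Phi of \<open>p\<close>; that \<open>g' * S\<close> is the identity is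
    a triangle identity. The equations below are checked after composition with the projections
    \<open>p\<close>, \<open>p1\<close> and \<open>p2\<close>, which suffices by
    \<open>phi_map_unique\<close>.\<close>
  define S where "S = j2 * Idt E B * \<sigma> + s2 * j2 * Idt E B"
  define r where "r = j1 * (s * (p * (\<sigma> * p2) - p * (p2 * s2))) * s2 + s1 * j1 * (s * (p * (\<sigma> * p2) - p * (p2 * s2)))"
  have f': "nat_hom B1 s1 B2 s2 f'" "p2 * f' = j * t * p1" unfolding f'_def using phi_map[OF 2 d1(1) c1] .
  have g': "nat_hom B2 s2 B \<sigma> g'" "p * g' = p * p2" unfolding g'_def using phi_map[OF ph[folded p_def] d2(1) c2] .
  have S: "nat_hom B \<sigma> B2 s2 S" "p2 * S = Idt E B" unfolding S_def using phi_map[OF 2 d(1) c3] .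
  have r: "nat_hom B2 s2 B1 s1 r" "p1 * r = s * (p * (\<sigma> * p2) - p * (p2 * s2))"
    unfolding r_def using phi_map[OF 1 d2(1) c4] .
  have id: "nat_hom X x X x (Idt E X)" if "nat_ob X x" for X x
    using that dd_idt dd_ob dd_id unfolding nat_ob_def nat_hom_def by metis
  have comp: "nat_hom X x Z z (b * a)" if "nat_hom X x Y y a" "nat_hom Y y Z z b" for X x Y y Z z a b
    using that dd_closed_comp[of Y Z 0 b X 0 a 0] unfolding nat_hom_def by (metis add_0 mult.assoc)
  have zero: "nat_hom X x Y y 0" if "nat_ob X x" "nat_ob Y y" for X x Y y
    using that dd_zero[of X Y] dd_ob unfolding nat_ob_def nat_hom_def by (metis mult_zero_left mult_zero_right)
  have add: "nat_hom X x Y y (a + b)" if "nat_hom X x Y y a" "nat_hom X x Y y b" for X x Y y a b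
    using that dd_add[of X Y 0 a 0 b 0] by (simp add: nat_hom_def algebra_simps)
  have p2': "p2 * (f' * h) = j * t * p1 * h" "p * (g' * h) = p * p2 * h" "p2 * (S * h) = Idt E B * h"
     "p1 * (r * h) = s * (p * (\<sigma> * p2) - p * (p2 * s2)) * h" for h
    using f'(2) g'(2) S(2) r(2) by (metis mult.assoc)+
  have com: "s2 * f' = f' * s1" "s2 * S = S * \<sigma>" using f' S by (auto simp: nat_hom_def)
  have gS: "g' * S = Idt E B"
    by (rule phi_map_unique[OF ph[folded p_def] comp[OF S(1) g'(1)] id[OF d(1)]])
      (use S(2) in \<open>simp add: p2' mult.assoc ids\<close>)
  have rf: "r * f' = Idt E B1"
    by (rule phi_map_unique[OF 1 comp[OF f'(1) r(1)] id[OF d1(1)]])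
      (simp add: p2' f'(2) com algebra_simps d ids st)
  have gf: "g' * f' = 0"
    by (rule phi_map_unique[OF ph[folded p_def] comp[OF f'(1) g'(1)] zero[OF d1(1) d(1)]])
      (simp add: p2' f'(2) mult.assoc d)
  have rS: "r * S = 0"
    by (rule phi_map_unique[OF 1 comp[OF S(1) r(1)] zero[OF d(1) d1(1)]])
      (simp add: p2' S(2) com algebra_simps ids)
  have "dd B2 B 0 g' 0" using g' by (simp add: nat_hom_def)
  hence "p2 * (f' * r + S * g') = j * (t * (p1 * r)) + g'" by (simp add: p2' distrib_left mult.assoc dd_id)
  also have "\<dots> = j * (p * (\<sigma> * p2)) - j * (p * (p2 * s2)) + g'"
    unfolding r(2) by (simp add: algebra_simps ids st)
  also have "\<dots> = p2" unfolding g'_def by (simp add: algebra_simps d ids)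
  finally have p2sum: "p2 * (f' * r + S * g') = p2 * Idt E B2" by (simp add: ids)
  have sum: "f' * r + S * g' = Idt E B2"
    by (rule phi_map_unique[OF 2 add[OF comp[OF r(1) f'(1)] comp[OF g'(1) S(1)]] id[OF d2(1)] p2sum])
  have "((B1, s1), f', (B2, s2), g', (B, \<sigma>)) \<in> nses E"
  proof (rule exact_category.split_ses[OF nat_exact])
    show "(B1, s1) \<in> obj (Z0 (natural_dg E))" "(B2, s2) \<in> obj (Z0 (natural_dg E))" "(B, \<sigma>) \<in> obj (Z0 (natural_dg E))"
      using d(1) d1(1) d2(1) by (simp_all add: Z0_def nat_ob_iff)
    show "f' \<in> mor (Z0 (natural_dg E)) (B1, s1) (B2, s2)" "S \<in> mor (Z0 (natural_dg E)) (B, \<sigma>) (B2, s2)"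
      "r \<in> mor (Z0 (natural_dg E)) (B2, s2) (B1, s1)" "g' \<in> mor (Z0 (natural_dg E)) (B2, s2) (B, \<sigma>)"
      using f' g' S r d(1) d1(1) d2(1) by (simp_all add: nat_hom_iff)
  qed (use rf gS gf rS sum in \<open>simp_all add: Z0_def natural_dg_def\<close>)
  moreover have "Phi_seq E (Y1, j * t, B, p, Y) ((B1, s1), f', (B2, s2), g', (B, \<sigma>))"
    by (rule Phi_sesI[OF P1(2) p1_def P2(2) p2_def P p_def jt d(4) f' g'])
  ultimately show ?thesis using Phi_exact p_def by blast
qed

end

subsection \<open>Short exact sequences and nonclosed morphisms\<close>

context dg_pair
begin

lemma shiftOb:
  assumes "X \<in> Ob E"
  obtains X' s t where "X' \<in> Ob E" "dd X X' (- i) s 0" "dd X' X i t 0" "t * s = Idt E X" "s * t = Idt E X'"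
    "is_shift E X i X' s t"
  using shiftE[OF subset_refl has_shifts assms] by metis

lemma shifted_phiE:
  assumes X: "X \<in> Ob E"
  obtains B \<sigma> j p where "phi 0 (gone E) X B \<sigma> j p"
proof -
  obtain X1 s t where X1: "X1 \<in> Ob E" and s: "dd X X1 (- gone E) s 0" "dd X1 X (gone E) t 0" "t * s = Idt E X" "s * t = Idt E X1"
    using shiftOb[OF X] by metis
  obtain B \<sigma> j p where ph: "phi (gone E) 0 X1 B \<sigma> j p" using phiE[OF X1] by metis
  show thesis using phi_shift[OF ph s] that by blast
qed

text \<open>Morphisms from \<open>Z\<close> of degree \<open>n\<close>, closed or not, amount to closed morphisms of degree \<open>0\<close> from the
  object underlying \<open>\<Phi>\<close> of a shift of \<open>Z\<close>.\<close>

lemma closed_from: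
  assumes Z: "Z \<in> Ob E"
  obtains B a b e e' where "dd Z B n e e'"
    "\<And>U y y'. dd Z U n y y' \<Longrightarrow> dd B U 0 (y' * a + y * b) 0 \<and> (y' * a + y * b) * e = y"
proof -
  obtain Z1 s t where Z1: "Z1 \<in> Ob E" and s: "dd Z Z1 n s 0" "dd Z1 Z (- n) t 0" "t * s = Idt E Z"
    using shiftOb[OF Z, of "- n"] by (metis add.inverse_inverse)
  obtain B \<sigma> j p where ph: "phi (gone E) 0 Z1 B \<sigma> j p" using phiE[OF Z1] by metis
  note d = phiD[OF ph]
  have "dd Z1 B 0 (\<sigma> * j) j" using dd_compm1[OF d(2,3)] by (simp add: dd_id[OF d(3)])
  from dd_comp0[OF this s(1)] have e: "dd Z B n (\<sigma> * j * s) (j * s)" by simp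
  have "dd B U 0 (y' * (t * (p * \<sigma>)) + y * (t * p)) 0 \<and> (y' * (t * (p * \<sigma>)) + y * (t * p)) * (\<sigma> * j * s) = y"
    if y: "dd Z U n y y'" for U y y'
  proof
    have yt: "dd Z1 U 0 (y * t) (y' * t)" using dd_comp[OF y s(2), of 0] by (simp add: ksign_zero)
    have "dd B U (- gone E) (y * t * (p * \<sigma>)) (y' * t * (p * \<sigma>) + y * t * p)"
      using dd_comp0[OF yt dd_comp0[OF d(4,2)]] by (simp add: dd_id[OF d(4)] algebra_simps)
    thus "dd B U 0 (y' * (t * (p * \<sigma>)) + y * (t * p)) 0" using dd_deriv by (force simp: mult.assoc)
    show "(y' * (t * (p * \<sigma>)) + y * (t * p)) * (\<sigma> * j * s) = y"
      by (simp add: algebra_simps d s(3) dd_id[OF s(1)] dd_id[OF y])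
  qed
  thus thesis using that[OF e] by blast
qed

lemma closed_to:
  assumes Z: "Z \<in> Ob E"
  obtains B a b e e' where "dd B Z n e e'"
    "\<And>V y y'. dd V Z n y y' \<Longrightarrow> dd V B 0 (a * y' + b * y) 0 \<and> e * (a * y' + b * y) = y"
proof -
  obtain Z1 s t where Z1: "Z1 \<in> Ob E" and s: "dd Z Z1 (- n) s 0" "dd Z1 Z n t 0" "t * s = Idt E Z"
    using shiftOb[OF Z, of n] by metis
  \<comment> \<open>With the shifted form of Phi, \<open>p * \<sigma>\<close> has degree 0, so that
    \<open>t * (p * \<sigma>)\<close> has the desired degree \<open>n\<close>.\<close>
  obtain B \<sigma> j p where ph: "phi 0 (gone E) Z1 B \<sigma> j p" using shifted_phiE[OF Z1] by metis
  note d = phiD[OF ph]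
  have "dd B Z1 0 (p * \<sigma>) (- p)" using dd_comp1m[OF d(4,2)] by (simp add: dd_id[OF d(4)])
  from dd_comp[OF s(2) this, of n] obtain e' where e: "dd B Z n (t * (p * \<sigma>)) e'" by auto
  \<comment> \<open>This carries the sign that the Leibniz rule for \<open>s * y\<close> puts in
    front of the differential of \<open>y\<close>.\<close>
  define s' where "s' = ksign E (- n) s"
  have "dd V B 0 (- (\<sigma> * (j * s')) * y' + j * s * y) 0 \<and> t * (p * \<sigma>) * (- (\<sigma> * (j * s')) * y' + j * s * y) = y"
    if y: "dd V Z n y y'" for V y y'
  proof
    have z: "dd V Z1 0 (s * y) (s' * y')" using dd_comp[OF s(1) y, of 0] by (auto simp: s'_def ksign_def split: if_splits)
    have "dd V B (- gone E) (\<sigma> * (j * (s * y))) (j * (s * y) - \<sigma> * (j * (s' * y')))"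
      using dd_compm0[OF d(2) dd_comp0[OF d(3) z]] by (simp add: dd_id[OF d(3)] algebra_simps)
    from dd_deriv[OF this, of 0] show "dd V B 0 (- (\<sigma> * (j * s')) * y' + j * s * y) 0" by (simp add: mult.assoc)
    show "t * (p * \<sigma>) * (- (\<sigma> * (j * s')) * y' + j * s * y) = y"
      using dd_id(1)[OF z] dd_id(1)[OF y] s(3) by (simp add: algebra_simps d) (metis mult.assoc)
  qed
  thus thesis using that[OF e] by blast
qed

lemma comp_zero_deriv:
  "dd V W 0 g 0 \<Longrightarrow> dd Z V n y y' \<Longrightarrow> g * y = 0 \<Longrightarrow> g * (y' * h) = 0 \<and> g * (y * h) = 0"
  "dd W V 0 g 0 \<Longrightarrow> dd V Z n y y' \<Longrightarrow> y * g = 0 \<Longrightarrow> h * y' * g = 0 \<and> h * y * g = 0"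
proof -
  assume g: "dd V W 0 g 0" and y: "dd Z V n y y'" "g * y = 0"
  have "g * y' = 0" using dd_unique[OF dd_comp0[OF g y(1)]] dd_zero dd_ob y g by force
  thus "g * (y' * h) = 0 \<and> g * (y * h) = 0" using y(2) by (metis mult.assoc mult_zero_left)
next
  assume g: "dd W V 0 g 0" and y: "dd V Z n y y'" "y * g = 0"
  have "dd W Z n (y * g) (y' * g)" using dd_comp[OF y(1) g, of n] by (simp add: ksign_zero)
  hence "y' * g = 0" using dd_unique dd_zero dd_ob y(2) by metis
  thus "h * y' * g = 0 \<and> h * y * g = 0" using y(2) by (simp add: mult.assoc)
qed

lemma Z0_mor: "f \<in> mor (Z0 E) X Y \<and> X \<in> Ob E \<and> Y \<in> Ob E \<longleftrightarrow> dd X Y 0 f 0"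
  by (auto simp: Z0_def dd_Cyc)

text \<open>The exact structure speaks only of closed morphisms of degree 0.
  \<open>closed_from\<close> encodes \<open>y\<close> and its differential in one such morphism on
  \<open>B\<close>. It is killed by \<open>g\<close>, because \<open>g\<close> kills
  \<open>y\<close> and hence its differential; composing its lift with \<open>e\<close> gives a lift
  of \<open>y\<close>.\<close>

lemma ses_lift:
  assumes ses: "(U, f, V, g, W) \<in> ses E" and y: "dd Z V n y y'" and gy: "g * y = 0"
  obtains x x' where "dd Z U n x x'" "f * x = y"
proof -
  note fg = ses_dd[OF ses]
  obtain B a b e e' where e: "dd Z B n e e'"
    and U: "\<And>U y y'. dd Z U n y y' \<Longrightarrow> dd B U 0 (y' * a + y * b) 0 \<and> (y' * a + y * b) * e = y"
    using closed_from y dd_ob by metis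
  have "g * (y' * a + y * b) = 0" using comp_zero_deriv(1)[OF fg(2) y gy] by (simp add: distrib_left)
  moreover have "B \<in> obj (Z0 E)" "y' * a + y * b \<in> mor (Z0 E) B V"
    using U[OF y] Z0_mor dd_ob[OF e] by (auto simp: Z0_def)
  ultimately obtain c where c: "c \<in> mor (Z0 E) B U" "f * c = y' * a + y * b"
    using exact_category.ses_kernel[OF exact ses] unfolding is_kernel_def by metis
  hence "dd B U 0 c 0" using Z0_mor dd_ob[OF e] dd_ob[OF fg(1)] by blast
  from dd_comp0[OF this e] show thesis using that c(2) U[OF y] by (metis mult.assoc)
qed

lemma ses_mono:
  assumes ses: "(U, f, V, g, W) \<in> ses E" and x: "dd Z U n x x'" and fx: "f * x = 0"
  shows "x = 0"
proof -
  note fg = ses_dd[OF ses]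
  obtain B a b e e' where e: "dd Z B n e e'"
    and U: "\<And>U y y'. dd Z U n y y' \<Longrightarrow> dd B U 0 (y' * a + y * b) 0 \<and> (y' * a + y * b) * e = y"
    using closed_from x dd_ob by metis
  have "f * (x' * a + x * b) = 0" using comp_zero_deriv(1)[OF fg(1) x fx] by (simp add: distrib_left)
  moreover have "x' * a + x * b \<in> mor (Z0 E) B U" "0 \<in> mor (Z0 E) B U" "0 \<in> mor (Z0 E) B V" "B \<in> obj (Z0 E)"
    using U[OF x] dd_zero[of B U 0] dd_zero[of B V 0] dd_ob[OF e] dd_ob[OF fg(1)] by (auto simp: Z0_def dd_Cyc)
  ultimately have "x' * a + x * b = 0"
    using exact_category.ses_kernel[OF exact ses] unfolding is_kernel_def by (metis mult_zero_right)
  thus ?thesis using U[OF x] by simp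
qed

lemma ses_extend:
  assumes ses: "(U, f, V, g, W) \<in> ses E" and y: "dd V Z n y y'" and yf: "y * f = 0"
  obtains x x' where "dd W Z n x x'" "x * g = y"
proof -
  note fg = ses_dd[OF ses]
  obtain B a b e e' where e: "dd B Z n e e'"
    and U: "\<And>V y y'. dd V Z n y y' \<Longrightarrow> dd V B 0 (a * y' + b * y) 0 \<and> e * (a * y' + b * y) = y"
    using closed_to y dd_ob by metis
  have "(a * y' + b * y) * f = 0" using comp_zero_deriv(2)[OF fg(1) y yf] by (simp add: distrib_right)
  moreover have "B \<in> obj (Z0 E)" "a * y' + b * y \<in> mor (Z0 E) V B"
    using U[OF y] Z0_mor dd_ob[OF e] by (auto simp: Z0_def)
  ultimately obtain c where c: "c \<in> mor (Z0 E) W B" "c * g = a * y' + b * y"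
    using exact_category.ses_cokernel[OF exact ses] unfolding is_cokernel_def by metis
  hence "dd W B 0 c 0" using Z0_mor dd_ob[OF e] dd_ob[OF fg(2)] by blast
  from dd_comp[OF e this, of n] show thesis using that c(2) U[OF y] by (metis add_0 mult.assoc)
qed

lemma ses_epi:
  assumes ses: "(U, f, V, g, W) \<in> ses E" and x: "dd W Z n x x'" and xg: "x * g = 0"
  shows "x = 0"
proof -
  note fg = ses_dd[OF ses]
  obtain B a b e e' where e: "dd B Z n e e'"
    and U: "\<And>V y y'. dd V Z n y y' \<Longrightarrow> dd V B 0 (a * y' + b * y) 0 \<and> e * (a * y' + b * y) = y"
    using closed_to x dd_ob by metis
  have "(a * x' + b * x) * g = 0" using comp_zero_deriv(2)[OF fg(2) x xg] by (simp add: distrib_right)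
  moreover have "a * x' + b * x \<in> mor (Z0 E) W B" "0 \<in> mor (Z0 E) W B" "0 \<in> mor (Z0 E) V B" "B \<in> obj (Z0 E)"
    using U[OF x] dd_zero[of W B 0] dd_zero[of V B 0] dd_ob[OF e] dd_ob[OF fg(2)] by (auto simp: Z0_def dd_Cyc)
  ultimately have "a * x' + b * x = 0"
    using exact_category.ses_cokernel[OF exact ses] unfolding is_cokernel_def by (metis mult_zero_left)
  thus ?thesis using U[OF x] by simp
qed

subsection \<open>Null-homotopic morphisms from and to totalizations\<close>

text \<open>A morphism to the totalization of \<open>U \<rightarrow> V \<rightarrow> W\<close> is null-homotopic as soon as its component in \<open>W\<close> lifts to
  a possibly nonclosed morphism to \<open>V\<close>.\<close>

lemma null_to_totalization:
  assumes ses: "(U, f, V, g, W) \<in> ses E" and c: "cone U f V C q p j i" and T: "cone C (g * q) W T q' p' j' i'"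
    and h: "dd Y T 0 h 0" and v1: "dd Y V 0 v1 v1'" and e: "q' * h = g * v1"
  shows "h \<in> Bd Y T 0"
proof -
  note fg = ses_dd[OF ses]
  note d = cone_dd[OF c] note eq = cone_eqs[OF c] note d' = cone_dd[OF T] note eq' = cone_eqs[OF T]
  have ph: "dd Y C (gone E) (p' * h) 0" using dd_comp10[OF d'(3) h] by simp
  have v: "dd Y V (gone E) (q * (p' * h)) (- (f * (p * (p' * h))))"
    using dd_comp0[OF d(2) ph] by (simp add: mult.assoc)
  have w: "dd Y W 0 (g * v1) (- (g * (q * (p' * h))))" using dd_comp0[OF d'(2) h] e by (simp add: mult.assoc)
  have gv1: "g * v1' = - (g * (q * (p' * h)))" using dd_unique[OF _ w] dd_comp0[OF fg(2) v1] by simp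
  have v1c: "dd Y V (gone E) v1' 0" using dd_deriv[OF v1] by simp
  have z: "dd Y V (gone E) (- (q * (p' * h)) - v1') (f * (p * (p' * h)))"
    using dd_diff[OF dd_minus[OF v] v1c] by simp
  \<comment> \<open>The map \<open>j * v1 + i * u\<close> to \<open>C\<close> should have
    differential \<open>- (p' * h)\<close>. This dictates \<open>f * u\<close>, and then
    \<open>u'\<close> because \<open>f\<close> can be cancelled.\<close>
  obtain u u' where u: "dd Y U (gone E) u u'" "f * u = - (q * (p' * h)) - v1'"
    using ses_lift[OF ses z] gv1 by (metis diff_self mult_minus_right right_diff_distrib)
  have "f * u' = f * (p * (p' * h))" using dd_comp0[OF fg(1) u(1)] z dd_unique unfolding u(2) by fastforce
  hence fu: "f * (u' - p * (p' * h)) = 0" by (simp add: algebra_simps)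
  have pph: "dd Y U (gone E + gone E) (p * (p' * h)) 0" using dd_closed_comp[OF d(3) ph] by simp
  have "u' = p * (p' * h)"
    using ses_mono[OF ses dd_diff[OF dd_deriv[OF u(1) refl] pph] fu] by simp
  have x: "dd Y C 0 (j * v1 + i * u) (j * v1' + (j * (f * u) - i * u'))"
    using dd_add[OF dd_comp0[OF d(4) v1] dd_compm1[OF d(5) u(1)]] by (simp add: mult.assoc)
  have "dd Y T (- gone E) (i' * (j * v1 + i * u))
     (j' * (g * q) * (j * v1 + i * u) - i' * (j * v1' + (j * (f * u) - i * u')))"
    using dd_compm0[OF d'(5) x] .
  moreover have "j' * (g * q) * (j * v1 + i * u) = j' * (q' * h)"
    by (simp add: algebra_simps eq e dd_id[OF v1])
  moreover have "j * v1' + (j * (f * u) - i * u') = - (p' * h)"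
    unfolding u(2) \<open>u' = _\<close> by (simp add: algebra_simps eq dd_id[OF ph])
  ultimately have "dd Y T (- gone E) (i' * (j * v1 + i * u)) h" by (simp add: eq' dd_id[OF h])
  thus ?thesis using BdI by fastforce
qed

text \<open>The dual criterion, in which the component of \<open>h\<close> on \<open>U\<close> must
  extend to \<open>V\<close>. The degree is \<open>gone E\<close> because it will be applied to a
  composite of a map of degree two with the injection \<open>i2\<close> of another cone, which has
  degree minus one.\<close>

lemma null_from_totalization:
  assumes ses: "(U, f, V, g, W) \<in> ses E" and c: "cone U f V C q p j i" and T: "cone C (g * q) W T q' p' j' i'"
    and h: "dd T Y (gone E) h 0" and v1: "dd V Y (- gone E) v1 v1'" and e: "h * (i' * i) = v1 * f"
  shows "h \<in> Bd T Y (gone E)"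
proof -
  note fg = ses_dd[OF ses]
  note d = cone_dd[OF c] note eq = cone_eqs[OF c] note d' = cone_dd[OF T] note eq' = cone_eqs[OF T]
  note ids = d[THEN dd_id(1)] d[THEN dd_id(2)] d'[THEN dd_id(1)] d'[THEN dd_id(2)]
    d[THEN dd_id(3)] d[THEN dd_id(4)] d'[THEN dd_id(3)] d'[THEN dd_id(4)]
  have ii: "dd U T (- gone E - gone E) (i' * i) (- (i' * (j * f)))"
    using dd_compm[OF d'(5) d(5) refl] by (simp add: mult.assoc eq)
  have ij: "dd V T (- gone E) (i' * j) (j' * g)"
    using dd_compm0[OF d'(5) d(4)] by (simp add: mult.assoc eq dd_id[OF fg(2)])
  have 1: "dd U Y (- gone E) (h * (i' * i)) (h * (i' * (j * f)))" using dd_comp1[OF h ii] by simp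
  have 2: "dd U Y (- gone E) (v1 * f) (v1' * f)" using dd_compm0[OF v1 fg(1)] by simp
  have "v1' * f = h * (i' * (j * f))" using dd_unique[OF 1 2[folded e]] by simp
  hence yf: "(v1' - h * (i' * j)) * f = 0" by (simp add: algebra_simps)
  have y: "dd V Y 0 (v1' - h * (i' * j)) (h * (j' * g))"
    using dd_diff[OF dd_deriv[OF v1, of 0] dd_comp1m[OF h ij]] by simp
  \<comment> \<open>The contracting homotopy will be zero on \<open>U\<close>, \<open>v1\<close> on
    \<open>V\<close> and \<open>w\<close> on \<open>W\<close>.\<close>
  obtain w w' where w: "dd W Y 0 w w'" "w * g = v1' - h * (i' * j)" using ses_extend[OF ses y yf] by metis
  have hj: "dd W Y (gone E) (h * j') 0" using dd_comp10[OF h d'(4)] by simp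
  have "w' * g = h * (j' * g)" using dd_comp0[OF w(1) fg(2)] y dd_unique unfolding w(2) by fastforce
  hence "(w' - h * j') * g = 0" by (simp add: algebra_simps)
  hence w': "w' = h * j'" using ses_epi[OF ses dd_diff[OF dd_deriv[OF w(1), of "gone E"] hj]] by simp
  have qp: "dd T V (gone E) (q * p') (- (f * (p * p')))" using dd_comp0[OF d(2) d'(3)] by (simp add: mult.assoc)
  have "dd T Y 0 (v1 * (q * p') + w * q') (v1' * (q * p') + v1 * (f * (p * p')) + (w' * q' - w * (g * (q * p'))))"
    using dd_add[OF dd_compm1[OF v1 qp] dd_comp0[OF w(1) d'(2)]] by (simp add: mult.assoc)
  moreover have "v1' * (q * p') + v1 * (f * (p * p')) + (w' * q' - w * (g * (q * p'))) = h"
  proof -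
    have "w * (g * (q * p')) = (v1' - h * (i' * j)) * (q * p')" using w(2) by (metis mult.assoc)
    moreover have "v1 * (f * (p * p')) = h * (i' * i) * (p * p')" using e by (metis mult.assoc)
    ultimately have "v1' * (q * p') + v1 * (f * (p * p')) + (w' * q' - w * (g * (q * p')))
      = h * (j' * q' + i' * ((j * q + i * p) * p'))" unfolding w' by (simp only: distrib_left distrib_right mult.assoc left_diff_distrib right_diff_distrib) (simp add: algebra_simps)
    also have "\<dots> = h" using c T dd_id(2)[OF h] dd_id(1)[OF d'(3)] by (simp add: cone_def)
    finally show ?thesis .
  qed
  ultimately show ?thesis using BdI by fastforce
qed

end

subsection \<open>Exact DG-subpairs\<close>

locale dg_subpair = dg_pair E K for E :: "('g::ab_group_add, 'o, 'm::ring) exact_dgcat" and K +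
  fixes F :: "'o set" and L :: "('o \<times> 'm) set"
  assumes subpair: "exact_dg_subpair E K F L"
begin

lemma F_sub: "F \<subseteq> Ob E" and F_shifts: "closed_under_shifts E F" and F_cones: "closed_under_cones E F"
  and F_exact: "exact_category ((Z0 E)\<lparr>obj := F\<rparr>) (seqs_in F (ses E))"
  and F_additive: "additive_category (Z0 (dg_sub E F))"
  and L_sub: "L \<subseteq> K"
  using subpair by (simp_all add: exact_dg_subpair_def inherits_exact_dg_def inherits_exact_def)

lemma L_F: "(X, t) \<in> L \<Longrightarrow> X \<in> F"
  using subpair by (auto simp: exact_dg_subpair_def natural_dg_def dg_sub_def)

lemma LK: "(X, t) \<in> L \<Longrightarrow> (X, t) \<in> K"
  using L_sub by blast

lemma L_ses:
  assumes s: "((X, a), f, (Y, b), g, (Z, c)) \<in> pair_ses E K" and L: "(X, a) \<in> L" "(Y, b) \<in> L" "(Z, c) \<in> L"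
  shows "(X, f, Y, g, Z) \<in> seqs_in F (ses E)"
proof -
  have n: "((X, a), f, (Y, b), g, (Z, c)) \<in> nses E" using s by (simp add: pair_ses_def seqs_in_def)
  have "(X, a) \<in> Ob (natural_dg E)" "(Y, b) \<in> Ob (natural_dg E)" "(Z, c) \<in> Ob (natural_dg E)"
    using L LK K_nat nat_ob_iff by blast+
  moreover have "f \<in> mor (Z0 (natural_dg E)) (X, a) (Y, b)" "g \<in> mor (Z0 (natural_dg E)) (Y, b) (Z, c)"
    using exact_category.ses_kernel[OF nat_exact n] by (simp_all add: is_kernel_def)
  ultimately have "(X, f, Y, g, Z) \<in> ses E" using Psi_exact n by blast
  thus ?thesis using L L_F by (auto simp: seqs_in_def)
qed

lemma pair_ses_hom:
  assumes "((X, a), f, (Y, b), g, (Z, c)) \<in> pair_ses E K"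
  shows "(X, a) \<in> K" "(Y, b) \<in> K" "(Z, c) \<in> K" "nat_hom X a Y b f" "nat_hom Y b Z c g"
proof -
  show K: "(X, a) \<in> K" "(Y, b) \<in> K" "(Z, c) \<in> K" using assms by (auto simp: pair_ses_def seqs_in_def)
  show "nat_hom X a Y b f" "nat_hom Y b Z c g"
    using exact_category.ses_kernel[OF pair_exact assms] K by (auto simp: is_kernel_def pair_mor)
qed

lemma pair_cat_obj: "obj (pair_cat E K) = K"
  by (simp add: pair_cat_def)

text \<open>The lifting property yields an admissible epimorphism from an object of
  \<open>L\<close>, but its kernel is only isomorphic to an object of \<open>L\<close>. Replacing
  the kernel puts all three terms into \<open>L\<close>, and Psi^+ then gives a short exact sequence
  in \<open>Z0\<close> of \<open>F\<close>.\<close>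

lemma resolving_epi:
  assumes res: "self_resolving (pair_cat E K) (pair_ses E K) L"
    and B: "(B, \<sigma>) \<in> L" and e: "adm_epi (pair_ses E K) (Q, \<kappa>) p (B, \<sigma>)"
  obtains X \<tau> h e R r where "(X, \<tau>) \<in> L" "(R, r, X, e, B) \<in> seqs_in F (ses E)" "nat_hom X \<tau> B \<sigma> e"
    "nat_hom X \<tau> Q \<kappa> h" "p * h = e"
proof -
  have Q: "(Q, \<kappa>) \<in> K" using e by (auto simp: adm_epi_def pair_ses_def seqs_in_def)
  obtain P e' h where P: "P \<in> L" and ae: "adm_epi (pair_ses E K) P e' (B, \<sigma>)"
      and h: "h \<in> mor (pair_cat E K) P (Q, \<kappa>)" "p * h = e'"
    using res B e Q unfolding self_resolving_def pair_cat_obj by blast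
  obtain X \<tau> where X: "P = (X, \<tau>)" by fastforce
  obtain P0 i where s: "(P0, i, (X, \<tau>), e', (B, \<sigma>)) \<in> pair_ses E K" using ae X by (auto simp: adm_epi_def)
  obtain P1 a where P1: "P1 \<in> L" "iso_mor (pair_cat E K) P0 a P1"
    using res s P X B unfolding self_resolving_def by blast
  obtain b where b: "b \<in> mor (pair_cat E K) P1 P0" "b * a = idm (pair_cat E K) P0" "a * b = idm (pair_cat E K) P1"
      and P0: "P0 \<in> K" "P1 \<in> K" using P1(2) by (auto simp: iso_mor_def pair_cat_obj)
  interpret p: exact_category "pair_cat E K" "pair_ses E K" by (rule pair_exact)
  have XB: "(X, \<tau>) \<in> K" "(B, \<sigma>) \<in> K" using P X B L_sub by auto
  have m: "i \<in> mor (pair_cat E K) P0 (X, \<tau>)" "e' \<in> mor (pair_cat E K) (X, \<tau>) (B, \<sigma>)"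
    using p.ses_kernel[OF s] by (auto simp: is_kernel_def)
  have ib: "i * b \<in> mor (pair_cat E K) P1 (X, \<tau>)"
    using p.comp_mor b(1) m(1) P0 XB by (simp add: pair_cat_obj)
  have "i * b * a = i" using b(2) p.idm_right m(1) P0 XB by (simp add: mult.assoc pair_cat_obj)
  hence "(P1, i * b, (X, \<tau>), e', (B, \<sigma>)) \<in> pair_ses E K"
    using p.ses_iso[OF s P1(2) p.iso_idm p.iso_idm ib m(2)] XB m P0
    by (simp add: pair_cat_obj p.idm_left p.idm_right)
  hence "(fst P1, i * b, X, e', B) \<in> seqs_in F (ses E)"
    using L_ses[of "fst P1" "snd P1"] P P1(1) X B by simp
  thus thesis using that P X h m(2) XB Q by (simp add: pair_mor)
qed

lemma coresolving_mono:
  assumes res: "self_coresolving (pair_cat E K) (pair_ses E K) L"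
    and B: "(B, \<sigma>) \<in> L" and e: "adm_mono (pair_ses E K) (B, \<sigma>) i (Q, \<kappa>)"
  obtains X \<tau> h e R r where "(X, \<tau>) \<in> L" "(B, e, X, r, R) \<in> seqs_in F (ses E)" "nat_hom B \<sigma> X \<tau> e"
    "nat_hom Q \<kappa> X \<tau> h" "h * i = e"
proof -
  have Q: "(Q, \<kappa>) \<in> K" using e by (auto simp: adm_mono_def pair_ses_def seqs_in_def)
  obtain P e' h where P: "P \<in> L" and ae: "adm_mono (pair_ses E K) (B, \<sigma>) e' P"
      and h: "h \<in> mor (pair_cat E K) (Q, \<kappa>) P" "h * i = e'"
    using res B e Q unfolding self_coresolving_def pair_cat_obj by blast
  obtain X \<tau> where X: "P = (X, \<tau>)" by fastforce
  obtain P0 p where s: "((B, \<sigma>), e', (X, \<tau>), p, P0) \<in> pair_ses E K" using ae X by (auto simp: adm_mono_def)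
  obtain P1 a where P1: "P1 \<in> L" "iso_mor (pair_cat E K) P0 a P1"
    using res s P X B unfolding self_coresolving_def by blast
  have a: "a \<in> mor (pair_cat E K) P0 P1" and P0: "P0 \<in> K" "P1 \<in> K"
    using P1(2) by (auto simp: iso_mor_def pair_cat_obj)
  interpret p: exact_category "pair_cat E K" "pair_ses E K" by (rule pair_exact)
  have XB: "(X, \<tau>) \<in> K" "(B, \<sigma>) \<in> K" using P X B L_sub by auto
  have m: "p \<in> mor (pair_cat E K) (X, \<tau>) P0" "e' \<in> mor (pair_cat E K) (B, \<sigma>) (X, \<tau>)"
    using p.ses_kernel[OF s] by (auto simp: is_kernel_def)
  have ap: "a * p \<in> mor (pair_cat E K) (X, \<tau>) P1"
    using p.comp_mor a m(1) P0 XB by (simp add: pair_cat_obj)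
  have "((B, \<sigma>), e', (X, \<tau>), a * p, P1) \<in> pair_ses E K"
    using p.ses_iso[OF s p.iso_idm p.iso_idm P1(2) m(2) ap] XB m ap P0
    by (simp add: pair_cat_obj p.idm_left p.idm_right)
  hence "(B, e', X, a * p, fst P1) \<in> seqs_in F (ses E)"
    using L_ses[of B \<sigma> e' X \<tau> "a * p" "fst P1" "snd P1"] P P1(1) X B by simp
  thus thesis using that P X h m(2) XB Q by (simp add: pair_mor)
qed

text \<open>\<open>Phi(Y)\<close> is taken in \<open>L\<close>, so the middle term of the sequence
  \<open>Y[-1] -> B -> Y\<close> lies in \<open>F\<close>. The choice of \<open>Y[-1]\<close> is
  left open because in one application it is a prescribed object.\<close>

lemma F_PhiE:
  assumes Y: "Y \<in> F"
  obtains B \<sigma> j p where "(B, \<sigma>) \<in> L" "phi (gone E) 0 Y B \<sigma> j p"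
    "\<And>Y1 s t. \<lbrakk>Y1 \<in> F; dd Y Y1 (gone E) s 0; dd Y1 Y (- gone E) t 0; t * s = Idt E Y; s * t = Idt E Y1\<rbrakk>
      \<Longrightarrow> (Y1, j * t, B, p, Y) \<in> seqs_in F (ses E)"
proof -
  obtain B \<sigma> where B: "(B, \<sigma>) \<in> L" "Phi_rep E Y (B, \<sigma>)"
    using subpair Y unfolding exact_dg_subpair_def by (metis surj_pair)
  then obtain Y0 s0 t0 q0 p0 where P: "is_Phi E Y Y0 s0 t0 q0 p0 (B, \<sigma>)" by (auto simp: Phi_rep_def)
  obtain j where j: "phi (gone E) 0 Y B \<sigma> j (t0 * p0)" using is_Phi_phi[OF P] by metis
  show thesis using that[OF B(1) j] counit_ses[OF P j] L_F[OF B(1)] Y by (simp add: seqs_in_def)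
qed

lemma resolving_lift:
  assumes res: "self_resolving (pair_cat E K) (pair_ses E K) L"
    and ses: "(U, f, V, g, W) \<in> ses E" and Y: "Y \<in> F"
    and w: "dd Y W 0 w (- (g * v))" and v: "dd Y V (gone E) v v'"
  obtains R r X a v1 v1' where "(R, r, X, a, Y) \<in> seqs_in F (ses E)" "dd X V 0 v1 v1'" "w * a = g * v1"
proof -
  obtain B1 s1 j1 p1 B2 s2 j2 p2 B3 s3 j3 p3 f' g' where
    ph: "phi (gone E) 0 U B1 s1 j1 p1" "phi (gone E) 0 V B2 s2 j2 p2" "phi (gone E) 0 W B3 s3 j3 p3"
    and n: "((B1, s1), f', (B2, s2), g', (B3, s3)) \<in> pair_ses E K"
    and h: "nat_hom B1 s1 B2 s2 f'" "nat_hom B2 s2 B3 s3 g'" "p3 * g' = g * p2"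
    using ses_Phi[OF ses] by metis
  obtain B \<sigma> j p where B: "(B, \<sigma>) \<in> L" and ph0: "phi (gone E) 0 Y B \<sigma> j p"
    and counit: "\<And>Y1 s t. \<lbrakk>Y1 \<in> F; dd Y Y1 (gone E) s 0; dd Y1 Y (- gone E) t 0; t * s = Idt E Y; s * t = Idt E Y1\<rbrakk>
      \<Longrightarrow> (Y1, j * t, B, p, Y) \<in> seqs_in F (ses E)"
    using F_PhiE[OF Y] by metis
  obtain Y1 s t where "Y1 \<in> F" "dd Y Y1 (gone E) s 0" "dd Y1 Y (- gone E) t 0" "t * s = Idt E Y" "s * t = Idt E Y1"
    using shiftE[OF F_sub F_shifts Y, of "- gone E"] by (metis add.inverse_inverse)
  hence counit: "(Y1, j * t, B, p, Y) \<in> seqs_in F (ses E)" using counit by blast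
  note d = phiD[OF ph0]
  have dw: "dd B W (- gone E) (w * (p * \<sigma>)) (- (g * v) * (p * \<sigma>) + w * p)"
    using dd_comp0[OF w dd_comp0[OF d(4) d(2)]] by (simp add: dd_id[OF d(4)])
  \<comment> \<open>This is the differential of \<open>w * (p * \<sigma>)\<close>, hence closed
    although \<open>w\<close> need not be. It differs from \<open>w * p\<close> by a map that
    factors through \<open>g\<close>.\<close>
  define c where "c = - (g * v) * (p * \<sigma>) + w * p"
  have c: "dd B W 0 c 0" unfolding c_def using dd_deriv[OF dw] by simp
  define \<phi> where "\<phi> = j3 * c * \<sigma> + s3 * j3 * c"
  have \<phi>: "nat_hom B \<sigma> B3 s3 \<phi>" "p3 * \<phi> = c" unfolding \<phi>_def using phi_map[OF ph(3) d(1) c] .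
  have K: "(B2, s2) \<in> K" "(B3, s3) \<in> K" "(B, \<sigma>) \<in> K" using pair_ses_hom[OF n] LK[OF B] by blast+
  have "adm_epi (pair_ses E K) (B2, s2) g' (B3, s3)" using n by (auto simp: adm_epi_def)
  then obtain x p' P where pb: "is_pullback (pair_cat E K) (B2, s2) g' (B3, s3) \<phi> (B, \<sigma>) x p' P"
      and ep: "adm_epi (pair_ses E K) P p' (B, \<sigma>)"
    using exact_category.pullback_epi[OF pair_exact] K \<phi>(1) by (metis pair_cat_obj pair_mor)
  obtain Q \<kappa> where P: "P = (Q, \<kappa>)" by fastforce
  have Q: "(Q, \<kappa>) \<in> K" using pb P by (simp add: is_pullback_def pair_cat_obj)
  have x: "nat_hom Q \<kappa> B2 s2 x" "g' * x = \<phi> * p'"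
    using pb Q K by (auto simp: is_pullback_def P pair_mor)
  obtain X \<tau> h' e R r where X: "(X, \<tau>) \<in> L" "(R, r, X, e, B) \<in> seqs_in F (ses E)" "nat_hom X \<tau> B \<sigma> e"
      "nat_hom X \<tau> Q \<kappa> h'" "p' * h' = e"
    using resolving_epi[OF res B ep[unfolded P]] by metis
  have e: "dd X B 0 e 0" using X(3) by (simp add: nat_hom_def)
  have xh: "dd X B2 0 (x * h') 0" using dd_comp0[of Q B2 x 0 X 0 h' 0] x(1) X(4) by (simp add: nat_hom_def)
  have "g * (p2 * (x * h')) = c * e"
    using h(3) x(2) X(5) \<phi>(2) by (metis mult.assoc)
  hence key: "w * (p * e) = g * (p2 * (x * h') + v * (p * (\<sigma> * e)))" by (simp add: c_def algebra_simps)
  have v1: "dd X V 0 (p2 * (x * h') + v * (p * (\<sigma> * e))) (0 + (v' * (p * (\<sigma> * e)) - v * (p * e)))"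
    using dd_add[OF dd_closed_comp[OF phiD(4)[OF ph(2)] xh, of 0] dd_comp1m[OF v dd_comp0[OF d(4) dd_compm0[OF d(2) e]]]]
    by (simp add: dd_id[OF e])
  have "adm_epi (seqs_in F (ses E)) X e B" "adm_epi (seqs_in F (ses E)) B p Y"
    using X(2) counit by (auto simp: adm_epi_def)
  hence "adm_epi (seqs_in F (ses E)) X (p * e) Y" using exact_category.comp_epi[OF F_exact] by blast
  thus thesis using that v1 key by (auto simp: adm_epi_def)
qed

text \<open>Dual to \<open>resolving_lift\<close>, with \<open>Y\<close> embedded into
  \<open>Phi(Y[1])\<close> instead of covered by \<open>Phi(Y)\<close>. The sequence is shifted by
  [1] first, because the argument needs closed maps of degree 0 from \<open>U\<close> and
  \<open>V\<close> to values of Phi, and these values are \<open>Phi(U[1])\<close> and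
  \<open>Phi(V[1])\<close>.\<close>

lemma coresolving_extend:
  assumes res: "self_coresolving (pair_cat E K) (pair_ses E K) L"
    and ses: "(U, f, V, g, W) \<in> ses E" and Y: "Y \<in> F"
    and u: "dd U Y 0 u (v * f)" and v: "dd V Y (gone E) v v'"
  obtains R r X a v1 v1' where "(Y, a, X, r, R) \<in> seqs_in F (ses E)" "dd V X 0 v1 v1'" "a * u = v1 * f"
proof -
  note fg = ses_dd[OF ses]
  have ob: "U \<in> Ob E" "V \<in> Ob E" "W \<in> Ob E" using fg dd_ob by blast+
  obtain U' sU tU where U': "dd U U' (- gone E) sU 0" "dd U' U (gone E) tU 0" "tU * sU = Idt E U" "sU * tU = Idt E U'"
      "is_shift E U (gone E) U' sU tU" using shiftOb[OF ob(1)] by metis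
  obtain V' sV tV where V': "dd V V' (- gone E) sV 0" "dd V' V (gone E) tV 0" "tV * sV = Idt E V" "sV * tV = Idt E V'"
      "is_shift E V (gone E) V' sV tV" using shiftOb[OF ob(2)] by metis
  obtain W' sW tW where W': "is_shift E W (gone E) W' sW tW" using shiftOb[OF ob(3)] by metis
  have "shift_seq E (gone E) (U, f, V, g, W) (U', sV * f * tU, V', sW * g * tV, W')"
    unfolding shift_seq.simps using U'(5) V'(5) W' by blast
  hence "(U', sV * f * tU, V', sW * g * tV, W') \<in> ses E"
    using ses_shift ses unfolding ses_shift_invariant_def by blast
  then obtain B1 s1 j1 p1 B2 s2 j2 p2 B3 s3 f' g' where
    ph: "phi (gone E) 0 U' B1 s1 j1 p1" "phi (gone E) 0 V' B2 s2 j2 p2"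
    and n: "((B1, s1), f', (B2, s2), g', (B3, s3)) \<in> pair_ses E K"
    and h: "nat_hom B1 s1 B2 s2 f'" "f' * j1 = j2 * (sV * f * tU)"
    using ses_Phi by metis
  have ph1: "phi 0 (gone E) U B1 s1 (j1 * sU) (tU * p1)" using phi_shift[OF ph(1) U'(1-4)] .
  have ph2: "phi 0 (gone E) V B2 s2 (j2 * sV) (tV * p2)" using phi_shift[OF ph(2) V'(1-4)] .
  have fj: "f' * (j1 * sU) = j2 * sV * f"
    using h(2) U'(3) dd_id(2)[OF fg(1)] by (metis mult.assoc)
  obtain Y2 s t where Y2: "Y2 \<in> F" and s: "dd Y Y2 (- gone E) s 0" "dd Y2 Y (gone E) t 0" "t * s = Idt E Y" "s * t = Idt E Y2"
    using shiftE[OF F_sub F_shifts Y, of "gone E"] by metis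
  obtain B \<sigma> j p where B: "(B, \<sigma>) \<in> L" and ph0: "phi (gone E) 0 Y2 B \<sigma> j p"
    and counit: "\<And>Y1 s t. \<lbrakk>Y1 \<in> F; dd Y2 Y1 (gone E) s 0; dd Y1 Y2 (- gone E) t 0; t * s = Idt E Y2; s * t = Idt E Y1\<rbrakk>
      \<Longrightarrow> (Y1, j * t, B, p, Y2) \<in> seqs_in F (ses E)"
    using F_PhiE[OF Y2] by metis
  \<comment> \<open>The sequence for \<open>Y2 = Y[1]\<close>, with \<open>Y\<close> itself serving
    as the shift back.\<close>
  have counit: "(Y, j * s, B, p, Y2) \<in> seqs_in F (ses E)" using counit[OF Y s(2,1,4,3)] .
  have ph': "phi 0 (gone E) Y B \<sigma> (j * s) (t * p)" using phi_shift[OF ph0 s] .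
  define a0 where "a0 = j * s"
  note d = phiD[OF ph'[folded a0_def]]
  have du: "dd U B (- gone E) (\<sigma> * (a0 * u)) (a0 * u - \<sigma> * (a0 * (v * f)))"
    using dd_compm0[OF d(2) dd_comp0[OF d(3) u]] by (simp add: dd_id[OF d(3)])
  define c where "c = a0 * u - \<sigma> * (a0 * (v * f))"
  have c: "dd U B 0 c 0" unfolding c_def using dd_deriv[OF du] by simp
  define \<phi> where "\<phi> = c * (tU * p1) * s1 + \<sigma> * c * (tU * p1)"
  have \<phi>: "nat_hom B1 s1 B \<sigma> \<phi>" "\<phi> * (j1 * sU) = c" unfolding \<phi>_def using phi_comap[OF ph1 d(1) c] .
  have K: "(B1, s1) \<in> K" "(B2, s2) \<in> K" "(B, \<sigma>) \<in> K" using pair_ses_hom[OF n] LK[OF B] by blast+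
  have "adm_mono (pair_ses E K) (B1, s1) f' (B2, s2)" using n by (auto simp: adm_mono_def)
  then obtain x i' P where po: "is_pushout (pair_cat E K) (B1, s1) f' (B2, s2) \<phi> (B, \<sigma>) x i' P"
      and mo: "adm_mono (pair_ses E K) (B, \<sigma>) i' P"
    using exact_category.pushout_mono[OF pair_exact] K \<phi>(1) by (metis pair_cat_obj pair_mor)
  obtain Q \<kappa> where P: "P = (Q, \<kappa>)" by fastforce
  have Q: "(Q, \<kappa>) \<in> K" using po P by (simp add: is_pushout_def pair_cat_obj)
  have x: "nat_hom B2 s2 Q \<kappa> x" "x * f' = i' * \<phi>"
    using po Q K by (auto simp: is_pushout_def P pair_mor)
  obtain X \<tau> h' e R r where X: "(X, \<tau>) \<in> L" "(B, e, X, r, R) \<in> seqs_in F (ses E)" "nat_hom B \<sigma> X \<tau> e"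
      "nat_hom Q \<kappa> X \<tau> h'" "h' * i' = e"
    using coresolving_mono[OF res B mo[unfolded P]] by metis
  have e: "dd B X 0 e 0" using X(3) by (simp add: nat_hom_def)
  have hx: "dd B2 X 0 (h' * x) 0" using dd_comp0[of Q X h' 0 B2 0 x 0] x(1) X(4) by (simp add: nat_hom_def)
  have "h' * x * (j2 * sV) * f = e * c"
    using fj x(2) X(5) \<phi>(2) by (metis mult.assoc)
  hence key: "e * a0 * u = (h' * x * (j2 * sV) + e * (\<sigma> * (a0 * v))) * f" by (simp add: c_def algebra_simps)
  have "dd V X 0 (e * (\<sigma> * (a0 * v))) (e * (a0 * v - \<sigma> * (a0 * v')))"
    using dd_comp0[OF e dd_compm1[OF d(2) dd_comp0[OF d(3) v]]] by (simp add: dd_id[OF d(3)])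
  hence v1: "dd V X 0 (h' * x * (j2 * sV) + e * (\<sigma> * (a0 * v))) (0 + e * (a0 * v - \<sigma> * (a0 * v')))"
    using dd_add[OF dd_closed_comp[OF hx phiD(3)[OF ph2], of 0]] by simp
  have "adm_mono (seqs_in F (ses E)) Y a0 B" "adm_mono (seqs_in F (ses E)) B e X"
    using X(2) counit a0_def by (auto simp: adm_mono_def)
  hence "adm_mono (seqs_in F (ses E)) Y (e * a0) X" using exact_category.comp_mono[OF F_exact] by blast
  thus thesis using that v1 key by (auto simp: adm_mono_def)
qed

end

subsection \<open>Totalizations and factorization\<close>

locale dg_subpair_acyclic = dg_subpair E K F L + rel_triangulated E F N
  for E :: "('g::ab_group_add, 'o, 'm::ring) exact_dgcat" and K F L N +
  assumes totalization_N: "\<lbrakk>(R, r, X, a, Y) \<in> seqs_in F (ses E); cone R r X C q p j i; cone C (a * q) Y T q' p' j' i';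
      C \<in> F; T \<in> F\<rbrakk> \<Longrightarrow> T \<in> N"
begin

lemma seqs_in_F:
  assumes "(R, r, X, a, Y) \<in> seqs_in F (ses E)"
  shows "R \<in> F" "X \<in> F" "Y \<in> F" "(R, r, X, a, Y) \<in> ses E"
  using assms by (auto simp: seqs_in_def)

lemma totalization_factor_from:
  assumes res: "self_resolving (pair_cat E K) (pair_ses E K) L"
    and ses: "(U, f, V, g, W) \<in> ses E" and c: "cone U f V C q p j i" and T: "cone C (g * q) W T q' p' j' i'"
  shows "T \<in> factor_from"
proof -
  note d = cone_dd[OF c] note d' = cone_dd[OF T]
  have "null_morphism Y T h" if Y: "Y \<in> F" and h: "dd Y T 0 h 0" for Y h
  proof -
    have w: "dd Y W 0 (q' * h) (- (g * (q * (p' * h))))" using dd_comp0[OF d'(2) h] by (simp add: mult.assoc)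
    have ph: "dd Y C (gone E) (p' * h) 0" using dd_comp10[OF d'(3) h] by simp
    have v: "dd Y V (gone E) (q * (p' * h)) (- (f * p) * (p' * h) + q * 0)" by (rule dd_comp0[OF d(2) ph])
    obtain R r X a v1 v1' where s: "(R, r, X, a, Y) \<in> seqs_in F (ses E)" and v1: "dd X V 0 v1 v1'" "q' * h * a = g * v1"
      using resolving_lift[OF res ses Y w v] by metis
    note F = seqs_in_F[OF s] note ra = ses_dd[OF F(4)]
    obtain C1 q1 p1 j1 i1 where C1: "C1 \<in> F" "cone R r X C1 q1 p1 j1 i1" using coneE[OF F_cones F(1,2) ra(1)] by metis
    note d1 = cone_dd[OF C1(2)]
    have aq: "dd C1 Y 0 (a * q1) 0"
      using dd_comp0[OF ra(2) d1(2)] ra(3) by (simp add: mult.assoc[symmetric])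
    obtain T1 q2 p2 j2 i2 where T1: "T1 \<in> F" "cone C1 (a * q1) Y T1 q2 p2 j2 i2" using coneE[OF F_cones C1(1) Y aq] by metis
    have "qis C1 Y (a * q1)" unfolding qis_def using C1(1) Y T1(2) totalization_N[OF s C1(2) T1(2) C1(1) T1(1)] by blast
    moreover have "h * (a * q1) \<in> Bd C1 T 0"
    proof (rule null_to_totalization[OF ses c T])
      show "dd C1 T 0 (h * (a * q1)) 0" using dd_closed_comp[OF h aq] by simp
      show "dd C1 V 0 (v1 * q1) (v1' * q1 + v1 * - (r * p1))" by (rule dd_comp0[OF v1(1) d1(2)])
      show "q' * (h * (a * q1)) = g * (v1 * q1)" using v1(2) by (metis mult.assoc)
    qed
    ultimately show ?thesis using killed_right_null h by blast
  qed
  thus ?thesis using dd_ob[OF d'(4)] by (simp add: factor_from_def)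
qed

text \<open>The totalization of \<open>Y \<rightarrow> X \<rightarrow> R\<close> can also be built as the cone of \<open>Y[1] \<rightarrow> cone(r)\<close>.\<close>

lemma cototalization_N:
  assumes s: "(Y, a, X, r, R) \<in> seqs_in F (ses E)" and c2: "cone X r R C2 q2 p2 j2 i2"
    and t: "dd Y Y1 (- gone E) s' 0" "dd Y1 Y (gone E) t' 0" "t' * s' = Idt E Y" "s' * t' = Idt E Y1"
    and T: "cone Y1 (i2 * (a * t')) C2 T q4 p4 j4 i4" and F: "T \<in> F"
  shows "T \<in> N"
proof -
  note F' = seqs_in_F[OF s] note ra = ses_dd[OF F'(4)]
  have rh: "r * (a * h) = 0" for h using ra(3) by (metis mult.assoc mult_zero_left)
  have ts: "t' * (s' * h) = Idt E Y * h" "s' * (t' * h) = Idt E Y1 * h" for h using t(3,4) by (metis mult.assoc)+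
  obtain C1 q1 p1 j1 i1 where C1: "C1 \<in> F" "cone Y a X C1 q1 p1 j1 i1" using coneE[OF F_cones F'(1,2) ra(1)] by metis
  note d1 = cone_dd[OF C1(2)] note e1 = cone_eqs[OF C1(2)]
  note d2 = cone_dd[OF c2] note e2 = cone_eqs[OF c2]
  note d4 = cone_dd[OF T] note e4 = cone_eqs[OF T]
  note ids = d1[THEN dd_id(1)] d1[THEN dd_id(2)] d1[THEN dd_id(3)] d1[THEN dd_id(4)]
    d2[THEN dd_id(1)] d2[THEN dd_id(2)] d2[THEN dd_id(3)] d2[THEN dd_id(4)]
    d4[THEN dd_id(1)] d4[THEN dd_id(2)] d4[THEN dd_id(3)] d4[THEN dd_id(4)]
    t(1,2)[THEN dd_id(1)] t(1,2)[THEN dd_id(2)] t(1,2)[THEN dd_id(3)] t(1,2)[THEN dd_id(4)]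
  have rq: "dd C1 R 0 (r * q1) 0" using dd_comp0[OF ra(2) d1(2)] by (simp add: rh)
  \<comment> \<open>Both constructions have the underlying graded object
    \<open>R + X[1] + Y[2]\<close>. The structure maps regroup the three summands, with a sign on
    \<open>Y[2]\<close>.\<close>
  have "cone C1 (r * q1) R T (q2 * q4) (j1 * (p2 * q4) - i1 * (t' * p4)) (j4 * j2) (j4 * (i2 * q1) - i4 * (s' * p1))"
    unfolding cone_def
  proof (intro conjI)
    show "dd C1 R 0 (r * q1) 0" by (fact rq)
    show "dd T R 0 (q2 * q4) (- (r * q1 * (j1 * (p2 * q4) - i1 * (t' * p4))))"
      using dd_comp0[OF d2(2) d4(2)] by (simp add: e1 e2 ids algebra_simps)
    have tp: "dd T Y (gone E + gone E) (t' * p4) 0" using dd_closed_comp[OF t(2) d4(3)] by simp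
    have itp: "dd T C1 (gone E) (i1 * (t' * p4)) (j1 * (a * (t' * p4)))"
      using dd_compm[OF d1(5) tp, of "gone E"] by (simp add: mult.assoc)
    show "dd T C1 (gone E) (j1 * (p2 * q4) - i1 * (t' * p4)) 0"
      using dd_diff[OF dd_comp0[OF d1(4) dd_comp10[OF d2(3) d4(2)]] itp] by (simp add: e2 ids algebra_simps)
    show "dd R T 0 (j4 * j2) 0" using dd_closed_comp[OF d4(4) d2(4)] by simp
    have sp: "dd C1 Y1 0 (s' * p1) 0" using dd_closed_comp[OF t(1) d1(3)] by simp
    show "dd C1 T (- gone E) (j4 * (i2 * q1) - i4 * (s' * p1)) (j4 * j2 * (r * q1))"
      using dd_diff[OF dd_comp0[OF d4(4) dd_compm0[OF d2(5) d1(2)]] dd_compm0[OF d4(5) sp]]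
      by (simp add: ts ids algebra_simps)
  qed (simp_all add: e1 e2 e4 ts ids algebra_simps)
  thus ?thesis using totalization_N[OF s C1(2) _ C1(1) F] by blast
qed

lemma totalization_factor_to:
  assumes res: "self_coresolving (pair_cat E K) (pair_ses E K) L"
    and ses: "(U, f, V, g, W) \<in> ses E" and c: "cone U f V C q p j i" and T: "cone C (g * q) W T q' p' j' i'"
  shows "T \<in> factor_to"
proof -
  note d = cone_dd[OF c] note d' = cone_dd[OF T] note e = cone_eqs[OF c]
  have "null_morphism T Y h" if Y: "Y \<in> F" and h: "dd T Y 0 h 0" for Y h
  proof -
    \<comment> \<open>The injection \<open>i' * i\<close> of \<open>U\<close> into \<open>T\<close>
      has degree minus two. With \<open>Y3 = Y[-2]\<close> the component on \<open>U\<close> has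
      degree 0, as \<open>coresolving_extend\<close> requires.\<close>
    obtain Y3 s t where Y3: "Y3 \<in> F" and s: "dd Y Y3 (gone E + gone E) s 0" "dd Y3 Y (- (gone E + gone E)) t 0"
        "t * s = Idt E Y"
      using shiftE[OF F_sub F_shifts Y, of "- (gone E + gone E)"] by (metis add.inverse_inverse)
    have sh: "dd T Y3 (gone E + gone E) (s * h) 0" using dd_closed_comp[OF s(1) h] by simp
    have ii: "dd U T (- gone E - gone E) (i' * i) (- (i' * (j * f)))"
      using dd_compm[OF d'(5) d(5) refl] by (simp add: mult.assoc e)
    have ij: "dd V T (- gone E) (i' * j) (j' * g)"
      using dd_compm0[OF d'(5) d(4)] ses_dd[OF ses] by (simp add: mult.assoc e dd_id)
    have "sform E (gone E) (gone E + gone E) = sform E (gone E + gone E) (gone E)" by (rule sform_sym)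
    also have "\<dots> = 0" by (simp add: sform_add sform_gone)
    finally have k: "ksign E (gone E + gone E) x = x" for x by (simp add: ksign_def)
    have u: "dd U Y3 0 (s * h * (i' * i)) (- (s * h * (i' * j)) * f)"
      using dd_comp[OF sh ii, of 0] by (simp add: k mult.assoc)
    have v: "dd V Y3 (gone E) (- (s * h * (i' * j))) (- (s * h * (j' * g)))"
      using dd_minus[OF dd_comp[OF sh ij, of "gone E"]] by (simp add: k mult.assoc)
    obtain R r X a v1 v1' where ar: "(Y3, a, X, r, R) \<in> seqs_in F (ses E)" and v1: "dd V X 0 v1 v1'"
        "a * (s * h * (i' * i)) = v1 * f"
      using coresolving_extend[OF res ses Y3 u v] by metis
    note F = seqs_in_F[OF ar] note ra = ses_dd[OF F(4)]
    obtain C2 q2 p2 j2 i2 where C2: "C2 \<in> F" "cone X r R C2 q2 p2 j2 i2" using coneE[OF F_cones F(2,3) ra(2)] by metis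
    note d2 = cone_dd[OF C2(2)]
    obtain Y1 s' t' where Y1: "Y1 \<in> F" and s': "dd Y3 Y1 (- gone E) s' 0" "dd Y1 Y3 (gone E) t' 0" "t' * s' = Idt E Y3" "s' * t' = Idt E Y1"
      using shiftE[OF F_sub F_shifts Y3, of "gone E"] by metis
    have ia: "dd Y3 C2 (- gone E) (i2 * a) 0"
      using dd_compm0[OF d2(5) ra(1)] ra(3) by (simp add: mult.assoc)
    have iat: "dd Y1 C2 0 (i2 * (a * t')) 0" using dd_closed_comp[OF ia s'(2), of 0] by (simp add: mult.assoc)
    obtain T3 q4 p4 j4 i4 where T3: "T3 \<in> F" "cone Y1 (i2 * (a * t')) C2 T3 q4 p4 j4 i4"
      using coneE[OF F_cones Y1 C2(1) iat] by metis
    have N: "T3 \<in> N" using cototalization_N[OF ar C2(2) s' T3(2,1)] .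
    have iash: "dd T C2 (gone E) (i2 * a * (s * h)) 0" using dd_closed_comp[OF ia sh, of "gone E"] by simp
    have "i2 * a * (s * h) \<in> Bd T C2 (gone E)"
    proof (rule null_from_totalization[OF ses c T iash])
      show "dd V C2 (- gone E) (i2 * v1) (j2 * r * v1 - i2 * v1')" by (rule dd_compm0[OF d2(5) v1(1)])
      show "i2 * a * (s * h) * (i' * i) = i2 * v1 * f" using v1(2) by (simp add: mult.assoc)
    qed
    moreover have "i2 * (a * t') * (s' * (s * h)) = i2 * a * (s * h)" using s'(3) dd_id(1)[OF sh] by (metis mult.assoc)
    moreover have ssh: "dd T Y1 (gone E) (s' * (s * h)) 0" using dd_closed_comp[OF s'(1) sh] by simp
    \<comment> \<open>The shifted \<open>h\<close> is killed up to homotopy by the map whose cone is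
      \<open>T3\<close>, so it factors strictly through the connecting map \<open>p4\<close> and
      thereby through an object of \<open>N\<close>.\<close>
    ultimately obtain b where b: "dd T T3 0 b 0" "s' * (s * h) = p4 * b"
      using cone_exact_X[OF T3(2) ssh, of 0] by auto
    have "h = t * t' * p4 * b"
      using s(3) s'(3) b(2) dd_id(1)[OF h] dd_id(1)[OF sh] by (metis mult.assoc)
    moreover have "dd Y1 Y (- gone E) (t * t') 0" using dd_closed_comp[OF s(2) s'(2)] by simp
    hence "dd T3 Y 0 (t * t' * p4) 0" using dd_closed_comp[OF _ cone_dd(3)[OF T3(2)], of Y "- gone E" "t * t'" 0] by simp
    ultimately show ?thesis unfolding null_morphism_def
      using N b(1) Bd_zero dd_ob[OF h] by (metis diff_self)
  qed
  thus ?thesis using dd_ob[OF d'(4)] by (simp add: factor_to_def)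
qed

end

section \<open>Acyclic objects\<close>

context full_dg_subcategory
begin

lemma sub_products:
  assumes "closed_under_products J A F" shows "closed_under_products J A' F"
  unfolding closed_under_products_def
proof (intro ballI)
  fix I X assume I: "I \<in> J" and X: "X \<in> I \<rightarrow> F"
  obtain P \<pi> where "P \<in> F" "is_product A I X P \<pi>" using assms I X unfolding closed_under_products_def by blast
  thus "\<exists>P\<in>F. \<exists>\<pi>. is_product A' I X P \<pi>" using sub_product X by blast
qed

lemma sub_coproducts:
  assumes "closed_under_coproducts J A F" shows "closed_under_coproducts J A' F"
  unfolding closed_under_coproducts_def
proof (intro ballI)
  fix I X assume I: "I \<in> J" and X: "X \<in> I \<rightarrow> F"
  obtain P \<pi> where "P \<in> F" "is_coproduct A I X P \<pi>" using assms I X unfolding closed_under_coproducts_def by blast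
  thus "\<exists>P\<in>F. \<exists>\<pi>. is_coproduct A' I X P \<pi>" using sub_coproduct X by blast
qed

text \<open>The products of one family chosen in \<open>F\<close> and in \<open>N\<close> are
  isomorphic, and \<open>N\<close> is closed under homotopy equivalence.\<close>

lemma products_restrict:
  assumes r: "rel_triangulated A (Ob A) N" and N: "closed_under_products J A N" and F: "closed_under_products J A F"
  shows "closed_under_products J A' (N \<inter> F)"
  unfolding closed_under_products_def
proof (intro ballI)
  fix I X assume I: "I \<in> J" and X: "X \<in> I \<rightarrow> N \<inter> F"
  have X': "X \<in> I \<rightarrow> N" "X \<in> I \<rightarrow> F" using X by auto
  obtain P \<pi> where P: "P \<in> F" "is_product A I X P \<pi>" using F I X' unfolding closed_under_products_def by blast
  obtain Q \<rho> where Q: "Q \<in> N" "is_product A I X Q \<rho>" using N I X' unfolding closed_under_products_def by blast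
  have "P \<in> N" using rel_triangulated.N_iso[OF r Q(1) _ product_hiso[OF Q(2) P(2)]] P F_sub by blast
  thus "\<exists>P\<in>N \<inter> F. \<exists>\<pi>. is_product A' I X P \<pi>" using sub_product[OF P(2) X'(2) P(1)] P by blast
qed

lemma coproducts_restrict:
  assumes r: "rel_triangulated A (Ob A) N" and N: "closed_under_coproducts J A N" and F: "closed_under_coproducts J A F"
  shows "closed_under_coproducts J A' (N \<inter> F)"
  unfolding closed_under_coproducts_def
proof (intro ballI)
  fix I X assume I: "I \<in> J" and X: "X \<in> I \<rightarrow> N \<inter> F"
  have X': "X \<in> I \<rightarrow> N" "X \<in> I \<rightarrow> F" using X by auto
  obtain P \<pi> where P: "P \<in> F" "is_coproduct A I X P \<pi>" using F I X' unfolding closed_under_coproducts_def by blast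
  obtain Q \<rho> where Q: "Q \<in> N" "is_coproduct A I X Q \<rho>" using N I X' unfolding closed_under_coproducts_def by blast
  have "P \<in> N" using rel_triangulated.N_iso[OF r Q(1) _ coproduct_hiso[OF Q(2) P(2)]] P F_sub by blast
  thus "\<exists>P\<in>N \<inter> F. \<exists>\<pi>. is_coproduct A' I X P \<pi>" using sub_coproduct[OF P(2) X'(2) P(1)] P by blast
qed

lemma products_Inter:
  assumes t: "\<And>N. N \<in> \<N> \<Longrightarrow> triangulated_sub A' N \<and> closed_under_products J A' N" and F: "F \<in> \<N>"
  shows "closed_under_products J A' (\<Inter>\<N>)"
  unfolding closed_under_products_def
proof (intro ballI)
  fix I X assume I: "I \<in> J" and X: "X \<in> I \<rightarrow> \<Inter>\<N>"
  have X': "X \<in> I \<rightarrow> N" if "N \<in> \<N>" for N using X that by auto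
  obtain P \<pi> where P: "P \<in> F" "is_product A' I X P \<pi>"
    using t[OF F] I X'[OF F] unfolding closed_under_products_def by blast
  have "P \<in> N" if N: "N \<in> \<N>" for N
  proof -
    obtain Q \<rho> where Q: "Q \<in> N" "is_product A' I X Q \<rho>"
      using t[OF N] I X'[OF N] unfolding closed_under_products_def by blast
    have "hiso Q P" using sub.product_hiso[OF Q(2) P(2)] sub_hiso by blast
    moreover have "rel_triangulated A F N" using t[OF N] by (simp add: triangulated_sub_iff)
    ultimately show ?thesis using rel_triangulated.N_iso Q(1) P(1) by metis
  qed
  thus "\<exists>P\<in>\<Inter>\<N>. \<exists>\<pi>. is_product A' I X P \<pi>" using P by blast
qed

lemma coproducts_Inter:
  assumes t: "\<And>N. N \<in> \<N> \<Longrightarrow> triangulated_sub A' N \<and> closed_under_coproducts J A' N" and F: "F \<in> \<N>"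
  shows "closed_under_coproducts J A' (\<Inter>\<N>)"
  unfolding closed_under_coproducts_def
proof (intro ballI)
  fix I X assume I: "I \<in> J" and X: "X \<in> I \<rightarrow> \<Inter>\<N>"
  have X': "X \<in> I \<rightarrow> N" if "N \<in> \<N>" for N using X that by auto
  obtain P \<pi> where P: "P \<in> F" "is_coproduct A' I X P \<pi>"
    using t[OF F] I X'[OF F] unfolding closed_under_coproducts_def by blast
  have "P \<in> N" if N: "N \<in> \<N>" for N
  proof -
    obtain Q \<rho> where Q: "Q \<in> N" "is_coproduct A' I X Q \<rho>"
      using t[OF N] I X'[OF N] unfolding closed_under_coproducts_def by blast
    have "hiso Q P" using sub.coproduct_hiso[OF Q(2) P(2)] sub_hiso by blast
    moreover have "rel_triangulated A F N" using t[OF N] by (simp add: triangulated_sub_iff)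
    ultimately show ?thesis using rel_triangulated.N_iso Q(1) P(1) by metis
  qed
  thus "\<exists>P\<in>\<Inter>\<N>. \<exists>\<pi>. is_coproduct A' I X P \<pi>" using P by blast
qed

text \<open>A factorization through \<open>N\<close> and a homotopy are chosen for every component.
  The intermediate objects have a product in \<open>N\<close>, and both the maps and the homotopies
  assemble, because the universal property of products covers all degrees and nonclosed
  morphisms.\<close>

lemma factor_from_products:
  assumes r: "rel_triangulated A F N" and A: "closed_under_products J A (Ob A)" and N: "closed_under_products J A' N"
  shows "closed_under_products J A (rel_triangulated.factor_from A F N)"
  unfolding closed_under_products_def
proof (intro ballI)
  interpret r: rel_triangulated A F N by fact
  fix I X assume I: "I \<in> J" and X: "X \<in> I \<rightarrow> r.factor_from"
  have "X \<in> I \<rightarrow> Ob A" using X by (auto simp: r.factor_from_def)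
  then obtain P \<pi> where P: "is_product A I X P \<pi>" using A I unfolding closed_under_products_def by blast
  note p = productD[OF P]
  have "r.null_morphism Y P f" if Y: "Y \<in> F" and f: "dd Y P 0 f 0" for Y f
  proof -
    have YA: "Y \<in> Ob A" using Y F_sub by blast
    have pf: "dd Y (X i) 0 (\<pi> i * f) 0" if "i \<in> I" for i using dd_closed_comp[OF p(3)[OF that] f] by simp
    hence "\<forall>i\<in>I. \<exists>Z a b h. Z \<in> N \<and> dd Y Z 0 a 0 \<and> dd Z (X i) 0 b 0 \<and> dd Y (X i) (- gone A) h (\<pi> i * f - b * a)"
      using X Y unfolding r.factor_from_def r.null_morphism_def Bd_def by fastforce
    then obtain Z a b h where Z: "\<And>i. i \<in> I \<Longrightarrow> Z i \<in> N" and a: "\<And>i. i \<in> I \<Longrightarrow> dd Y (Z i) 0 (a i) 0"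
        and b: "\<And>i. i \<in> I \<Longrightarrow> dd (Z i) (X i) 0 (b i) 0"
        and h: "\<And>i. i \<in> I \<Longrightarrow> dd Y (X i) (- gone A) (h i) (\<pi> i * f - b i * a i)"
      by metis
    have "Z \<in> I \<rightarrow> N" using Z by blast
    then obtain Q \<rho> where Q: "Q \<in> N" "is_product A' I Z Q \<rho>" using N I unfolding closed_under_products_def by blast
    have QA: "Q \<in> F" "Q \<in> Ob A" using Q r.N_sub F_sub by auto
    have \<rho>: "dd Q (Z i) 0 (\<rho> i) 0" if "i \<in> I" for i using sub.productD(3)[OF Q(2) that] sub_dd by blast
    have a': "sub.dd Y (Z i) 0 (a i) 0" if "i \<in> I" for i using a[OF that] Z[OF that] Y r.N_sub sub_dd by blast
    have Y': "Y \<in> Ob A'" using Y by (simp add: Ob')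
    obtain a0 where a0: "dd Y Q 0 a0 0" "\<And>i. i \<in> I \<Longrightarrow> \<rho> i * a0 = a i"
      using sub.product_map_closed[OF Q(2) Y' a'] sub_dd by metis
    have b\<rho>: "dd Q (X i) 0 (b i * \<rho> i) 0" if "i \<in> I" for i using dd_closed_comp[OF b[OF that] \<rho>[OF that]] by simp
    obtain b0 where b0: "dd Q P 0 b0 0" "\<And>i. i \<in> I \<Longrightarrow> \<pi> i * b0 = b i * \<rho> i"
      using product_map_closed[OF P QA(2) b\<rho>] by metis
    obtain h0 h1 where h0: "dd Y P (- gone A) h0 h1" "\<And>i. i \<in> I \<Longrightarrow> \<pi> i * h1 = \<pi> i * f - b i * a i"
      using product_map[OF P YA h] by metis
    have h1: "dd Y P 0 h1 0" using dd_deriv[OF h0(1)] by simp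
    have fb: "dd Y P 0 (f - b0 * a0) 0" using dd_diff[OF f dd_closed_comp[OF b0(1) a0(1), of 0]] by simp
    have "h1 = f - b0 * a0"
    proof (rule product_unique[OF P h1 fb])
      fix i assume i: "i \<in> I"
      have "\<pi> i * (b0 * a0) = b i * a i" using a0(2)[OF i] b0(2)[OF i] by (metis mult.assoc)
      thus "\<pi> i * h1 = \<pi> i * (f - b0 * a0)" using h0(2)[OF i] by (simp add: right_diff_distrib)
    qed
    hence "f - b0 * a0 \<in> Bd Y P 0" using BdI[OF h0(1)] by simp
    thus ?thesis unfolding r.null_morphism_def using Q(1) a0(1) b0(1) by blast
  qed
  hence "P \<in> r.factor_from" using p(1) by (simp add: r.factor_from_def)
  thus "\<exists>P\<in>r.factor_from. \<exists>\<pi>. is_product A I X P \<pi>" using P by blast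
qed

lemma factor_to_coproducts:
  assumes r: "rel_triangulated A F N" and A: "closed_under_coproducts J A (Ob A)" and N: "closed_under_coproducts J A' N"
  shows "closed_under_coproducts J A (rel_triangulated.factor_to A F N)"
  unfolding closed_under_coproducts_def
proof (intro ballI)
  interpret r: rel_triangulated A F N by fact
  fix I X assume I: "I \<in> J" and X: "X \<in> I \<rightarrow> r.factor_to"
  have "X \<in> I \<rightarrow> Ob A" using X by (auto simp: r.factor_to_def)
  then obtain P \<pi> where P: "is_coproduct A I X P \<pi>" using A I unfolding closed_under_coproducts_def by blast
  note p = coproductD[OF P]
  have "r.null_morphism P Y f" if Y: "Y \<in> F" and f: "dd P Y 0 f 0" for Y f
  proof -
    have YA: "Y \<in> Ob A" using Y F_sub by blast
    have pf: "dd (X i) Y 0 (f * \<pi> i) 0" if "i \<in> I" for i using dd_closed_comp[OF f p(3)[OF that]] by simp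
    hence "\<forall>i\<in>I. \<exists>Z a b h. Z \<in> N \<and> dd (X i) Z 0 a 0 \<and> dd Z Y 0 b 0 \<and> dd (X i) Y (- gone A) h (f * \<pi> i - b * a)"
      using X Y unfolding r.factor_to_def r.null_morphism_def Bd_def by fastforce
    then obtain Z a b h where Z: "\<And>i. i \<in> I \<Longrightarrow> Z i \<in> N" and a: "\<And>i. i \<in> I \<Longrightarrow> dd (X i) (Z i) 0 (a i) 0"
        and b: "\<And>i. i \<in> I \<Longrightarrow> dd (Z i) Y 0 (b i) 0"
        and h: "\<And>i. i \<in> I \<Longrightarrow> dd (X i) Y (- gone A) (h i) (f * \<pi> i - b i * a i)"
      by metis
    have "Z \<in> I \<rightarrow> N" using Z by blast
    then obtain Q \<rho> where Q: "Q \<in> N" "is_coproduct A' I Z Q \<rho>" using N I unfolding closed_under_coproducts_def by blast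
    have QA: "Q \<in> F" "Q \<in> Ob A" using Q r.N_sub F_sub by auto
    have \<rho>: "dd (Z i) Q 0 (\<rho> i) 0" if "i \<in> I" for i using sub.coproductD(3)[OF Q(2) that] sub_dd by blast
    have b': "sub.dd (Z i) Y 0 (b i) 0" if "i \<in> I" for i using b[OF that] Z[OF that] Y r.N_sub sub_dd by blast
    have Y': "Y \<in> Ob A'" using Y by (simp add: Ob')
    obtain b0 where b0: "dd Q Y 0 b0 0" "\<And>i. i \<in> I \<Longrightarrow> b0 * \<rho> i = b i"
      using sub.coproduct_map_closed[OF Q(2) Y' b'] sub_dd by metis
    have \<rho>a: "dd (X i) Q 0 (\<rho> i * a i) 0" if "i \<in> I" for i using dd_closed_comp[OF \<rho>[OF that] a[OF that]] by simp
    obtain a0 where a0: "dd P Q 0 a0 0" "\<And>i. i \<in> I \<Longrightarrow> a0 * \<pi> i = \<rho> i * a i"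
      using coproduct_map_closed[OF P QA(2) \<rho>a] by metis
    obtain h0 h1 where h0: "dd P Y (- gone A) h0 h1" "\<And>i. i \<in> I \<Longrightarrow> h1 * \<pi> i = f * \<pi> i - b i * a i"
      using coproduct_map[OF P YA h] by metis
    have h1: "dd P Y 0 h1 0" using dd_deriv[OF h0(1)] by simp
    have fb: "dd P Y 0 (f - b0 * a0) 0" using dd_diff[OF f dd_closed_comp[OF b0(1) a0(1), of 0]] by simp
    have "h1 = f - b0 * a0"
    proof (rule coproduct_unique[OF P h1 fb])
      fix i assume i: "i \<in> I"
      have "b0 * a0 * \<pi> i = b i * a i" using a0(2)[OF i] b0(2)[OF i] by (metis mult.assoc)
      thus "h1 * \<pi> i = (f - b0 * a0) * \<pi> i" using h0(2)[OF i] by (simp add: left_diff_distrib)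
    qed
    hence "f - b0 * a0 \<in> Bd P Y 0" using BdI[OF h0(1)] by simp
    thus ?thesis unfolding r.null_morphism_def using Q(1) a0(1) b0(1) by blast
  qed
  hence "P \<in> r.factor_to" using p(1) by (simp add: r.factor_to_def)
  thus "\<exists>P\<in>r.factor_to. \<exists>\<pi>. is_coproduct A I X P \<pi>" using P by blast
qed

end

section \<open>The minimal subcategories of acyclic objects\<close>

lemma totalizations_Ob: "totalizations E \<subseteq> Ob E"
  unfolding totalizations_def is_cone_def by blast

locale full_exact_dg_subcategory = full_dg_subcategory A A' F
  for A :: "('g::ab_group_add, 'o, 'm::ring, 'z) dgcat_scheme" and A' :: "('g, 'o, 'm) exact_dgcat" and F
begin

lemma Ac_abs_triangulated: "triangulated_sub A' (Ac_abs A')" "totalizations A' \<subseteq> Ac_abs A'"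
proof -
  have "thick_sub A' F" unfolding thick_sub_def using triangulated_sub_whole by (auto simp: cat_retract_def sub_H0)
  thus "triangulated_sub A' (Ac_abs A')" unfolding Ac_abs_def
    using totalizations_Ob[of A'] by (intro triangulated_sub_Inter) (auto simp: thick_sub_def Ob')
qed (auto simp: Ac_abs_def)

lemma Ac_ctr_triangulated:
  assumes F: "closed_under_products J A' F"
  shows "triangulated_sub A' (Ac_ctr J A')" "totalizations A' \<subseteq> Ac_ctr J A'" "closed_under_products J A' (Ac_ctr J A')"
proof -
  have m: "F \<in> {N. triangulated_sub A' N \<and> totalizations A' \<subseteq> N \<and> closed_under_products J A' N}"
    using triangulated_sub_whole F totalizations_Ob[of A'] by (simp add: Ob')
  show "triangulated_sub A' (Ac_ctr J A')" unfolding Ac_ctr_def using m by (intro triangulated_sub_Inter) auto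
  show "totalizations A' \<subseteq> Ac_ctr J A'" by (auto simp: Ac_ctr_def)
  show "closed_under_products J A' (Ac_ctr J A')" unfolding Ac_ctr_def using m by (intro products_Inter) auto
qed

lemma Ac_co_triangulated:
  assumes F: "closed_under_coproducts J A' F"
  shows "triangulated_sub A' (Ac_co J A')" "totalizations A' \<subseteq> Ac_co J A'" "closed_under_coproducts J A' (Ac_co J A')"
proof -
  have m: "F \<in> {N. triangulated_sub A' N \<and> totalizations A' \<subseteq> N \<and> closed_under_coproducts J A' N}"
    using triangulated_sub_whole F totalizations_Ob[of A'] by (simp add: Ob')
  show "triangulated_sub A' (Ac_co J A')" unfolding Ac_co_def using m by (intro triangulated_sub_Inter) auto
  show "totalizations A' \<subseteq> Ac_co J A'" by (auto simp: Ac_co_def)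
  show "closed_under_coproducts J A' (Ac_co J A')" unfolding Ac_co_def using m by (intro coproducts_Inter) auto
qed

end

section \<open>Full faithfulness for a DG-subpair\<close>

context dg_subpair
begin

text \<open>The only closed endomorphism of degree 0 of a zero object is 0, so its identity vanishes
  and is a coboundary.\<close>

lemma zero_object_contractible:
  assumes "additive_category (Z0 A')" and same: "Ob A' = F'" "F' \<subseteq> Ob E" "Idt A' = Idt E" "Cyc A' = Cyc E"
  shows "\<exists>X\<in>F'. Idt E X \<in> Bd X X 0"
proof -
  obtain X where "zero_object (Z0 A') X" using assms(1) by (auto simp: additive_category_def)
  hence X: "X \<in> F'" "Cyc E X X 0 = {0}" using same by (auto simp: zero_object_def Z0_def)
  have "X \<in> Ob E" using X same by blast
  thus ?thesis using X dd_idt[of X] Bd_zero[of X X] by (metis dd_Cyc singletonD)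
qed

text \<open>\<open>E\<close> is viewed as a full subcategory of itself, so that the facts on acyclic
  objects apply to \<open>E\<close> and to \<open>dg_sub E F\<close> alike.\<close>

lemma whole: "full_exact_dg_subcategory E E (Ob E)"
  using zero_object_contractible[OF additive refl] has_shifts has_cones dg
  by (simp add: full_exact_dg_subcategory_def full_dg_subcategory_def full_dg_subcategory_axioms_def)

lemma part: "full_exact_dg_subcategory E (dg_sub E F) F"
proof -
  have s: "sform (dg_sub E F) = sform E" "gone (dg_sub E F) = gone E" "Hom (dg_sub E F) = Hom E"
    "Idt (dg_sub E F) = Idt E" "Diff (dg_sub E F) = Diff E" "Ob (dg_sub E F) = F" by (simp_all add: dg_sub_def)
  have "Cyc (dg_sub E F) = Cyc E" by (intro ext) (simp add: Cyc_def s)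
  hence "\<exists>X\<in>F. Idt E X \<in> Bd X X 0" using zero_object_contractible[OF F_additive] F_sub s by blast
  thus ?thesis using F_shifts F_cones F_sub dg s
    by (simp add: full_exact_dg_subcategory_def full_dg_subcategory_def full_dg_subcategory_axioms_def)
qed

sublocale whole: full_exact_dg_subcategory E E "Ob E" by (rule whole)

sublocale part: full_exact_dg_subcategory E "dg_sub E F" F by (rule part)

lemma ses_part: "ses (dg_sub E F) = seqs_in F (ses E)"
  by (simp add: dg_sub_def)

lemma totalizations_part: "totalizations (dg_sub E F) \<subseteq> totalizations E"
  unfolding totalizations_def ses_part part.sub_is_cone seqs_in_def by blast

lemma acyclicI:
  assumes "triangulated_sub (dg_sub E F) N'" and t: "totalizations (dg_sub E F) \<subseteq> N'"
  shows "dg_subpair_acyclic E K F L N'"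
proof -
  interpret r: rel_triangulated E F N' using assms by (simp add: part.triangulated_sub_iff)
  show ?thesis
  proof unfold_locales
    fix R r X a Y C q p j i T q' p' j' i'
    assume s: "(R, r, X, a, Y) \<in> seqs_in F (ses E)" and c: "cone R r X C q p j i" "cone C (a * q) Y T q' p' j' i'"
      and F: "C \<in> F" "T \<in> F"
    have "is_cone (dg_sub E F) R r X C q p" "is_cone (dg_sub E F) C (a * q) Y T q' p'"
      using s c F cone_imp_is_cone by (auto simp: part.sub_is_cone seqs_in_def)
    hence "T \<in> totalizations (dg_sub E F)" using s ses_part unfolding totalizations_def by blast
    thus "T \<in> N'" using t by blast
  qed
qed

lemma totalizations_factor_from:
  assumes "dg_subpair_acyclic E K F L N'" "self_resolving (pair_cat E K) (pair_ses E K) L"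
  shows "totalizations E \<subseteq> rel_triangulated.factor_from E F N'"
proof -
  interpret a: dg_subpair_acyclic E K F L N' by fact
  show ?thesis using a.totalization_factor_from[OF assms(2)] unfolding totalizations_def is_cone_iff by blast
qed

lemma totalizations_factor_to:
  assumes "dg_subpair_acyclic E K F L N'" "self_coresolving (pair_cat E K) (pair_ses E K) L"
  shows "totalizations E \<subseteq> rel_triangulated.factor_to E F N'"
proof -
  interpret a: dg_subpair_acyclic E K F L N' by fact
  show ?thesis using a.totalization_factor_to[OF assms(2)] unfolding totalizations_def is_cone_iff by blast
qed

lemma fully_faithful_verdier:
  assumes N: "rel_triangulated E (Ob E) N" and N': "rel_triangulated E F N'" and sub: "N' \<subseteq> N"
    and f: "N \<subseteq> rel_triangulated.factor_from E F N' \<or> N \<subseteq> rel_triangulated.factor_to E F N'"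
  shows "fully_faithful (verdier_quotient (dg_sub E F) N') (verdier_quotient E N) id (inclusion_map E N)"
proof -
  interpret t: triangulated_pair E N F N'
    using N N' sub dg by (simp add: triangulated_pair_def triangulated_pair_axioms_def)
  have "fractions_subcat (H0 E) t.big.denominators F t.small.denominators"
    using f
  proof
    assume "N \<subseteq> t.small.factor_from"
    thus ?thesis by (intro t.fractions_subcat_from) (auto simp: t.small.factor_from_def)
  next
    assume "N \<subseteq> t.small.factor_to"
    thus ?thesis by (intro t.fractions_subcat_to) (auto simp: t.small.factor_to_def)
  qed
  from fractions_subcat.fully_faithful_localization[OF this]
  show ?thesis
    unfolding verdier_quotient_def inclusion_map_def part.sub_H0 whole.sub_denominators[OF N] part.sub_denominators[OF N'] .
qed

lemma D_abs_fully_faithful: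
  assumes "self_resolving (pair_cat E K) (pair_ses E K) L \<or> self_coresolving (pair_cat E K) (pair_ses E K) L"
  shows "fully_faithful (D_abs (dg_sub E F)) (D_abs E) id (inclusion_map E (Ac_abs E))"
proof -
  note N = whole.Ac_abs_triangulated note N' = part.Ac_abs_triangulated
  have a: "dg_subpair_acyclic E K F L (Ac_abs (dg_sub E F))" using acyclicI N' by blast
  then interpret a: dg_subpair_acyclic E K F L "Ac_abs (dg_sub E F)" .
  \<comment> \<open>Each thick subcategory that competes in the definition of
    \<open>Ac_abs E\<close> restricts to a competitor in the definition for
    \<open>F\<close>.\<close>
  have "Ac_abs (dg_sub E F) \<subseteq> X" if X: "thick_sub E X" "totalizations E \<subseteq> X" for X
  proof -
    have "rel_triangulated E (Ob E) X" using X by (simp add: thick_sub_def whole.triangulated_sub_iff)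
    hence "thick_sub (dg_sub E F) (X \<inter> F)" using part.thick_sub_restrict X(1) by blast
    moreover have "totalizations (dg_sub E F) \<subseteq> X \<inter> F"
      using totalizations_part X(2) totalizations_Ob[of "dg_sub E F"] by (auto simp: part.Ob')
    ultimately show ?thesis unfolding Ac_abs_def by blast
  qed
  hence sub: "Ac_abs (dg_sub E F) \<subseteq> Ac_abs E" unfolding Ac_abs_def[of E] by blast
  \<comment> \<open>By minimality: \<open>factor_from\<close> or \<open>factor_to\<close>, according
    to the hypothesis, is itself a thick subcategory containing the totalizations.\<close>
  have "Ac_abs E \<subseteq> a.factor_from \<or> Ac_abs E \<subseteq> a.factor_to"
    using assms totalizations_factor_from[OF a] totalizations_factor_to[OF a] a.factor_from_thick a.factor_to_thick
    unfolding Ac_abs_def[of E] by blast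
  thus ?thesis unfolding D_abs_def
    using fully_faithful_verdier[OF N(1)[unfolded whole.triangulated_sub_iff] N'(1)[unfolded part.triangulated_sub_iff] sub]
    by blast
qed

lemma D_ctr_fully_faithful:
  assumes res: "self_resolving (pair_cat E K) (pair_ses E K) L"
    and E: "closed_under_products J E (Ob E)" and F: "closed_under_products J E F"
  shows "fully_faithful (D_ctr J (dg_sub E F)) (D_ctr J E) id (inclusion_map E (Ac_ctr J E))"
proof -
  note N = whole.Ac_ctr_triangulated[OF E] note N' = part.Ac_ctr_triangulated[OF part.sub_products[OF F]]
  have a: "dg_subpair_acyclic E K F L (Ac_ctr J (dg_sub E F))" using acyclicI N' by blast
  then interpret a: dg_subpair_acyclic E K F L "Ac_ctr J (dg_sub E F)" .
  \<comment> \<open>The right-hand side competes in the definition of the left: a product taken in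
    \<open>F\<close> is homotopy equivalent to one in \<open>Ac_ctr J E\<close>, so the intersection
    is closed under products.\<close>
  have "Ac_ctr J (dg_sub E F) \<subseteq> Ac_ctr J E \<inter> F"
    unfolding Ac_ctr_def[of J "dg_sub E F"]
    using part.triangulated_sub_restrict[OF N(1)[unfolded whole.triangulated_sub_iff]]
      part.products_restrict[OF N(1)[unfolded whole.triangulated_sub_iff] N(3) F]
      totalizations_part N(2) totalizations_Ob[of "dg_sub E F"] by (intro Inter_lower) (auto simp: part.Ob')
  hence sub: "Ac_ctr J (dg_sub E F) \<subseteq> Ac_ctr J E" by blast
  have "Ac_ctr J E \<subseteq> a.factor_from"
    unfolding Ac_ctr_def[of J E]
    using totalizations_factor_from[OF a res] a.factor_from_triangulated
      part.factor_from_products[OF a.rel_triangulated_axioms E N'(3)] by (intro Inter_lower) simp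
  thus ?thesis unfolding D_ctr_def
    using fully_faithful_verdier[OF N(1)[unfolded whole.triangulated_sub_iff] N'(1)[unfolded part.triangulated_sub_iff] sub]
    by blast
qed

lemma D_co_fully_faithful:
  assumes res: "self_coresolving (pair_cat E K) (pair_ses E K) L"
    and E: "closed_under_coproducts J E (Ob E)" and F: "closed_under_coproducts J E F"
  shows "fully_faithful (D_co J (dg_sub E F)) (D_co J E) id (inclusion_map E (Ac_co J E))"
proof -
  note N = whole.Ac_co_triangulated[OF E] note N' = part.Ac_co_triangulated[OF part.sub_coproducts[OF F]]
  have a: "dg_subpair_acyclic E K F L (Ac_co J (dg_sub E F))" using acyclicI N' by blast
  then interpret a: dg_subpair_acyclic E K F L "Ac_co J (dg_sub E F)" .
  have "Ac_co J (dg_sub E F) \<subseteq> Ac_co J E \<inter> F"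
    unfolding Ac_co_def[of J "dg_sub E F"]
    using part.triangulated_sub_restrict[OF N(1)[unfolded whole.triangulated_sub_iff]]
      part.coproducts_restrict[OF N(1)[unfolded whole.triangulated_sub_iff] N(3) F]
      totalizations_part N(2) totalizations_Ob[of "dg_sub E F"] by (intro Inter_lower) (auto simp: part.Ob')
  hence sub: "Ac_co J (dg_sub E F) \<subseteq> Ac_co J E" by blast
  have "Ac_co J E \<subseteq> a.factor_to"
    unfolding Ac_co_def[of J E]
    using totalizations_factor_to[OF a res] a.factor_to_triangulated
      part.factor_to_coproducts[OF a.rel_triangulated_axioms E N'(3)] by (intro Inter_lower) simp
  thus ?thesis unfolding D_co_def
    using fully_faithful_verdier[OF N(1)[unfolded whole.triangulated_sub_iff] N'(1)[unfolded part.triangulated_sub_iff] sub]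
    by blast
qed

end

theorem theorem7p9:
  fixes E :: "('g::ab_group_add, 'o, 'm::ring) exact_dgcat"
    and K L M :: "('o \<times> 'm) set"
    and F G :: "'o set"
    and J :: "'i set set"
  assumes "exact_dg_pair E K"
    and "exact_dg_subpair E K F L"
    and "exact_dg_subpair E K G M"
    and "small_index_sets J"
  shows "(self_resolving (pair_cat E K) (pair_ses E K) L \<longrightarrow>
            fully_faithful (D_abs (dg_sub E F)) (D_abs E) id (inclusion_map E (Ac_abs E)) \<and>
            (exact_products J E \<and> closed_under_products J E F \<longrightarrow>
               fully_faithful (D_ctr J (dg_sub E F)) (D_ctr J E) id (inclusion_map E (Ac_ctr J E)))) \<and>
         (self_coresolving (pair_cat E K) (pair_ses E K) M \<longrightarrow>
            fully_faithful (D_abs (dg_sub E G)) (D_abs E) id (inclusion_map E (Ac_abs E)) \<and>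
            (exact_coproducts J E \<and> closed_under_coproducts J E G \<longrightarrow>
               fully_faithful (D_co J (dg_sub E G)) (D_co J E) id (inclusion_map E (Ac_co J E))))"
proof -
  interpret F: dg_subpair E K F L using assms(1,2) by unfold_locales
  interpret G: dg_subpair E K G M using assms(1,3) by unfold_locales
  have "exact_products J E \<Longrightarrow> closed_under_products J E (Ob E)"
    "exact_coproducts J E \<Longrightarrow> closed_under_coproducts J E (Ob E)"
    by (simp_all add: exact_products_def exact_coproducts_def)
  thus ?thesis
    using F.D_abs_fully_faithful G.D_abs_fully_faithful F.D_ctr_fully_faithful G.D_co_fully_faithful
    by blast
qed

end
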